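(* In the basis $\mathbf B_1=\{b_p\}$ of $W^{(N)}(b)$ the Gram matrix $G=(\langle b_p|b_{p'}\rangle)_{p,p'}$ is diagonal.
   Context: Let $N\ge2$. Fix complex numbers $\eta,\omega_1,\omega_2,\theta$; write $q^x=e^{\eta x}$ and $[x]=\frac{q^x-q^{-x}}{q-q^{-1}}$. Assume genericity: $q$ is not a root of unity, $[\omega_1-m]\neq0$ for all $m\in\mathbb Z$, and $[\omega_2],[\omega_2+1]\ne0$. Put $\delta=[2]$, $s_1=\frac{[\omega_1]}{[\omega_1+1]}$, $s_2=\frac{[\omega_2]}{[\omega_2+1]}$. The 2BTL algebra is the unital complex algebra with generators $e_0,\dots,e_N$ and relations $e_i^2=\delta e_i$, $e_ie_{i\pm1}e_i=e_i$ for $1\le i\le N-1$ (with $i\pm1\in\{0,\dots,N\}$), $e_0^2=s_1e_0$, $e_N^2=s_2e_N$, $e_ie_j=e_je_i$ for $|i-j|>1$. For $N$ even set $I_1=e_1e_3\cdots e_{N-1}$, $I_2=e_0e_2\cdots e_N$ and $b=\frac{[(\omega_1+\omega_2+1+\theta)/2][(\omega_1+\omega_2+1-\theta)/2]}{[\omega_1+1][\omega_2+1]}$; for $N$ odd set $I_1=e_1e_3\cdots e_N$, $I_2=e_0e_2\cdots e_{N-1}$ and $b=-\frac{[(\omega_1-\omega_2+\theta)/2][(\omega_1-\omega_2-\theta)/2]}{[\omega_1+1][\omega_2+1]}$. The double quotient $\mathcal A_b$ is the quotient of 2BTL by $I_1I_2I_1=bI_1$, $I_2I_1I_2=bI_2$.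 Define $E_0=1$ and $E_i=s_1^{(-1)^i}E_{i-1}e_{i-1}E_{i-1}$ for $1\le i\le N$ (idempotents). The $2^N$-dimensional module $W^{(N)}(b)$ is realised as the left ideal $\mathcal A_bE_N$. Bilinear form: let $a\mapsto a^T$ be the anti-automorphism of $\mathcal A_b$ fixing every $e_i$. One has $E_N^T=E_N$ and $E_N\mathcal A_bE_N=\mathbb C E_N$, and the symmetric bilinear form on $W^{(N)}(b)$ is defined by $E_Na^Ta'E_N=\langle aE_N|a'E_N\rangle E_N$. In particular $\langle E_N|E_N\rangle=1$. Put $r(u)=\frac{[u+1]}{[u]}$, $k(u)=-\frac{[(u-\omega_2+\theta)/2][(u-\omega_2-\theta)/2]}{[u][\omega_2+1]}$, $R_i(u)=e_i-r(u)$, $K_N(u)=e_N-k(u)$. A path is $p=(h_0,\dots,h_N)$ with $h_0=0$, $h_{i+1}-h_i=\pm1$. The fundamental path is $p_0=(0,-1,0,-1,0,\dots)$. A path $p'$ is obtained from $p$ by adding a tile at point $i$ ($1\le i\le N-1$) if they agree except at $i$, $h_{i-1}=h_{i+1}$, and: either $h_{i-1}\ge0$, $h_i=h_{i-1}-1$, $h_i'=h_{i-1}+1$ (tile added from above), or $h_{i-1}<0$, $h_i=h_{i-1}+1$, $h'_i=h_{i-1}-1$ (tile added from below). It is obtained by adding a right boundary half-tile if they agree except at $N$ and the same conditions hold with $i=N$ (omitting the condition on $h_{i+1}$). Every path is obtained from $p_0$ by successive additions. The basis $\mathbf B_1=\{b_p\}$ of $W^{(N)}(b)$ is defined by $b_{p_0}=E_N$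 and $b_{p'}=X_ib_p$ when $p'$ is obtained from $p$ by adding a tile or half-tile at $i$, where: from above, $X_i=R_i(\omega_1-h_{i-1})$ for $i<N$, and $X_N=K_N(\omega_1-h_{N-1})$; from below, $X_i=R_i(-\omega_1+h_{i-1})$ for $i<N$, and $X_N=K_N(-\omega_1+h_{N-1})$. (This is independent of the order of additions.) *)

theory Defs
  imports Complex_Main "HOL-Library.Poly_Mapping" "HOL-Algebra.QuotRing"
begin

section \<open>The free algebra on \<open>e\<^sub>0, \<dots>, e\<^sub>N\<close>\<close>

text \<open>
  dq_alg word in the generators is wrapped in a datatype, so that concatenation can be written as
  addition and the convolution product of finitely supported functions from words to \<open>complex\<close>
  is the product of the free algebra.
\<close>

datatype word = Word (letters: "nat list")

instantiation word :: monoid_add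
begin

definition zero_word :: word where "0 = Word []"

definition plus_word :: "word \<Rightarrow> word \<Rightarrow> word"
  where "v + w = Word (letters v @ letters w)"

instance
  by standard (simp_all add: zero_word_def plus_word_def)

end

lemma letters_zero [simp]: "letters 0 = []"
  by (simp add: zero_word_def)

lemma letters_plus [simp]: "letters (v + w) = letters v @ letters w"
  by (simp add: plus_word_def)

type_synonym free_elem = "word \<Rightarrow>\<^sub>0 complex"

definition monom_word :: "nat list \<Rightarrow> free_elem"
  where "monom_word l = Poly_Mapping.single (Word l) 1"

definition scalar :: "complex \<Rightarrow> free_elem"
  where "scalar c = Poly_Mapping.single 0 c"

definition free_carrier :: "nat \<Rightarrow> free_elem set"
  where "free_carrier N = {f. \<forall>w \<in> Poly_Mapping.keys f. set (letters w) \<subseteq> {..N}}"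

definition free_alg :: "nat \<Rightarrow> free_elem ring"
  where "free_alg N =
    \<lparr>carrier = free_carrier N, mult = (*), one = 1, zero = 0, add = (+)\<rparr>"

definition word_rev :: "word \<Rightarrow> word"
  where "word_rev w = Word (rev (letters w))"

text \<open>Word reversal, extended linearly (\<^const>\<open>word_rev\<close> is an involution).\<close>

definition free_rev :: "free_elem \<Rightarrow> free_elem"
  where "free_rev f = Poly_Mapping.map_key word_rev f"

section \<open>Quantum numbers\<close>

definition qpow :: "complex \<Rightarrow> complex \<Rightarrow> complex"
  where "qpow \<eta> x = exp (\<eta> * x)"

definition qnum :: "complex \<Rightarrow> complex \<Rightarrow> complex"
  where "qnum \<eta> x = (qpow \<eta> x - qpow \<eta> (- x)) / (qpow \<eta> 1 - qpow \<eta> (- 1))"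

section \<open>Paths\<close>

definition paths :: "nat \<Rightarrow> int list set"
  where "paths N = {p. length p = N + 1 \<and> p ! 0 = 0 \<and> (\<forall>i<N. \<bar>p ! (i + 1) - p ! i\<bar> = 1)}"

definition fundamental_path :: "nat \<Rightarrow> int list"
  where "fundamental_path N = map (\<lambda>i. if even i then 0 else -1) [0..<N + 1]"

text \<open>
  Both relations cover tiles (\<open>1 \<le> i \<le> N - 1\<close>) and right boundary half-tiles (\<open>i = N\<close>,
  without a condition on \<open>h\<^bsub>i+1\<^esub>\<close>).
\<close>

definition add_above :: "nat \<Rightarrow> int list \<Rightarrow> nat \<Rightarrow> int list \<Rightarrow> bool"
  where "add_above N p i p' \<longleftrightarrow>
    1 \<le> i \<and> i \<le> N \<and> (i < N \<longrightarrow> p ! (i - 1) = p ! (i + 1)) \<and>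
    p ! (i - 1) \<ge> 0 \<and> p ! i = p ! (i - 1) - 1 \<and> p' = p[i := p ! (i - 1) + 1]"

definition add_below :: "nat \<Rightarrow> int list \<Rightarrow> nat \<Rightarrow> int list \<Rightarrow> bool"
  where "add_below N p i p' \<longleftrightarrow>
    1 \<le> i \<and> i \<le> N \<and> (i < N \<longrightarrow> p ! (i - 1) = p ! (i + 1)) \<and>
    p ! (i - 1) < 0 \<and> p ! i = p ! (i - 1) + 1 \<and> p' = p[i := p ! (i - 1) - 1]"

section \<open>The algebra, the module, the bilinear form and the basis\<close>

context
  fixes N :: nat and \<eta> \<omega>\<^sub>1 \<omega>\<^sub>2 \<theta> :: complex
begin

abbreviation qn :: "complex \<Rightarrow> complex" where "qn \<equiv> qnum \<eta>"

definition s1_par :: complex where "s1_par = qn \<omega>\<^sub>1 / qn (\<omega>\<^sub>1 + 1)"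

definition s2_par :: complex where "s2_par = qn \<omega>\<^sub>2 / qn (\<omega>\<^sub>2 + 1)"

definition b_weight :: complex
  where "b_weight =
    (if even N
     then qn ((\<omega>\<^sub>1 + \<omega>\<^sub>2 + 1 + \<theta>) / 2) * qn ((\<omega>\<^sub>1 + \<omega>\<^sub>2 + 1 - \<theta>) / 2)
          / (qn (\<omega>\<^sub>1 + 1) * qn (\<omega>\<^sub>2 + 1))
     else - (qn ((\<omega>\<^sub>1 - \<omega>\<^sub>2 + \<theta>) / 2) * qn ((\<omega>\<^sub>1 - \<omega>\<^sub>2 - \<theta>) / 2))
          / (qn (\<omega>\<^sub>1 + 1) * qn (\<omega>\<^sub>2 + 1)))"

text \<open>A relation \<open>l = r\<close> is represented by the element \<open>l - r\<close> of the free algebra.\<close>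

definition tbtl_relators :: "free_elem set"
  where "tbtl_relators =
      {monom_word [i, i] - scalar (qn 2) * monom_word [i] | i. 1 \<le> i \<and> i < N}
    \<union> {monom_word [i, i + 1, i] - monom_word [i] | i. 1 \<le> i \<and> i < N}
    \<union> {monom_word [i, i - 1, i] - monom_word [i] | i. 1 \<le> i \<and> i < N}
    \<union> {monom_word [0, 0] - scalar s1_par * monom_word [0]}
    \<union> {monom_word [N, N] - scalar s2_par * monom_word [N]}
    \<union> {monom_word [i, j] - monom_word [j, i] | i j.
         i \<le> N \<and> j \<le> N \<and> \<bar>int i - int j\<bar> > 1}"

text \<open>
  For even \<open>N\<close> the odd indices up to \<open>N\<close> are \<open>1, 3, \<dots>, N - 1\<close> and the even ones
  \<open>0, 2, \<dots>, N\<close>; for odd \<open>N\<close> they are \<open>1, 3, \<dots>, N\<close> and \<open>0, 2, \<dots>, N - 1\<close>.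
\<close>

definition I1_elem :: free_elem where "I1_elem = monom_word (filter odd [0..<N + 1])"

definition I2_elem :: free_elem where "I2_elem = monom_word (filter even [0..<N + 1])"

definition dq_relators :: "free_elem set"
  where "dq_relators =
      {I1_elem * I2_elem * I1_elem - scalar b_weight * I1_elem,
       I2_elem * I1_elem * I2_elem - scalar b_weight * I2_elem}"

text \<open>
  The quotient of 2BTL by the two further relations is presented in one step, as the quotient of
  the free algebra by all the relations together.
\<close>

definition dq_ideal :: "free_elem set"
  where "dq_ideal = genideal (free_alg N) (tbtl_relators \<union> dq_relators)"

definition dq_alg :: "free_elem set ring" where "dq_alg = free_alg N Quot dq_ideal"

definition coset_of :: "free_elem \<Rightarrow> free_elem set"
  where "coset_of f = dq_ideal +>\<^bsub>free_alg N\<^esub> f"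

definition egen :: "nat \<Rightarrow> free_elem set" where "egen i = coset_of (monom_word [i])"

definition scale_by :: "complex \<Rightarrow> free_elem set \<Rightarrow> free_elem set"
  where "scale_by c x = coset_of (scalar c) \<otimes>\<^bsub>dq_alg\<^esub> x"

text \<open>
  The anti-automorphism \<open>a \<mapsto> a\<^sup>T\<close> fixing every \<open>e\<^sub>i\<close>: word reversal preserves the ideal, so the
  image of a coset is the coset of the reversed representative.
\<close>

definition transpose_el :: "free_elem set \<Rightarrow> free_elem set"
  where "transpose_el x = free_rev ` x"

primrec E_idem :: "nat \<Rightarrow> free_elem set"
  where
    "E_idem 0 = \<one>\<^bsub>dq_alg\<^esub>"
  | "E_idem (Suc i) =
      scale_by (s1_par powi ((-1) ^ Suc i))
        (E_idem i \<otimes>\<^bsub>dq_alg\<^esub> egen i \<otimes>\<^bsub>dq_alg\<^esub> E_idem i)"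

definition W_mod :: "free_elem set set"
  where "W_mod = {a \<otimes>\<^bsub>dq_alg\<^esub> E_idem N | a. a \<in> carrier dq_alg}"

text \<open>
  For \<open>x, y\<close> in \<^const>\<open>W_mod\<close>, the value \<open>\<langle>x|y\<rangle>\<close> is the scalar satisfying the defining
  equation for all ways of writing \<open>x = a E\<^sub>N\<close> and \<open>y = a' E\<^sub>N\<close>.
\<close>

definition gform :: "free_elem set \<Rightarrow> free_elem set \<Rightarrow> complex"
  where "gform x y = (THE c. \<forall>a \<in> carrier dq_alg. \<forall>a' \<in> carrier dq_alg.
    x = a \<otimes>\<^bsub>dq_alg\<^esub> E_idem N \<longrightarrow> y = a' \<otimes>\<^bsub>dq_alg\<^esub> E_idem N \<longrightarrow>
    E_idem N \<otimes>\<^bsub>dq_alg\<^esub> transpose_el a \<otimes>\<^bsub>dq_alg\<^esub> a' \<otimes>\<^bsub>dq_alg\<^esub> E_idem N = scale_by c (E_idem N))"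

definition r_fun :: "complex \<Rightarrow> complex" where "r_fun u = qn (u + 1) / qn u"

definition k_fun :: "complex \<Rightarrow> complex"
  where "k_fun u = - (qn ((u - \<omega>\<^sub>2 + \<theta>) / 2) * qn ((u - \<omega>\<^sub>2 - \<theta>) / 2)) / (qn u * qn (\<omega>\<^sub>2 + 1))"

definition R_op :: "nat \<Rightarrow> complex \<Rightarrow> free_elem set"
  where "R_op i u = egen i \<ominus>\<^bsub>dq_alg\<^esub> scale_by (r_fun u) \<one>\<^bsub>dq_alg\<^esub>"

definition K_op :: "complex \<Rightarrow> free_elem set"
  where "K_op u = egen N \<ominus>\<^bsub>dq_alg\<^esub> scale_by (k_fun u) \<one>\<^bsub>dq_alg\<^esub>"

definition X_op :: "nat \<Rightarrow> complex \<Rightarrow> free_elem set"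
  where "X_op i u = (if i < N then R_op i u else K_op u)"

text \<open>\<open>builds p x\<close>: some sequence of tile additions leading from the fundamental path to \<open>p\<close>
  produces the module element \<open>x\<close>.\<close>

inductive builds :: "int list \<Rightarrow> free_elem set \<Rightarrow> bool"
  where
    base: "builds (fundamental_path N) (E_idem N)"
  | above: "\<lbrakk>builds p x; add_above N p i p'\<rbrakk>
      \<Longrightarrow> builds p' (X_op i (\<omega>\<^sub>1 - of_int (p ! (i - 1))) \<otimes>\<^bsub>dq_alg\<^esub> x)"
  | below: "\<lbrakk>builds p x; add_below N p i p'\<rbrakk>
      \<Longrightarrow> builds p' (X_op i (- \<omega>\<^sub>1 + of_int (p ! (i - 1))) \<otimes>\<^bsub>dq_alg\<^esub> x)"

text \<open>The description is definite because the result does not depend on the order of the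
  additions.\<close>

definition basis_elt :: "int list \<Rightarrow> free_elem set"
  where "basis_elt p = (THE x. builds p x)"

definition gram :: "int list \<Rightarrow> int list \<Rightarrow> complex"
  where "gram p p' = gform (basis_elt p) (basis_elt p')"

end

section \<open>Well-formedness of the presentation\<close>

text \<open>
  \<^const>\<open>genideal\<close> is the intersection of all ideals of the ring, hence degenerate if the record is
  not a ring; the following facts exclude this.
\<close>

lemma free_carrier_closed:
  shows "0 \<in> free_carrier N" and "1 \<in> free_carrier N"
    and "scalar c \<in> free_carrier N"
    and "set l \<subseteq> {..N} \<Longrightarrow> monom_word l \<in> free_carrier N"
    and "f \<in> free_carrier N \<Longrightarrow> - f \<in> free_carrier N"
    and "f \<in> free_carrier N \<Longrightarrow> g \<in> free_carrier N \<Longrightarrow> f + g \<in> free_carrier N"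
    and "f \<in> free_carrier N \<Longrightarrow> g \<in> free_carrier N \<Longrightarrow> f - g \<in> free_carrier N"
    and "f \<in> free_carrier N \<Longrightarrow> g \<in> free_carrier N \<Longrightarrow> f * g \<in> free_carrier N"
proof -
  show "0 \<in> free_carrier N" "1 \<in> free_carrier N"
    by (simp_all add: free_carrier_def)
  show "scalar c \<in> free_carrier N"
    by (simp add: free_carrier_def scalar_def)
  show "monom_word l \<in> free_carrier N" if "set l \<subseteq> {..N}"
    using that by (simp add: free_carrier_def monom_word_def)
  show minus: "- f \<in> free_carrier N" if "f \<in> free_carrier N" for f
    using that by (simp add: free_carrier_def)
  show plus: "f + g \<in> free_carrier N" if "f \<in> free_carrier N" "g \<in> free_carrier N" for f g
    using that Poly_Mapping.keys_add[of f g] by (auto simp: free_carrier_def)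
  show "f - g \<in> free_carrier N" if "f \<in> free_carrier N" "g \<in> free_carrier N"
    using plus[OF that(1) minus[OF that(2)]] by simp
  show "f * g \<in> free_carrier N" if "f \<in> free_carrier N" "g \<in> free_carrier N"
    using that Poly_Mapping.keys_mult[of f g] by (fastforce simp: free_carrier_def)
qed

lemma ring_free_alg: "ring (free_alg N)"
proof (rule ringI)
  show "abelian_group (free_alg N)"
  proof (rule abelian_groupI)
    fix x assume "x \<in> carrier (free_alg N)"
    then show "\<exists>y\<in>carrier (free_alg N). y \<oplus>\<^bsub>free_alg N\<^esub> x = \<zero>\<^bsub>free_alg N\<^esub>"
      by (intro bexI[of _ "- x"]) (simp_all add: free_alg_def free_carrier_closed)
  qed (simp_all add: free_alg_def free_carrier_closed add_ac)
  show "Group.monoid (free_alg N)"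
    by (rule monoidI) (simp_all add: free_alg_def free_carrier_closed mult.assoc)
qed (simp_all add: free_alg_def algebra_simps)

lemma relators_carrier:
  assumes "N \<ge> 2"
  shows "tbtl_relators N \<eta> \<omega>\<^sub>1 \<omega>\<^sub>2 \<union> dq_relators N \<eta> \<omega>\<^sub>1 \<omega>\<^sub>2 \<theta> \<subseteq> carrier (free_alg N)"
  using assms
  by (auto simp: tbtl_relators_def dq_relators_def I1_elem_def I2_elem_def free_alg_def
           intro!: free_carrier_closed)

lemma ideal_dq_ideal:
  assumes "N \<ge> 2"
  shows "ideal (dq_ideal N \<eta> \<omega>\<^sub>1 \<omega>\<^sub>2 \<theta>) (free_alg N)"
  unfolding dq_ideal_def
  by (rule ring.genideal_ideal[OF ring_free_alg relators_carrier[OF assms]])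

lemma ring_dq_alg:
  assumes "N \<ge> 2"
  shows "ring (dq_alg N \<eta> \<omega>\<^sub>1 \<omega>\<^sub>2 \<theta>)"
  unfolding dq_alg_def by (rule ideal.quotient_is_ring[OF ideal_dq_ideal[OF assms]])

end

theory Submission
  imports Defs
begin

text \<open>
  Jucys--Murphy elements \<open>J\<^sub>n\<close> of the one-boundary subalgebra are fixed by the transposition and
  act diagonally on the basis: the eigenvalue of \<open>J\<^sub>n\<close> on \<open>b\<^sub>p\<close> is \<open>q\<^bsup>n - 1\<^esup> q\<^bsup>x\<^esup>\<close> or \<open>q\<^bsup>n - 1\<^esup> q\<^bsup>-x\<^esup>\<close>
  with \<open>x = \<omega>\<^sub>1 - h\<^bsub>n-1\<^esub>\<close>, according to whether step \<open>n\<close> of \<open>p\<close> goes down or up. By genericity, two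
  different paths are told apart at their first point of difference, so \<open>b\<^sub>p\<^sup>T b\<^bsub>p'\<^esub> = 0\<close>.

  The diagonal action follows by induction on \<open>n\<close> from \<open>2 \<times> 2\<close> blocks once \<open>e\<^sub>i b\<^sub>p = 0\<close> is known at
  every slope \<open>h\<^bsub>i-1\<^esub> \<noteq> h\<^bsub>i+1\<^esub>\<close>. Removing tiles reduces this vanishing, by the Yang--Baxter and
  reflection equations, to paths with heights in \<open>{0, -1}\<close> near \<open>i\<close>. There it is a property of
  \<open>E\<^sub>N\<close>; the double quotient relation is used only for \<open>e\<^bsub>N-1\<^esub> e\<^sub>N E\<^sub>N = \<kappa> e\<^bsub>N-1\<^esub> E\<^sub>N\<close>.

  The value of the form is well defined only if \<open>E\<^sub>N \<noteq> 0\<close>. If \<open>E\<^sub>N\<close> vanished, so would \<open>I\<^sub>1\<close>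
  (\<open>N\<close> even) or \<open>I\<^sub>2\<close> (\<open>N\<close> odd), but this element acts nontrivially on an XXZ spin chain with rank
  one boundary terms.
\<close>

section \<open>The one-boundary Temperley--Lieb part and the idempotents\<close>

text \<open>The elements T = e_n - q are Hecke generators: T is -q where e_n = 0 and 1/q where e_n =
  [2]. With them J_{n+1} = T J_n T, and J_1 is the affine function of e_0 with value
  \<open>qpow \<eta> (- \<omega>\<^sub>1)\<close> at e_0 = 0 and
  \<open>qpow \<eta> \<omega>\<^sub>1\<close> at e_0 = s_1. With this start the exponents in the
  eigenvalues are, up to sign, the spectral parameters of the tiles, and T J_n T is diagonal on a
  pair of paths differing by one tile because r(u) - q = q^{-u}/[u]. The constants s_1, 1/s_1 and b
  (or b/s_1) are the values of r and k for the tiles that lie directly on the fundamental path. So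
  one relation, e_i e_{i+1} b_p = weight e_i b_p, covers bulk and boundary near the centre.
  Everything is an identity between elements of the algebra; no linear independence of the b_p
  enters. One removed tile does not suffice for the slopes: Yang-Baxter takes two and the reflection
  equation up to three, whence the complete induction on an area.\<close>

lemma mult_eq_assoc: "x * y = z \<Longrightarrow> x * (y * w) = z * (w::'a::semigroup_mult)"
  by (simp add: mult.assoc[symmetric])

text \<open>The sort \<open>{ring,monoid_mult}\<close> instead of \<open>ring_1\<close> leaves 1 = 0
  possible: that the quotient does not collapse is a separate matter, settled by the spin
  chain.\<close>

locale complex_algebra = vector_space scale
  for scale :: "complex \<Rightarrow> 'a::{ring,monoid_mult} \<Rightarrow> 'a" (infixr "*s" 75) +
  assumes scale_mult_left [simp]: "(c *s x) * y = c *s (x * y)"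
    and scale_mult_right [simp]: "x * (c *s y) = c *s (x * y)"

locale one_boundary_TL = complex_algebra scale
  for scale :: "complex \<Rightarrow> 'a::{ring,monoid_mult} \<Rightarrow> 'a" (infixr "*s" 75) +
  fixes e :: "nat \<Rightarrow> 'a" and N :: nat and s :: complex
  assumes N_ge_2: "N \<ge> 2" and s_nonzero: "s \<noteq> 0"
    and e_up: "1 \<le> i \<Longrightarrow> i < N \<Longrightarrow> e i * e (Suc i) * e i = e i"
    and e_down: "1 \<le> i \<Longrightarrow> i < N \<Longrightarrow> e i * e (i - 1) * e i = e i"
    and e_zero_sq: "e 0 * e 0 = s *s e 0"
    and e_comm: "i \<le> N \<Longrightarrow> j \<le> N \<Longrightarrow> Suc i < j \<Longrightarrow> e i * e j = e j * e i"
begin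

text \<open>This is s^{(-1)^n}, the inverse of the factor that normalises E_{n+1}.\<close>

definition cf :: "nat \<Rightarrow> complex"
  where "cf j = (if even j then s else 1 / s)"

lemma cf_nonzero [simp]: "cf j \<noteq> 0"
  using s_nonzero by (simp add: cf_def)

lemma cf_Suc: "cf (Suc j) = 1 / cf j"
  using s_nonzero by (simp add: cf_def)

primrec E :: "nat \<Rightarrow> 'a"
  where
    "E 0 = 1"
  | "E (Suc n) = (1 / cf n) *s (E n * e n * E n)"

declare E.simps(2) [simp del]

text \<open>\<open>E n\<close> is a polynomial in e_0, ..., e_{n-1}.\<close>

lemma E_comm: "n < j \<Longrightarrow> j \<le> N \<Longrightarrow> e j * E n = E n * e j"
proof (induction n)
  case (Suc n)
  then have IH: "e j * E n = E n * e j" and "e j * e n = e n * e j"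
    using e_comm[of n j] by simp_all
  then have "e j * (E n * e n * E n) = E n * e n * E n * e j"
    by (metis mult.assoc)
  then show ?case
    by (simp add: E.simps)
qed simp

text \<open>With m = n - 1, both e_n pass through the outer \<open>E m\<close> of \<open>E n\<close>
  and meet around e_m, where e_n e_m e_n = e_n. Idempotency of \<open>E m\<close> is a premise
  because the induction for \<open>E_idem\<close> uses this lemma; \<open>e_E_e\<close> discharges
  it.\<close>

lemma e_E_e_aux:
  assumes "1 \<le> n" "n < N" and idem: "E (n - 1) * E (n - 1) = E (n - 1)"
  shows "e n * E n * e n = cf n *s (e n * E (n - 1))"
proof -
  obtain m where n: "n = Suc m"
    using assms(1) by (cases n) auto
  have comm: "e n * E m = E m * e n"
    using E_comm[of m n] assms(2) n by simp
  have "e n * (E m * e m * E m) * e n = E m * (e n * e m * e n) * E m"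
    using comm by (simp add: mult.assoc comm[THEN mult_eq_assoc])
  also have "e n * e m * e n = e n"
    using e_down[of n] assms n by simp
  also have "E m * e n * E m = e n * E m"
    using idem n by (metis comm diff_Suc_1 mult.assoc)
  finally have "e n * (E m * e m * E m) * e n = e n * E m" .
  then show ?thesis
    using n by (simp add: cf_Suc E.simps)
qed

text \<open>The square of E_k e_k E_k contains e_k E_k e_k, which \<open>e_E_e_aux\<close> reduces
  to e_k E_{k-1}; then E_{k-1} is absorbed by E_k. The step reaches back two indices, so n = 1 is a
  separate case resting on e_0^2 = s e_0.\<close>

lemma E_idem: "n \<le> N \<Longrightarrow> E n * E n = E n"
proof (induction n rule: less_induct)
  case (less n)
  consider "n = 0" | "n = 1" | m where "n = Suc (Suc m)"
    by (metis One_nat_def not0_implies_Suc)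
  then show ?case
  proof cases
    case 2
    then show ?thesis using e_zero_sq s_nonzero by (simp add: cf_def E.simps)
  next
    case (3 m)
    define k where "k = Suc m"
    have idem: "E k * E k = E k" "E m * E m = E m"
      using less 3 by (simp_all add: k_def)
    have Em: "E m * E k = E k"
    proof -
      have "E m * (E m * e m * E m) = E m * e m * E m"
        using idem by (metis mult.assoc)
      then show ?thesis by (simp add: k_def E.simps)
    qed
    have "e k * E k * e k = cf k *s (e k * E m)"
      using e_E_e_aux[of k] idem 3 less.prems by (simp add: k_def)
    then have "(E k * e k * E k) * (E k * e k * E k) = cf k *s (E k * e k * E k)"
      using idem Em by (metis mult.assoc scale_mult_left scale_mult_right)
    then show ?thesis
      using 3 E.simps(2)[of k] by (simp add: k_def[symmetric] cf_Suc)
  qed simp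
qed

lemma E_mult_Suc: "Suc n \<le> N \<Longrightarrow> E n * E (Suc n) = E (Suc n)"
  and E_Suc_mult: "Suc n \<le> N \<Longrightarrow> E (Suc n) * E n = E (Suc n)"
  using E_idem[of n] by (simp_all add: E.simps mult.assoc E_idem[THEN mult_eq_assoc])

lemma E_absorb: "m \<le> n \<Longrightarrow> n \<le> N \<Longrightarrow> E m * E n = E n \<and> E n * E m = E n"
proof (induction n rule: dec_induct)
  case base
  then show ?case using E_idem by simp
next
  case (step n)
  then have "E m * E n = E n \<and> E n * E m = E n" by simp
  then show ?case
    using E_mult_Suc[of n] E_Suc_mult[of n] step.prems by (metis mult.assoc)
qed

lemma E_e_E: "E n * e n * E n = cf n *s E (Suc n)"
  by (simp add: E.simps)

lemma e_E_e:
  assumes "1 \<le> n" "n < N"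
  shows "e n * E n * e n = cf n *s (e n * E (n - 1))"
  using assms e_E_e_aux E_idem by simp

lemma e_E_Suc: "n < N \<Longrightarrow> e n * E (Suc n) = e n * E n"
proof (cases n)
  case 0
  then show ?thesis using e_zero_sq s_nonzero by (simp add: cf_def E.simps)
next
  case (Suc m)
  assume "n < N"
  then have "e n * E n * e n * E n = cf n *s (e n * E m * E n)"
    using e_E_e[of n] Suc by simp
  also have "\<dots> = cf n *s (e n * E n)"
    using E_mult_Suc[of m] Suc \<open>n < N\<close> by (simp add: mult.assoc)
  finally show ?thesis by (simp add: mult.assoc E.simps(2)[of n])
qed

text \<open>Expand \<open>E (i + 2)\<close> around e_{i+1} and peel off idempotents with e_i E_{i+1}
  = e_i E_i. This is the zigzag relation on the fundamental path: \<open>cf (Suc i)\<close> is the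
  weight of the tile that can be added there (see \<open>cf_eq_wt\<close>).\<close>

lemma e_e_Suc_E:
  assumes "Suc i < N"
  shows "e i * e (Suc i) * E N = cf (Suc i) *s (e i * E N)"
proof -
  let ?j = "Suc i"
  have comm: "e ?j * E i = E i * e ?j"
    using E_comm assms by simp
  have "cf ?j *s (e i * E (Suc ?j)) = e i * E ?j * e ?j * E ?j"
    using E_e_E[of ?j] by (metis mult.assoc scale_mult_right)
  also have "\<dots> = e i * E i * e ?j * E ?j"
    using e_E_Suc[of i] assms by simp
  also have "\<dots> = e i * e ?j * E ?j"
    using E_mult_Suc[of i] assms comm by (metis Suc_lessD less_eq_Suc_le mult.assoc)
  also have "\<dots> = e i * e ?j * E (Suc ?j)"
    using e_E_Suc[of ?j] assms by (metis mult.assoc)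
  finally have *: "e i * e ?j * E (Suc ?j) = cf ?j *s (e i * E (Suc ?j))" by simp
  have "E N = E (Suc ?j) * E N"
    using E_absorb[of "Suc ?j" N] assms by simp
  then show ?thesis
    using * by (metis mult.assoc scale_mult_left)
qed

text \<open>Writing e_i = e_i e_{i-1} e_i reduces the downward relation to the upward one.\<close>

lemma e_e_pred_E:
  assumes "1 \<le> i" "i < N"
  shows "e i * e (i - 1) * E N = cf (i - 1) *s (e i * E N)"
proof -
  obtain j where j: "i = Suc j" using assms by (cases i) auto
  have "e i * E N = e i * e j * e i * E N"
    using e_down[of i] assms j by simp
  also have "\<dots> = cf i *s (e i * e j * E N)"
    using e_e_Suc_E[of j] assms j by (simp add: mult.assoc)
  finally show ?thesis
    using j cf_Suc[of j] by simp
qed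

lemma e_zero_E: "e 0 * E N = s *s E N"
proof -
  have "e 0 * E 1 = s *s E 1"
    using e_zero_sq by (simp add: cf_def E.simps)
  moreover have "E N = E 1 * E N"
    using E_absorb[of 1 N] N_ge_2 by simp
  ultimately show ?thesis
    by (metis mult.assoc scale_mult_left)
qed

text \<open>\<open>I N\<close> is \<open>I\<^sub>1\<close> for even \<open>N\<close> and \<open>I\<^sub>2\<close> for odd \<open>N\<close>; \<open>I (Suc N)\<close> is the other one.\<close>

fun I :: "nat \<Rightarrow> 'a"
  where
    "I 0 = 1"
  | "I (Suc 0) = e 0"
  | "I (Suc (Suc n)) = e (Suc n) * I n"

text \<open>The product of \<open>cf j\<close> over the same indices j = n - 1, n - 3, ... as in
  \<open>I n\<close>.\<close>

fun Cf :: "nat \<Rightarrow> complex"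
  where
    "Cf 0 = 1"
  | "Cf (Suc 0) = cf 0"
  | "Cf (Suc (Suc n)) = cf (Suc n) * Cf n"

lemma Cf_nonzero [simp]: "Cf n \<noteq> 0"
  by (induction n rule: Cf.induct) auto

text \<open>Together the two products run over all j up to n, and the alternating factors s and 1/s
  cancel in pairs.\<close>

lemma Cf_Suc_mult: "Cf (Suc n) * Cf n = (if even n then s else 1)"
  using s_nonzero by (induction n) (simp_all add: cf_def mult_ac)

lemma I_comm: "n < j \<Longrightarrow> j \<le> N \<Longrightarrow> e j * I n = I n * e j"
proof (induction n rule: I.induct)
  case 2
  then show ?case using e_comm[of 0 j] by simp
next
  case (3 n)
  then have "e j * I n = I n * e j" "e j * e (Suc n) = e (Suc n) * e j"
    using e_comm[of "Suc n" j] by simp_all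
  then show ?case by (metis I.simps(3) mult.assoc)
qed simp

text \<open>\<open>I n\<close> has its largest index on the left while the words for I_1 and I_2
  list the indices upwards; the factors commute.\<close>

lemma I_eq_prod_list:
  "n \<le> Suc N \<Longrightarrow> I n = prod_list (map e (filter (\<lambda>j. odd (n + j)) [0..<n]))"
proof (induction n rule: I.induct)
  case (3 n)
  then have "I n * e (Suc n) = prod_list (map e (filter (\<lambda>j. odd (Suc (Suc n) + j)) [0..<Suc (Suc n)]))"
    by simp
  then show ?case using I_comm[of n "Suc n"] 3 by simp
qed auto

text \<open>For n = N this recovers \<open>I N\<close> from \<open>E N\<close>, so
  \<open>E N\<close> cannot vanish unless \<open>I N\<close> does.\<close>

lemma I_E_I: "n \<le> N \<Longrightarrow> I n * E n * I n = Cf n *s I n"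
proof (induction n rule: I.induct)
  case 2
  then show ?case using e_zero_sq s_nonzero by (simp add: cf_def E.simps)
next
  case (3 n)
  let ?j = "Suc n"
  have comm: "I n * e ?j = e ?j * I n"
    using I_comm[of n ?j] 3 by simp
  have "e ?j * E (Suc ?j) * e ?j = cf ?j *s (e ?j * E n)"
    using e_E_e[of ?j] e_E_Suc[of ?j] 3 by (simp)
  then have "(e ?j * I n) * E (Suc ?j) * (e ?j * I n) = cf ?j *s (I n * (e ?j * E n) * I n)"
    using comm by (metis mult.assoc scale_mult_left scale_mult_right)
  also have "\<dots> = cf ?j *s (e ?j * (I n * E n * I n))"
    using comm by (metis mult.assoc)
  also have "\<dots> = (cf ?j * Cf n) *s (e ?j * I n)"
    using 3 by simp
  finally show ?case by simp
qed simp

lemma E_I_E: "n \<le> N \<Longrightarrow> E n * I n * E n = Cf n *s E n"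
proof (induction n rule: I.induct)
  case 2
  then show ?case using e_zero_sq s_nonzero by (simp add: cf_def E.simps)
next
  case (3 n)
  let ?j = "Suc n"
  let ?E = "E (Suc ?j)"
  have IH: "E n * I n * E n = Cf n *s E n" using 3 by simp
  have comm: "E n * e ?j = e ?j * E n"
    using E_comm[of n ?j] 3 by simp
  have absorb: "?E * E n = ?E" "E n * ?E = ?E" "?E * E ?j = ?E" "E ?j * ?E = ?E"
    using E_absorb[of n "Suc ?j"] E_absorb[of "?j" "Suc ?j"] 3 by simp_all
  have "?E * (e ?j * I n) * ?E = ?E * (E n * e ?j) * I n * (E n * ?E)"
    using absorb by (metis mult.assoc)
  also have "\<dots> = ?E * e ?j * (E n * I n * E n) * ?E"
    using comm by (metis mult.assoc)
  also have "\<dots> = Cf n *s (?E * e ?j * ?E)"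
    unfolding IH using absorb(2) by (simp add: mult.assoc)
  also have "?E * e ?j * ?E = ?E * (E ?j * e ?j * E ?j) * ?E"
    using absorb by (metis mult.assoc)
  also have "\<dots> = cf ?j *s ?E"
    unfolding E_e_E using E_idem[of "Suc ?j"] 3 by (simp)
  finally show ?case by (simp add: mult.commute)
qed simp

text \<open>The factors of \<open>I n\<close> and \<open>I (Suc n)\<close> interlace. After
  commuting, they form adjacent pairs e_i e_{i+1}, each evaluated by \<open>e_e_Suc_E\<close>; a
  leftover e_0 is evaluated by \<open>e_zero_E\<close>.\<close>

lemma I_I_Suc_E: "n < N \<Longrightarrow> I n * I (Suc n) * E N = Cf (Suc n) *s (I n * E N)"
proof (induction n rule: I.induct)
  case 1
  then show ?case using e_zero_E by (simp add: cf_def)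
next
  case 2
  then show ?case using e_e_Suc_E[of 0] by simp
next
  case (3 n)
  let ?i = "Suc n" and ?j = "Suc (Suc n)"
  have IH: "I n * I ?i * E N = Cf ?i *s (I n * E N)" using 3 by simp
  have comm: "e ?j * I n = I n * e ?j" "e ?i * I n = I n * e ?i"
    using I_comm[of n ?i] I_comm[of n ?j] 3 by simp_all
  have "I (Suc ?i) * I (Suc ?j) * E N = e ?i * e ?j * (I n * I ?i * E N)"
    using comm by (metis I.simps(3) mult.assoc)
  also have "\<dots> = Cf ?i *s (I n * (e ?i * e ?j * E N))"
    using comm unfolding IH by (metis mult.assoc scale_mult_right)
  also have "\<dots> = (Cf ?i * cf ?j) *s (I n * e ?i * E N)"
    using e_e_Suc_E[of ?i] 3 by (simp add: mult.assoc del: Cf.simps)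
  also have "I n * e ?i = I (Suc ?i)"
    using comm by simp
  finally show ?case by (simp add: mult.commute)
qed

end

section \<open>The double quotient relation applied to \<open>E N\<close>\<close>

locale double_quotient = one_boundary_TL +
  fixes b :: complex
  assumes I_I_I: "I N * I (Suc N) * I N = b *s I N"
begin

lemma E_zero_imp_I_zero: "E N = 0 \<Longrightarrow> I N = 0"
  using I_E_I[of N] by simp

text \<open>The relation on \<open>I N\<close> is global, the claim is local: evaluating
  \<open>I N * I (Suc N) * E N\<close> in two ways leaves e_{N-1} e_N next to a spectator
  \<open>I n\<close>, which is then cancelled.\<close>

lemma e_N_E:
  "e (N - 1) * e N * E N = (if even N then b else b / s) *s (e (N - 1) * E N)"
proof -
  obtain n where n: "N = Suc (Suc n)"
    using N_ge_2 by (metis One_nat_def Suc_1 Suc_le_D Suc_le_mono)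
  let ?m = "Suc n"
  have comm: "e N * I n = I n * e N" "e ?m * I n = I n * e ?m" "e ?m * E n = E n * e ?m" "e N * E n = E n * e N"
    using I_comm[of n] E_comm[of n] n by simp_all
  \<comment> \<open>First evaluation: \<open>I_I_Suc_E\<close> trades \<open>Cf N\<close> for an
    additional \<open>I N\<close> on the right, so that the double quotient relation
    applies.\<close>
  have "Cf N *s (I N * I (Suc N) * E N) = I N * (e N * (I ?m * I N * E N))"
    using I_I_Suc_E[of ?m] n by (simp add: mult.assoc)
  also have "\<dots> = I N * I (Suc N) * I N * E N"
    using n by (simp add: mult.assoc)
  also have "\<dots> = b *s (I N * E N)"
    using I_I_I by simp
  finally have 1: "Cf N *s (I N * I (Suc N) * E N) = b *s (I N * E N)" .
  \<comment> \<open>Second evaluation: with e_{N-1} and e_N pulled out, the rest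
    \<open>I n * I ?m\<close> acts on \<open>E N\<close> through \<open>I_I_Suc_E\<close>.\<close>
  have "I N * I (Suc N) * E N = e ?m * (I n * e N) * I ?m * E N"
    using n by (simp add: mult.assoc)
  also have "\<dots> = e ?m * e N * (I n * I ?m * E N)"
    unfolding comm(1)[symmetric] by (simp add: mult.assoc)
  also have "\<dots> = Cf ?m *s (e ?m * e N * I n * E N)"
    using I_I_Suc_E[of n] n by (simp add: mult.assoc)
  finally have "(Cf N * Cf ?m) *s (e ?m * e N * I n * E N) = b *s (I N * E N)"
    using 1 by simp
  moreover have "e ?m * e N * I n = I n * e ?m * e N"
    using comm by (metis mult.assoc)
  moreover have "I N = I n * e ?m"
    using comm n by simp
  moreover have "Cf N * Cf ?m = (if even N then 1 else s)"
    using Cf_Suc_mult[of ?m] n by simp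
  ultimately have *: "(if even N then 1 else s) *s (I n * e ?m * e N * E N) = b *s (I n * e ?m * E N)"
    by simp
  \<comment> \<open>Cancelling \<open>I n\<close>: multiplied by \<open>E n\<close> on both sides it
    becomes the scalar \<open>Cf n\<close>, and \<open>E n\<close> passes through e_{N-1} and e_N
    into \<open>E N\<close>.\<close>
  have absorb: "E n * E N = E N" and E_I: "E n * I n * E n = Cf n *s E n"
    using E_absorb[of n N] E_I_E[of n] n by simp_all
  have fix_E: "E n * (e ?m * e N * E N) = e ?m * e N * E N" "E n * (e ?m * E N) = e ?m * E N"
    using absorb
    by (simp_all add: mult.assoc comm(3,4)[symmetric] comm(3,4)[symmetric, THEN mult_eq_assoc])
  have left: "E n * (I n * e ?m * e N * E N) = Cf n *s (e ?m * e N * E N)"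
    using arg_cong[OF E_I, of "\<lambda>x. x * (e ?m * e N * E N)"] fix_E by (simp add: mult.assoc)
  have right: "E n * (I n * e ?m * E N) = Cf n *s (e ?m * E N)"
    using arg_cong[OF E_I, of "\<lambda>x. x * (e ?m * E N)"] fix_E by (simp add: mult.assoc)
  let ?u = "if even N then 1 else s"
  have u: "?u \<noteq> 0" "b / ?u = (if even N then b else b / s)"
    using s_nonzero by simp_all
  have "?u *s (Cf n *s (e ?m * e N * E N)) = b *s (Cf n *s (e ?m * E N))"
    using arg_cong[OF *, of "\<lambda>x. E n * x"] left right by simp
  then have "(1 / (?u * Cf n)) *s (?u *s (Cf n *s (e ?m * e N * E N)))
      = (1 / (?u * Cf n)) *s (b *s (Cf n *s (e ?m * E N)))"
    by simp
  then have "e ?m * e N * E N = (b / ?u) *s (e ?m * E N)"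
    using u(1) by (simp only: scale_scale) simp
  then show ?thesis
    using n u(2) by simp
qed

end

section \<open>Paths and tiles\<close>

text \<open>A tile added from above raises the height at its point and a tile added from below lowers it;
  both move it away from \<open>-1/2\<close>, in the direction \<open>outward h\<close> for the neighbouring height \<open>h\<close>.\<close>

definition outward :: "int \<Rightarrow> int"
  where "outward h = (if h \<ge> 0 then 1 else -1)"

definition removable :: "nat \<Rightarrow> int list \<Rightarrow> nat \<Rightarrow> bool"
  where "removable N p i \<longleftrightarrow> 1 \<le> i \<and> i \<le> N \<and> (i < N \<longrightarrow> p ! (i - 1) = p ! (i + 1)) \<and>
    p ! i = p ! (i - 1) + outward (p ! (i - 1))"

definition remove_tile :: "int list \<Rightarrow> nat \<Rightarrow> int list"
  where "remove_tile p i = p[i := p ! (i - 1) - outward (p ! (i - 1))]"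

text \<open>Twice the total distance of the heights from -1/2. A summand is 1 exactly at the heights
  0 and -1, those of the fundamental path.\<close>

definition area :: "int list \<Rightarrow> nat"
  where "area p = (\<Sum>h\<leftarrow>p. nat \<bar>2 * h + 1\<bar>)"

lemma path_length: "p \<in> paths N \<Longrightarrow> length p = Suc N"
  by (simp add: paths_def)

lemma path_step: "p \<in> paths N \<Longrightarrow> i < N \<Longrightarrow> \<bar>p ! Suc i - p ! i\<bar> = 1"
  by (simp add: paths_def)

lemma path_nth_0: "p \<in> paths N \<Longrightarrow> p ! 0 = 0"
  by (simp add: paths_def)

lemma fundamental_path_nth: "i \<le> N \<Longrightarrow> fundamental_path N ! i = (if even i then 0 else -1)"
  by (simp add: fundamental_path_def del: upt_Suc)

lemma fundamental_path_in_paths: "fundamental_path N \<in> paths N"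
  by (auto simp: paths_def fundamental_path_nth) (simp add: fundamental_path_def)

lemma fundamental_pathI:
  assumes "p \<in> paths N" and "\<And>i. i \<le> N \<Longrightarrow> p ! i \<in> {0, -1}"
  shows "p = fundamental_path N"
proof -
  have "p ! i = (if even i then 0 else -1)" if "i \<le> N" for i
    using that
  proof (induction i)
    case 0
    then show ?case using path_nth_0[OF assms(1)] by simp
  next
    case (Suc i)
    then have "p ! i = (if even i then 0 else -1)" by simp
    moreover have "\<bar>p ! Suc i - p ! i\<bar> = 1"
      using path_step[OF assms(1), of i] Suc.prems by (simp only: Suc_le_eq)
    moreover have "p ! Suc i \<in> {0, -1}"
      using assms(2)[of "Suc i"] Suc.prems by (simp only:)
    ultimately show ?case by (auto split: if_splits)
  qed
  then show ?thesis
    using path_length[OF assms(1)] fundamental_path_nth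
    by (intro nth_equalityI) (auto simp: fundamental_path_def simp del: upt_Suc)
qed

lemma removable_height: "removable N p i \<Longrightarrow> p ! i \<notin> {0, -1}"
  by (auto simp: removable_def outward_def split: if_splits)

text \<open>Two tiles that are removable at the same time never touch, so the corresponding factors
  X_i and X_j commute.\<close>

lemma removable_apart:
  assumes "removable N p i" "removable N p j" "i < j"
  shows "Suc i < j"
proof (rule ccontr)
  assume "\<not> Suc i < j"
  then have "j = Suc i" using assms by simp
  then show False
    using assms by (auto simp: removable_def outward_def split: if_splits)
qed

lemma ex_removable:
  assumes "p \<in> paths N" "p \<noteq> fundamental_path N"
  obtains i where "removable N p i"
proof -
  have "\<exists>i\<le>N. p ! i \<notin> {0, -1}"
    using assms fundamental_pathI by blast
  then obtain k where k: "k \<le> N" "p ! k \<notin> {0, -1}" by blast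
  let ?f = "\<lambda>i. \<bar>2 * p ! i + 1\<bar>"
  \<comment> \<open>A point farthest from -1/2 is removable: its neighbours are not farther out,
    hence lie one step closer to the centre. It is not the point 0, where the height is 0.\<close>
  have "Max (?f ` {..N}) \<in> ?f ` {..N}"
    by (rule Max_in) auto
  then obtain i where "i \<in> {..N}" and "Max (?f ` {..N}) = ?f i" by (rule imageE)
  then have i: "i \<le> N" "Max (?f ` {..N}) = ?f i" by simp_all
  then have max: "?f j \<le> ?f i" if "j \<le> N" for j
    using that unfolding i(2)[symmetric] by (intro Max_ge) auto
  have big: "p ! i \<notin> {0, -1}"
    using max[OF k(1)] k(2) by auto
  then have "i \<noteq> 0"
    using path_nth_0[OF assms(1)] by (metis insertI1)
  then obtain m where m: "i = Suc m" by (cases i) auto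
  have "\<bar>p ! i - p ! m\<bar> = 1"
    using path_step[OF assms(1), of m] i m by simp
  moreover have "?f m \<le> ?f i" using max[of m] i m by simp
  moreover have "i < N \<longrightarrow> \<bar>p ! Suc i - p ! i\<bar> = 1 \<and> ?f (Suc i) \<le> ?f i"
    using path_step[OF assms(1), of i] max[of "Suc i"] by simp
  ultimately have "removable N p i"
    using big i(1) m unfolding removable_def outward_def
    by (cases "p ! i \<ge> 0") auto
  then show ?thesis by (rule that)
qed

lemma remove_tile_nth:
  assumes "p \<in> paths N" "removable N p i" "k \<le> N"
  shows "remove_tile p i ! k = (if k = i then p ! (i - 1) - outward (p ! (i - 1)) else p ! k)"
  using assms path_length[OF assms(1)] by (simp add: remove_tile_def)

lemma remove_tile_in_paths:
  assumes p: "p \<in> paths N" and i: "removable N p i"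
  shows "remove_tile p i \<in> paths N"
proof -
  note nth = remove_tile_nth[OF p i]
  have "\<bar>remove_tile p i ! Suc k - remove_tile p i ! k\<bar> = 1" if "k < N" for k
    using that path_step[OF p that] i
    by (auto simp: nth removable_def outward_def)
  moreover have "remove_tile p i ! 0 = 0"
    using nth[of 0] path_nth_0[OF p] i by (auto simp: removable_def)
  ultimately show ?thesis
    using path_length[OF p] by (simp add: paths_def remove_tile_def)
qed

lemma sum_list_update_nat:
  fixes f :: "'a \<Rightarrow> nat"
  shows "i < length xs \<Longrightarrow> (\<Sum>x\<leftarrow>xs[i := y]. f x) + f (xs ! i) = (\<Sum>x\<leftarrow>xs. f x) + f y"
  by (induction xs arbitrary: i) (auto split: nat.splits)

lemma area_remove_tile:
  assumes p: "p \<in> paths N" and i: "removable N p i"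
  shows "area (remove_tile p i) < area p"
proof -
  let ?h = "p ! (i - 1)"
  have "i < length p" using i path_length[OF p] by (simp add: removable_def)
  from sum_list_update_nat[OF this, where y = "?h - outward ?h" and f = "\<lambda>h. nat \<bar>2 * h + 1\<bar>"]
  have "area (remove_tile p i) + nat \<bar>2 * p ! i + 1\<bar> = area p + nat \<bar>2 * (?h - outward ?h) + 1\<bar>"
    by (simp add: area_def remove_tile_def)
  moreover have "nat \<bar>2 * (?h - outward ?h) + 1\<bar> < nat \<bar>2 * p ! i + 1\<bar>"
    using i by (auto simp: removable_def outward_def)
  ultimately show ?thesis by linarith
qed

text \<open>The hypothesis covers all paths of smaller area, not just the one with tile i removed,
  since some arguments remove several tiles in a row.\<close>

lemma path_induct [consumes 1, case_names fundamental remove]: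
  assumes "p \<in> paths N"
    and "P (fundamental_path N)"
    and "\<And>p i. p \<in> paths N \<Longrightarrow> removable N p i \<Longrightarrow>
      (\<And>p'. p' \<in> paths N \<Longrightarrow> area p' < area p \<Longrightarrow> P p') \<Longrightarrow> P p"
  shows "P p"
  using assms(1)
proof (induction "area p" arbitrary: p rule: less_induct)
  case less
  then show ?case
    using assms(2,3) ex_removable by metis
qed

lemma add_tile_iff:
  assumes "p \<in> paths N"
  shows "add_above N p i p' \<or> add_below N p i p' \<longleftrightarrow>
    p' \<in> paths N \<and> removable N p' i \<and> p = remove_tile p' i"
proof
  assume L: "add_above N p i p' \<or> add_below N p i p'"
  then have i: "1 \<le> i" "i \<le> N" "i < N \<longrightarrow> p ! (i - 1) = p ! (i + 1)"
    and h: "p ! i = p ! (i - 1) - outward (p ! (i - 1))"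
    and p': "p' = p[i := p ! (i - 1) + outward (p ! (i - 1))]"
    by (auto simp: add_above_def add_below_def outward_def)
  have nth: "p' ! k = (if k = i then p ! (i - 1) + outward (p ! (i - 1)) else p ! k)" if "k \<le> N" for k
    using that p' path_length[OF assms] by simp
  have "\<bar>p' ! Suc k - p' ! k\<bar> = 1" if "k < N" for k
    using that path_step[OF assms that] i h
    by (auto simp: nth outward_def split: if_splits)
  then have "p' \<in> paths N"
    using nth[of 0] path_nth_0[OF assms] i path_length[OF assms] p' by (simp add: paths_def)
  moreover have "removable N p' i"
    using i nth[of i] nth[of "i - 1"] nth[of "i + 1"] by (auto simp: removable_def)
  moreover have "p = remove_tile p' i"
    using i h p' nth by (simp add: remove_tile_def) (metis list_update_id)
  ultimately show "p' \<in> paths N \<and> removable N p' i \<and> p = remove_tile p' i"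
    by blast
next
  assume R: "p' \<in> paths N \<and> removable N p' i \<and> p = remove_tile p' i"
  then have p': "p' \<in> paths N" and r: "removable N p' i" and p: "p = remove_tile p' i"
    by blast+
  note nth = remove_tile_nth[OF p' r, folded p]
  have i: "1 \<le> i" "i \<le> N" "i < N \<longrightarrow> p' ! (i - 1) = p' ! (i + 1)"
    and h: "p' ! i = p' ! (i - 1) + outward (p' ! (i - 1))"
    using r by (simp_all add: removable_def)
  have nth': "p ! (i - 1) = p' ! (i - 1)" "i < N \<longrightarrow> p ! (i + 1) = p' ! (i + 1)"
    "p ! i = p' ! (i - 1) - outward (p' ! (i - 1))"
    using nth[of i] nth[of "i - 1"] nth[of "i + 1"] i by auto
  have "p[i := p' ! (i - 1) + outward (p' ! (i - 1))] = p'"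
    unfolding h[symmetric] by (simp add: p remove_tile_def)
  then show "add_above N p i p' \<or> add_below N p i p'"
    using i nth' unfolding add_above_def add_below_def outward_def
    by (cases "p' ! (i - 1) \<ge> 0") simp_all
qed

text \<open>The diamond property of tile removal, behind the independence of the order of
  additions.\<close>

lemma removable_remove_tile:
  assumes p: "p \<in> paths N" and i: "removable N p i" and j: "removable N p j" and "i \<noteq> j"
  shows "removable N (remove_tile p i) j"
    and "remove_tile (remove_tile p i) j = remove_tile (remove_tile p j) i"
proof -
  have apart: "Suc i < j \<or> Suc j < i"
    using removable_apart[OF i j] removable_apart[OF j i] \<open>i \<noteq> j\<close> by linarith
  have i': "1 \<le> i" "i \<le> N" and j': "1 \<le> j" "j \<le> N"
    using i j by (simp_all add: removable_def)
  have nth: "remove_tile p i ! j = p ! j" "remove_tile p i ! (j - 1) = p ! (j - 1)"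
    "j < N \<longrightarrow> remove_tile p i ! (j + 1) = p ! (j + 1)" "remove_tile p j ! (i - 1) = p ! (i - 1)"
    using remove_tile_nth[OF p i, of j] remove_tile_nth[OF p i, of "j - 1"]
      remove_tile_nth[OF p i, of "j + 1"] remove_tile_nth[OF p j, of "i - 1"] apart i' j'
    by auto
  then show "removable N (remove_tile p i) j"
    using j by (simp add: removable_def)
  show "remove_tile (remove_tile p i) j = remove_tile (remove_tile p j) i"
    unfolding remove_tile_def[of _ j] remove_tile_def[of "remove_tile p j"] nth(2) nth(4)[unfolded remove_tile_def[of _ j]]
    using \<open>i \<noteq> j\<close> nth(2,4) by (simp add: remove_tile_def list_update_swap)
qed

text \<open>The argument of R_i or K_N for a tile whose left neighbour has height h: above for h >=
  0, below for h < 0.\<close>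

definition spectral :: "complex \<Rightarrow> int \<Rightarrow> complex"
  where "spectral \<omega>\<^sub>1 h = (if h \<ge> 0 then \<omega>\<^sub>1 - of_int h else - \<omega>\<^sub>1 + of_int h)"

definition weight :: "nat \<Rightarrow> complex \<Rightarrow> complex \<Rightarrow> complex \<Rightarrow> nat \<Rightarrow> complex \<Rightarrow> complex"
  where "weight N \<eta> \<omega>\<^sub>2 \<theta> i u = (if i < N then r_fun \<eta> u else k_fun \<eta> \<omega>\<^sub>2 \<theta> u)"

lemma remove_tile_nth_pred:
  assumes "p \<in> paths N" "removable N p i"
  shows "remove_tile p i ! (i - 1) = p ! (i - 1)"
proof -
  have "1 \<le> i" "i \<le> N" using assms(2) unfolding removable_def by blast+
  then show ?thesis using remove_tile_nth[OF assms, of "i - 1"] by auto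
qed

text \<open>A path with an extremum at i belongs to a pair of paths that differ by one tile at i, as
  the member with the tile or the one without. These pairs carry the 2 x 2 blocks.\<close>

lemma extremum_cases:
  assumes p: "p \<in> paths N" and i: "1 \<le> i" "i \<le> N" "i < N \<Longrightarrow> p ! (i - 1) = p ! (i + 1)"
  obtains "removable N p i"
  | p' where "p' \<in> paths N" "removable N p' i" "remove_tile p' i = p"
proof -
  let ?h = "p ! (i - 1)"
  have "\<bar>p ! i - ?h\<bar> = 1"
    using path_step[OF p, of "i - 1"] i by simp
  then have "p ! i = ?h + 1 \<or> p ! i = ?h - 1" by linarith
  then consider "p ! i = ?h + outward ?h" | "p ! i = ?h - outward ?h"
    by (cases "?h \<ge> 0") (auto simp: outward_def)
  then show ?thesis
  proof cases
    case 1
    then show ?thesis using i that(1) unfolding removable_def by blast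
  next
    case 2
    then have "add_above N p i (p[i := ?h + outward ?h]) \<or> add_below N p i (p[i := ?h + outward ?h])"
      using i unfolding add_above_def add_below_def outward_def by (cases "?h \<ge> 0") simp_all
    then show ?thesis using that(2) add_tile_iff[OF p] by metis
  qed
qed

section \<open>The double quotient of the free algebra\<close>

lemma poly_mapping_sum_induct [case_names zero single add]:
  fixes f :: "'k \<Rightarrow>\<^sub>0 'b::comm_monoid_add"
  assumes "P 0" and "\<And>k c. P (Poly_Mapping.single k c)" and "\<And>f g. P f \<Longrightarrow> P g \<Longrightarrow> P (f + g)"
  shows "P f"
proof (induction f rule: update_induct)
  case const
  then show ?case by (rule assms(1))
next
  case (update f a b)
  then have "Poly_Mapping.update a b f = f + Poly_Mapping.single a b"
    by (intro poly_mapping_eqI) (auto simp: lookup_update lookup_add lookup_single in_keys_iff when_def)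
  then show ?case using assms(2,3) update by metis
qed

lemma monom_word_mult: "monom_word l * monom_word m = monom_word (l @ m)"
  by (simp add: monom_word_def mult_single plus_word_def)

lemma scalar_mult: "scalar c * scalar d = scalar (c * d)"
  and scalar_add: "scalar (c + d) = scalar c + scalar d"
  and scalar_1: "scalar 1 = 1"
  by (simp_all add: scalar_def mult_single single_add)

lemma scalar_central: "scalar c * f = f * scalar c"
  by (induction f rule: poly_mapping_sum_induct)
    (simp_all add: scalar_def mult_single algebra_simps)

lemma inj_word_rev: "inj word_rev"
  by (rule inj_on_inverseI[where g = word_rev]) (simp add: word_rev_def)

lemma word_rev_word_rev [simp]: "word_rev (word_rev w) = w"
  by (simp add: word_rev_def)

lemma free_rev_add: "free_rev (f + g) = free_rev f + free_rev g"
  by (simp add: free_rev_def map_key_plus[OF inj_word_rev])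

lemma free_rev_0 [simp]: "free_rev 0 = 0"
  by (simp add: free_rev_def map_key_zero[OF inj_word_rev])

lemma free_rev_single: "free_rev (Poly_Mapping.single w c) = Poly_Mapping.single (word_rev w) c"
  using map_key_single[OF inj_word_rev, of "word_rev w" c] by (simp add: free_rev_def)

lemma free_rev_free_rev [simp]: "free_rev (free_rev f) = f"
  by (induction f rule: poly_mapping_sum_induct) (simp_all add: free_rev_single free_rev_add)

lemma free_rev_minus: "free_rev (f - g) = free_rev f - free_rev g"
  using free_rev_add[of "f - g" g] by (simp add: algebra_simps)

lemma word_rev_add: "word_rev (v + w) = word_rev w + word_rev v"
  by (simp add: word_rev_def plus_word_def)

lemma free_rev_single_mult:
  "free_rev (Poly_Mapping.single w c * g) = free_rev g * Poly_Mapping.single (word_rev w) c"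
  by (induction g rule: poly_mapping_sum_induct)
    (simp_all add: mult_single free_rev_single word_rev_add free_rev_add algebra_simps)

lemma free_rev_mult: "free_rev (f * g) = free_rev g * free_rev f"
  by (induction f rule: poly_mapping_sum_induct)
    (simp_all add: free_rev_single_mult free_rev_single free_rev_add algebra_simps)

lemma free_rev_scalar [simp]: "free_rev (scalar c) = scalar c"
  by (simp add: scalar_def free_rev_single) (simp add: word_rev_def zero_word_def)

lemma free_rev_monom_word [simp]: "free_rev (monom_word l) = monom_word (rev l)"
  by (simp add: monom_word_def free_rev_single) (simp add: word_rev_def)

lemma free_rev_in_free_carrier: "f \<in> free_carrier N \<Longrightarrow> free_rev f \<in> free_carrier N"
  by (auto simp: free_carrier_def free_rev_def keys_map_key[OF inj_word_rev] word_rev_def)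
    (metis atMost_iff set_rev subsetD word.sel)

lemma free_alg_simps:
  "carrier (free_alg N) = free_carrier N" "x \<otimes>\<^bsub>free_alg N\<^esub> y = x * y"
  "x \<oplus>\<^bsub>free_alg N\<^esub> y = x + y" "\<one>\<^bsub>free_alg N\<^esub> = 1" "\<zero>\<^bsub>free_alg N\<^esub> = 0"
  by (simp_all add: free_alg_def)

lemma free_alg_a_inv:
  assumes "x \<in> free_carrier N"
  shows "\<ominus>\<^bsub>free_alg N\<^esub> x = - x"
proof -
  interpret ring "free_alg N" by (rule ring_free_alg)
  show ?thesis
    using assms by (intro minus_equality) (simp_all add: free_alg_simps free_carrier_closed)
qed

lemma free_alg_minus:
  "x \<in> free_carrier N \<Longrightarrow> y \<in> free_carrier N \<Longrightarrow> x \<ominus>\<^bsub>free_alg N\<^esub> y = x - y"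
  by (simp add: a_minus_def free_alg_a_inv free_alg_simps)

lemma ideal_free_algI:
  assumes "K \<subseteq> free_carrier N" "0 \<in> K"
    and "\<And>f g. f \<in> K \<Longrightarrow> g \<in> K \<Longrightarrow> f + g \<in> K"
    and "\<And>f g. f \<in> K \<Longrightarrow> g \<in> free_carrier N \<Longrightarrow> f * g \<in> K"
    and "\<And>f g. f \<in> K \<Longrightarrow> g \<in> free_carrier N \<Longrightarrow> g * f \<in> K"
  shows "ideal K (free_alg N)"
proof (rule idealI[OF ring_free_alg])
  interpret ring "free_alg N" by (rule ring_free_alg)
  \<comment> \<open>Negation is multiplication by the scalar -1, so closure under it comes from the
    ideal property.\<close>
  have neg: "- f \<in> K" if "f \<in> K" for f
    using assms(5)[OF that free_carrier_closed(3), of "-1"]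
    by (simp add: scalar_def single_uminus)
  show "subgroup K (add_monoid (free_alg N))"
  proof (rule group.subgroupI)
    show "Group.group (add_monoid (free_alg N))" by (rule a_group)
    show "K \<noteq> {}" using assms(2) by blast
    show "inv\<^bsub>add_monoid (free_alg N)\<^esub> a \<in> K" if "a \<in> K" for a
      using neg[OF that] free_alg_a_inv[of a] that assms(1) by (auto simp: a_inv_def)
  qed (use assms in \<open>auto simp: free_alg_simps\<close>)
qed (use assms in \<open>auto simp: free_alg_simps\<close>)

locale double_quotient_alg =
  fixes N :: nat and \<eta> \<omega>\<^sub>1 \<omega>\<^sub>2 \<theta> :: complex
  assumes N_ge_2: "N \<ge> 2"
begin

abbreviation A :: "free_elem set ring" where "A \<equiv> dq_alg N \<eta> \<omega>\<^sub>1 \<omega>\<^sub>2 \<theta>"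
abbreviation J :: "free_elem set" where "J \<equiv> dq_ideal N \<eta> \<omega>\<^sub>1 \<omega>\<^sub>2 \<theta>"
abbreviation cl :: "free_elem \<Rightarrow> free_elem set" where "cl \<equiv> coset_of N \<eta> \<omega>\<^sub>1 \<omega>\<^sub>2 \<theta>"

sublocale A: ring A
  by (rule ring_dq_alg[OF N_ge_2])

sublocale J: ideal J "free_alg N"
  by (rule ideal_dq_ideal[OF N_ge_2])

lemma cl_ring_hom: "cl \<in> ring_hom (free_alg N) A"
  using J.rcos_ring_hom by (simp add: dq_alg_def coset_of_def[abs_def])

lemma cl_closed [simp]: "f \<in> free_carrier N \<Longrightarrow> cl f \<in> carrier A"
  using ring_hom_closed[OF cl_ring_hom] by (simp add: free_alg_simps)

lemma cl_mult: "f \<in> free_carrier N \<Longrightarrow> g \<in> free_carrier N \<Longrightarrow> cl (f * g) = cl f \<otimes>\<^bsub>A\<^esub> cl g"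
  using ring_hom_mult[OF cl_ring_hom] by (simp add: free_alg_simps)

lemma cl_add: "f \<in> free_carrier N \<Longrightarrow> g \<in> free_carrier N \<Longrightarrow> cl (f + g) = cl f \<oplus>\<^bsub>A\<^esub> cl g"
  using ring_hom_add[OF cl_ring_hom] by (simp add: free_alg_simps)

lemma cl_1: "cl 1 = \<one>\<^bsub>A\<^esub>"
  using ring_hom_one[OF cl_ring_hom] by (simp add: free_alg_simps)

lemma cl_0: "cl 0 = \<zero>\<^bsub>A\<^esub>"
  using ring_hom_zero[OF cl_ring_hom ring_free_alg A.ring_axioms] by (simp add: free_alg_simps)

lemma cl_minus: "f \<in> free_carrier N \<Longrightarrow> g \<in> free_carrier N \<Longrightarrow> cl (f - g) = cl f \<ominus>\<^bsub>A\<^esub> cl g"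
proof -
  assume fg: "f \<in> free_carrier N" "g \<in> free_carrier N"
  then have "cl f = cl (f - g) \<oplus>\<^bsub>A\<^esub> cl g"
    using cl_add[of "f - g" g] by (simp add: free_carrier_closed)
  then show ?thesis
    using fg by (simp add: A.minus_eq A.a_assoc A.r_neg free_carrier_closed)
qed

lemma carrier_A: "carrier A = cl ` free_carrier N"
  by (auto simp: dq_alg_def FactRing_def A_RCOSETS_def RCOSETS_def coset_of_def a_r_coset_def free_alg_simps)

lemma cl_eq_iff:
  "f \<in> free_carrier N \<Longrightarrow> g \<in> free_carrier N \<Longrightarrow> cl f = cl g \<longleftrightarrow> f - g \<in> J"
  using ring.quotient_eq_iff_same_a_r_cos[OF ring_free_alg J.ideal_axioms, of f g]
  by (simp add: coset_of_def free_alg_minus free_alg_simps)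

lemma relator_in_J: "f \<in> tbtl_relators N \<eta> \<omega>\<^sub>1 \<omega>\<^sub>2 \<union> dq_relators N \<eta> \<omega>\<^sub>1 \<omega>\<^sub>2 \<theta> \<Longrightarrow> f \<in> J"
  unfolding dq_ideal_def
  using ring.genideal_self[OF ring_free_alg relators_carrier[OF N_ge_2]] by blast

lemma J_minimal:
  assumes "ideal K (free_alg N)" "tbtl_relators N \<eta> \<omega>\<^sub>1 \<omega>\<^sub>2 \<union> dq_relators N \<eta> \<omega>\<^sub>1 \<omega>\<^sub>2 \<theta> \<subseteq> K"
  shows "J \<subseteq> K"
  unfolding dq_ideal_def by (rule ring.genideal_minimal[OF ring_free_alg assms])

lemma monom_closed [simp]: "set l \<subseteq> {..N} \<Longrightarrow> monom_word l \<in> free_carrier N"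
  by (rule free_carrier_closed)

lemma cl_commute:
  assumes "i \<le> N" "j \<le> N" "Suc i < j \<or> Suc j < i"
  shows "cl (monom_word [i, j]) = cl (monom_word [j, i])"
proof -
  have "\<bar>int i - int j\<bar> > 1" using assms(3) by auto
  then have "monom_word [i, j] - monom_word [j, i] \<in> J"
    using assms by (intro relator_in_J) (auto simp: tbtl_relators_def)
  then show ?thesis
    using assms by (simp add: cl_eq_iff)
qed

text \<open>Letters that differ by more than one commute in the quotient. This makes I_1 and I_2
  invariant under reversal there, although their words are not palindromes in general.\<close>

lemma cl_rev:
  assumes "set l \<subseteq> {..N}" "sorted_wrt (\<lambda>i j. Suc i < j) l"
  shows "cl (monom_word (rev l)) = cl (monom_word l)"
  using assms
proof (induction l)
  case (Cons a l)
  have "cl (monom_word (m @ [a])) = cl (monom_word (a # m))" if "set m \<subseteq> set l" for m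
    using that
  proof (induction m)
    case (Cons b m)
    have *: "set m \<subseteq> {..N}" "b \<le> N" "a \<le> N" "Suc a < b"
      using Cons.prems \<open>set (a # l) \<subseteq> {..N}\<close> \<open>sorted_wrt _ (a # l)\<close> by auto
    have "monom_word ((b # m) @ [a]) = monom_word [b] * monom_word (m @ [a])"
      by (simp add: monom_word_mult)
    then have "cl (monom_word ((b # m) @ [a])) = cl (monom_word [b]) \<otimes>\<^bsub>A\<^esub> cl (monom_word (a # m))"
      using Cons * by (simp add: cl_mult)
    also have "\<dots> = cl (monom_word [b, a]) \<otimes>\<^bsub>A\<^esub> cl (monom_word m)"
      using * by (simp add: cl_mult[symmetric] monom_word_mult)
    also have "\<dots> = cl (monom_word [a, b]) \<otimes>\<^bsub>A\<^esub> cl (monom_word m)"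
      using cl_commute[of b a] * by simp
    also have "\<dots> = cl (monom_word (a # b # m))"
      using * by (simp add: cl_mult[symmetric] monom_word_mult)
    finally show ?case .
  qed simp
  from this[of "rev l"]
  have "cl (monom_word (rev (a # l))) = cl (monom_word ([a] @ rev l))" by simp
  also have "\<dots> = cl (monom_word [a]) \<otimes>\<^bsub>A\<^esub> cl (monom_word (rev l))"
    using Cons.prems by (simp add: cl_mult[symmetric] monom_word_mult)
  also have "\<dots> = cl (monom_word [a]) \<otimes>\<^bsub>A\<^esub> cl (monom_word l)"
    using Cons by simp
  also have "\<dots> = cl (monom_word (a # l))"
    using Cons.prems by (simp add: cl_mult[symmetric] monom_word_mult)
  finally show ?case .
qed simp

lemma sorted_parity_filter:
  "sorted_wrt (\<lambda>i j. Suc i < j) (filter even [0..<n])"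
  "sorted_wrt (\<lambda>i j. Suc i < j) (filter odd [0..<n])"
proof -
  have *: "sorted_wrt (\<lambda>i j. i < j \<and> even i = even j) l \<Longrightarrow> sorted_wrt (\<lambda>i j. Suc i < j) l" for l :: "nat list"
    by (erule sorted_wrt_mono_rel[rotated]) (metis Suc_lessI even_Suc)
  have **: "sorted_wrt (<) (filter P [0..<n])" for P :: "nat \<Rightarrow> bool"
    by (rule sorted_wrt_filter) simp
  show "sorted_wrt (\<lambda>i j. Suc i < j) (filter even [0..<n])"
    by (rule *, rule sorted_wrt_mono_rel[OF _ **]) auto
  show "sorted_wrt (\<lambda>i j. Suc i < j) (filter odd [0..<n])"
    by (rule *, rule sorted_wrt_mono_rel[OF _ **]) auto
qed

lemma I_elem_closed [simp]: "I1_elem N \<in> free_carrier N" "I2_elem N \<in> free_carrier N"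
  by (auto simp: I1_elem_def I2_elem_def intro!: monom_closed simp del: upt_Suc)

lemma cl_rev_I:
  "cl (free_rev (I1_elem N)) = cl (I1_elem N)" "cl (free_rev (I2_elem N)) = cl (I2_elem N)"
  by (auto simp: I1_elem_def I2_elem_def intro!: cl_rev sorted_parity_filter simp del: upt_Suc)

lemma J_add: "f \<in> J \<Longrightarrow> g \<in> J \<Longrightarrow> f + g \<in> J"
  using additive_subgroup.a_closed[OF J.is_additive_subgroup, of f g] by (simp only: free_alg_simps)

lemma J_0: "0 \<in> J"
  using additive_subgroup.zero_closed[OF J.is_additive_subgroup] by (simp only: free_alg_simps)

text \<open>The elements whose reversal lies in \<open>J\<close> form an ideal, so by minimality of
  \<open>J\<close> only the relators need reversing. This is what makes the transposition well
  defined on cosets.\<close>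

lemma free_rev_J:
  assumes "f \<in> J"
  shows "free_rev f \<in> J"
proof -
  let ?K = "{f \<in> free_carrier N. free_rev f \<in> J}"
  have carr: "f \<in> free_carrier N" if "f \<in> J" for f
    using J.Icarr[OF that] by (simp add: free_alg_simps)
  have "ideal ?K (free_alg N)"
    using J.I_l_closed J.I_r_closed J_add J_0
    by (intro ideal_free_algI)
      (auto simp: free_alg_simps free_carrier_closed free_rev_add free_rev_mult free_rev_in_free_carrier)
  moreover have "f \<in> ?K" if f: "f \<in> tbtl_relators N \<eta> \<omega>\<^sub>1 \<omega>\<^sub>2 \<union> dq_relators N \<eta> \<omega>\<^sub>1 \<omega>\<^sub>2 \<theta>" for f
  proof -
    have "f \<in> free_carrier N"
      using subsetD[OF relators_carrier[OF N_ge_2] f] by (simp add: free_alg_simps)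
    moreover have "free_rev f \<in> J"
    proof (cases "f \<in> tbtl_relators N \<eta> \<omega>\<^sub>1 \<omega>\<^sub>2")
      case True
      \<comment> \<open>Reversal exchanges the commutation relators of (i, j) and (j, i); the other
        relators of 2BTL are fixed once scalars are moved to the left.\<close>
      have swap: "\<bar>int i - int j\<bar> > 1 \<longleftrightarrow> \<bar>int j - int i\<bar> > 1" for i j by auto
      from True have "free_rev f \<in> tbtl_relators N \<eta> \<omega>\<^sub>1 \<omega>\<^sub>2"
        unfolding tbtl_relators_def
        by (auto simp: free_rev_minus free_rev_mult scalar_central simp del: of_nat_diff)
          (use swap in blast)+
      then show ?thesis by (intro relator_in_J) blast
    next
      case False
      \<comment> \<open>These relators are reversed only up to commuting letters, so they need not
        be mapped to relators; the argument passes to cosets and uses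
        \<open>cl_rev_I\<close>.\<close>
      have *: "free_rev (F * G * F - scalar c * F) \<in> J"
        if "F * G * F - scalar c * F \<in> J" "F \<in> free_carrier N" "G \<in> free_carrier N"
          "cl (free_rev F) = cl F" "cl (free_rev G) = cl G" for F G c
      proof -
        have "cl (F * G * F) = cl (scalar c * F)"
          using that by (subst cl_eq_iff) (simp_all add: free_carrier_closed)
        then have "cl (free_rev (F * G * F)) = cl (free_rev (scalar c * F))"
          using that
          by (simp add: free_rev_mult cl_mult free_carrier_closed free_rev_in_free_carrier
              scalar_central[symmetric] A.m_assoc)
        then show ?thesis
          using that cl_eq_iff
          by (simp add: free_rev_minus free_carrier_closed free_rev_in_free_carrier)
      qed
      show ?thesis
        using f False relator_in_J[OF f] *[OF _ _ _ cl_rev_I] *[OF _ _ _ cl_rev_I(2) cl_rev_I(1)]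
        by (auto simp: dq_relators_def)
    qed
    ultimately show ?thesis by simp
  qed
  ultimately have "J \<subseteq> ?K"
    by (intro J_minimal) blast+
  then show ?thesis using assms by blast
qed

lemma cl_def: "cl f = {j + f | j. j \<in> J}"
  by (auto simp: coset_of_def a_r_coset_def r_coset_def free_alg_def)

lemma transpose_cl: "transpose_el (cl f) = cl (free_rev f)"
proof -
  have "free_rev ` {j + f | j. j \<in> J} = {j + free_rev f | j. j \<in> J}"
  proof (intro equalityI subsetI)
    fix x assume "x \<in> {j + free_rev f | j. j \<in> J}"
    then obtain j where "j \<in> J" "x = free_rev (free_rev j + f)"
      by (auto simp: free_rev_add)
    then show "x \<in> free_rev ` {j + f | j. j \<in> J}"
      using free_rev_J by blast
  qed (use free_rev_J in \<open>auto simp: free_rev_add\<close>)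
  then show ?thesis by (simp add: transpose_el_def cl_def)
qed

end

section \<open>The elements attached to paths\<close>

context double_quotient_alg
begin

abbreviation E_N :: "free_elem set" where "E_N \<equiv> E_idem N \<eta> \<omega>\<^sub>1 \<omega>\<^sub>2 \<theta> N"
abbreviation b_elt :: "int list \<Rightarrow> free_elem set" where "b_elt \<equiv> basis_elt N \<eta> \<omega>\<^sub>1 \<omega>\<^sub>2 \<theta>"

lemma egen_closed [simp]: "i \<le> N \<Longrightarrow> egen N \<eta> \<omega>\<^sub>1 \<omega>\<^sub>2 \<theta> i \<in> carrier A"
  by (simp add: egen_def)

lemma scale_by_cl: "f \<in> free_carrier N \<Longrightarrow> scale_by N \<eta> \<omega>\<^sub>1 \<omega>\<^sub>2 \<theta> c (cl f) = cl (scalar c * f)"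
  by (simp add: scale_by_def cl_mult free_carrier_closed)

lemma scale_by_closed [simp]: "x \<in> carrier A \<Longrightarrow> scale_by N \<eta> \<omega>\<^sub>1 \<omega>\<^sub>2 \<theta> c x \<in> carrier A"
  by (simp add: scale_by_def free_carrier_closed)

lemma E_idem_closed: "i \<le> N \<Longrightarrow> E_idem N \<eta> \<omega>\<^sub>1 \<omega>\<^sub>2 \<theta> i \<in> carrier A"
  by (induction i) simp_all

lemma X_op_eq:
  "i \<le> N \<Longrightarrow> X_op N \<eta> \<omega>\<^sub>1 \<omega>\<^sub>2 \<theta> i u = cl (monom_word [i] - scalar (weight N \<eta> \<omega>\<^sub>2 \<theta> i u))"
  by (auto simp: X_op_def R_op_def K_op_def egen_def weight_def cl_1[symmetric] scale_by_cl
      free_carrier_closed cl_minus)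

lemma X_op_closed: "i \<le> N \<Longrightarrow> X_op N \<eta> \<omega>\<^sub>1 \<omega>\<^sub>2 \<theta> i u \<in> carrier A"
  by (simp add: X_op_eq free_carrier_closed)

lemma X_op_commute:
  assumes "i \<le> N" "j \<le> N" "Suc i < j \<or> Suc j < i"
  shows "X_op N \<eta> \<omega>\<^sub>1 \<omega>\<^sub>2 \<theta> i u \<otimes>\<^bsub>A\<^esub> X_op N \<eta> \<omega>\<^sub>1 \<omega>\<^sub>2 \<theta> j v
    = X_op N \<eta> \<omega>\<^sub>1 \<omega>\<^sub>2 \<theta> j v \<otimes>\<^bsub>A\<^esub> X_op N \<eta> \<omega>\<^sub>1 \<omega>\<^sub>2 \<theta> i u"
proof -
  let ?f = "monom_word [i] - scalar (weight N \<eta> \<omega>\<^sub>2 \<theta> i u)" and ?g = "monom_word [j] - scalar (weight N \<eta> \<omega>\<^sub>2 \<theta> j v)"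
  have "?f * ?g - ?g * ?f = monom_word [i, j] - monom_word [j, i]"
    by (simp add: algebra_simps monom_word_mult scalar_central[of _ "monom_word _"] scalar_mult)
  moreover have "monom_word [i, j] - monom_word [j, i] \<in> J"
    using cl_commute[OF assms] assms by (simp add: cl_eq_iff)
  ultimately have "cl (?f * ?g) = cl (?g * ?f)"
    using assms by (subst cl_eq_iff) (simp_all add: free_carrier_closed)
  then show ?thesis
    using assms by (simp add: X_op_eq cl_mult free_carrier_closed)
qed

section \<open>Independence of the order of additions\<close>

abbreviation B :: "int list \<Rightarrow> free_elem set \<Rightarrow> bool" where "B \<equiv> builds N \<eta> \<omega>\<^sub>1 \<omega>\<^sub>2 \<theta>"
abbreviation X :: "nat \<Rightarrow> int \<Rightarrow> free_elem set"
  where "X i h \<equiv> X_op N \<eta> \<omega>\<^sub>1 \<omega>\<^sub>2 \<theta> i (spectral \<omega>\<^sub>1 h)"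

lemma builds_in_paths: "B p x \<Longrightarrow> p \<in> paths N"
proof (induction rule: builds.induct)
  case base
  show ?case by (rule fundamental_path_in_paths)
next
  case (above p x i p')
  then show ?case using add_tile_iff[of p N i p'] by blast
next
  case (below p x i p')
  then show ?case using add_tile_iff[of p N i p'] by blast
qed

lemma builds_closed: "B p x \<Longrightarrow> x \<in> carrier A"
proof (induction rule: builds.induct)
  case base
  show ?case by (simp add: E_idem_closed)
next
  case (above p x i p')
  then have "i \<le> N" unfolding add_above_def by blast
  then show ?case using above.IH by (simp add: X_op_closed)
next
  case (below p x i p')
  then have "i \<le> N" unfolding add_below_def by blast
  then show ?case using below.IH by (simp add: X_op_closed)
qed

lemma builds_add_tile:
  assumes p: "p \<in> paths N" and i: "removable N p i" and y: "B (remove_tile p i) y"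
  shows "B p (X i (p ! (i - 1)) \<otimes>\<^bsub>A\<^esub> y)"
proof -
  have "add_above N (remove_tile p i) i p \<or> add_below N (remove_tile p i) i p"
    using add_tile_iff remove_tile_in_paths p i by blast
  then show ?thesis
  proof
    assume *: "add_above N (remove_tile p i) i p"
    then show ?thesis
      using builds.above[OF y *] remove_tile_nth_pred[OF p i] by (simp add: add_above_def spectral_def)
  next
    assume *: "add_below N (remove_tile p i) i p"
    then show ?thesis
      using builds.below[OF y *] remove_tile_nth_pred[OF p i] by (simp add: add_below_def spectral_def)
  qed
qed

lemma builds_lastE:
  assumes "B p x"
  obtains "p = fundamental_path N" "x = E_N"
  | i y where "removable N p i" "B (remove_tile p i) y" "x = X i (p ! (i - 1)) \<otimes>\<^bsub>A\<^esub> y"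
  using assms
proof (cases rule: builds.cases)
  case base
  then show ?thesis using that(1) by blast
next
  case (above q y i)
  then have "removable N p i" "q = remove_tile p i"
    using add_tile_iff builds_in_paths by blast+
  then show ?thesis
    using that(2)[of i y] above remove_tile_nth_pred[OF builds_in_paths[OF assms]]
    by (simp add: add_above_def spectral_def)
next
  case (below q y i)
  then have "removable N p i" "q = remove_tile p i"
    using add_tile_iff builds_in_paths by blast+
  then show ?thesis
    using that(2)[of i y] below remove_tile_nth_pred[OF builds_in_paths[OF assms]]
    by (simp add: add_below_def spectral_def)
qed

lemma ex_builds: "p \<in> paths N \<Longrightarrow> \<exists>x. B p x"
proof (induction p rule: path_induct)
  case fundamental
  then show ?case using builds.base by blast
next
  case (remove p i)
  then obtain y where "B (remove_tile p i) y"
    using remove_tile_in_paths area_remove_tile by blast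
  then show ?case using builds_add_tile remove by blast
qed

lemma removable_fundamental: "\<not> removable N (fundamental_path N) i"
proof
  assume i: "removable N (fundamental_path N) i"
  then have "i \<le> N" by (simp add: removable_def)
  then show False
    using removable_height[OF i] fundamental_path_nth[of i N] by (cases "even i") simp_all
qed

text \<open>If two constructions end with tiles i and j, i different from j, both tiles can be
  removed to reach a common path. By induction the two shorter constructions are X_j z and X_i z for
  one z, and X_i commutes with X_j. This gives meaning to the \<open>THE\<close> in
  \<open>basis_elt\<close>.\<close>

lemma builds_unique: "p \<in> paths N \<Longrightarrow> B p x \<Longrightarrow> B p y \<Longrightarrow> x = y"
proof (induction p arbitrary: x y rule: path_induct)
  case fundamental
  then show ?case by (metis builds_lastE removable_fundamental)
next
  case (remove p k)
  have "p \<noteq> fundamental_path N"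
    using removable_fundamental remove.hyps(2) by blast
  then obtain i v where i: "removable N p i" "B (remove_tile p i) v" "x = X i (p ! (i - 1)) \<otimes>\<^bsub>A\<^esub> v"
    using builds_lastE[OF remove.prems(1)] by blast
  obtain j w where j: "removable N p j" "B (remove_tile p j) w" "y = X j (p ! (j - 1)) \<otimes>\<^bsub>A\<^esub> w"
    using builds_lastE[OF remove.prems(2)] \<open>p \<noteq> fundamental_path N\<close> by blast
  note unique = remove.IH[OF remove_tile_in_paths area_remove_tile, OF remove.hyps(1) _ remove.hyps(1)]
  show ?case
  proof (cases "i = j")
    case True
    then show ?thesis using unique[of i v w] i j by simp
  next
    case False
    let ?q = "remove_tile (remove_tile p i) j"
    note rem = removable_remove_tile[OF remove.hyps(1)]
    have apart: "Suc i < j \<or> Suc j < i"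
      using removable_apart[of N p i j] removable_apart[of N p j i] i(1) j(1) False by linarith
    have le: "i \<le> N" "j \<le> N" using i(1) j(1) by (auto simp: removable_def)
    have pi: "remove_tile p i \<in> paths N" "remove_tile p j \<in> paths N"
      using remove_tile_in_paths remove.hyps(1) i(1) j(1) by blast+
    have ri: "removable N (remove_tile p i) j" "removable N (remove_tile p j) i"
      and swap: "remove_tile (remove_tile p j) i = ?q"
      using rem(1)[OF i(1) j(1)] rem(1)[OF j(1) i(1)] rem(2)[OF i(1) j(1)] False by auto
    have "?q \<in> paths N"
      using remove_tile_in_paths pi ri by blast
    then obtain z where z: "B ?q z" using ex_builds by blast
    have nth: "remove_tile p i ! (j - 1) = p ! (j - 1)" "remove_tile p j ! (i - 1) = p ! (i - 1)"
      using remove_tile_nth[OF remove.hyps(1) i(1), of "j - 1"]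
        remove_tile_nth[OF remove.hyps(1) j(1), of "i - 1"] apart le by auto
    have "v = X j (p ! (j - 1)) \<otimes>\<^bsub>A\<^esub> z"
      using builds_add_tile[OF pi(1) ri(1) z] unique[OF i(1) i(1) i(2)] nth by simp
    moreover have "w = X i (p ! (i - 1)) \<otimes>\<^bsub>A\<^esub> z"
      using builds_add_tile[OF pi(2) ri(2), of z] z swap unique[OF j(1) j(1) j(2)] nth by simp
    ultimately show ?thesis
      using i(3) j(3) X_op_commute[OF le apart] builds_closed[OF z] le
      by (simp add: A.m_assoc[symmetric] X_op_closed)
  qed
qed

lemma builds_b_elt: "p \<in> paths N \<Longrightarrow> B p (b_elt p)"
proof -
  assume p: "p \<in> paths N"
  then obtain x where x: "B p x" using ex_builds by blast
  show "B p (b_elt p)"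
    unfolding basis_elt_def by (rule theI[of "B p", OF x builds_unique[OF p _ x]])
qed

lemma b_elt_fundamental: "b_elt (fundamental_path N) = E_N"
  by (rule builds_unique[OF fundamental_path_in_paths builds_b_elt[OF fundamental_path_in_paths]
        builds.base])

lemma b_elt_add_tile:
  assumes "p \<in> paths N" "removable N p i"
  shows "b_elt p = X i (p ! (i - 1)) \<otimes>\<^bsub>A\<^esub> b_elt (remove_tile p i)"
  by (rule builds_unique[OF assms(1) builds_b_elt[OF assms(1)]])
    (rule builds_add_tile[OF assms builds_b_elt[OF remove_tile_in_paths[OF assms]]])

lemma b_elt_closed: "p \<in> paths N \<Longrightarrow> b_elt p \<in> carrier A"
  by (rule builds_closed[OF builds_b_elt])

lemma b_elt_in_W_mod: "p \<in> paths N \<Longrightarrow> \<exists>a\<in>carrier A. b_elt p = a \<otimes>\<^bsub>A\<^esub> E_N"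
proof (induction p rule: path_induct)
  case fundamental
  have "b_elt (fundamental_path N) = \<one>\<^bsub>A\<^esub> \<otimes>\<^bsub>A\<^esub> E_N"
    unfolding b_elt_fundamental by (rule A.l_one[symmetric]) (rule E_idem_closed[OF order_refl])
  then show ?case by (rule bexI) (rule A.one_closed)
next
  case (remove p i)
  have "i \<le> N" using remove.hyps(2) unfolding removable_def by blast
  have "\<exists>a\<in>carrier A. b_elt (remove_tile p i) = a \<otimes>\<^bsub>A\<^esub> E_N"
    by (rule remove.IH[OF remove_tile_in_paths[OF remove.hyps] area_remove_tile[OF remove.hyps]])
  then obtain a where a: "a \<in> carrier A" "b_elt (remove_tile p i) = a \<otimes>\<^bsub>A\<^esub> E_N"
    by (rule bexE)
  have "b_elt p = (X i (p ! (i - 1)) \<otimes>\<^bsub>A\<^esub> a) \<otimes>\<^bsub>A\<^esub> E_N"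
    unfolding b_elt_add_tile[OF remove.hyps] a(2)
    by (rule A.m_assoc[symmetric, OF X_op_closed[OF \<open>i \<le> N\<close>] a(1) E_idem_closed[OF order_refl]])
  then show ?case
    by (rule bexI) (rule A.m_closed[OF X_op_closed[OF \<open>i \<le> N\<close>] a(1)])
qed

end

section \<open>All double quotients inside one ring type\<close>

context double_quotient_alg
begin

abbreviation sc :: "complex \<Rightarrow> free_elem set \<Rightarrow> free_elem set"
  where "sc \<equiv> scale_by N \<eta> \<omega>\<^sub>1 \<omega>\<^sub>2 \<theta>"

lemma cl_cases [consumes 1, case_names cl]:
  assumes "x \<in> carrier A"
  obtains f where "f \<in> free_carrier N" "x = cl f"
  using assms by (auto simp: carrier_A)

lemma sc_algebra:
  assumes "x \<in> carrier A" "y \<in> carrier A"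
  shows "sc c (x \<oplus>\<^bsub>A\<^esub> y) = sc c x \<oplus>\<^bsub>A\<^esub> sc c y"
    and "sc (c + d) x = sc c x \<oplus>\<^bsub>A\<^esub> sc d x"
    and "sc c (sc d x) = sc (c * d) x"
    and "sc 1 x = x"
    and "sc c x \<otimes>\<^bsub>A\<^esub> y = sc c (x \<otimes>\<^bsub>A\<^esub> y)"
    and "x \<otimes>\<^bsub>A\<^esub> sc c y = sc c (x \<otimes>\<^bsub>A\<^esub> y)"
    and "sc c x \<in> carrier A"
proof -
  obtain f g where fg: "f \<in> free_carrier N" "g \<in> free_carrier N" and x: "x = cl f" and y: "y = cl g"
    using assms by (meson cl_cases)
  note [simp] = fg free_carrier_closed
  show "sc c (x \<oplus>\<^bsub>A\<^esub> y) = sc c x \<oplus>\<^bsub>A\<^esub> sc c y"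
    unfolding x y by (simp add: cl_add[symmetric] scale_by_cl distrib_left)
  show "sc (c + d) x = sc c x \<oplus>\<^bsub>A\<^esub> sc d x"
    unfolding x y by (simp add: cl_add[symmetric] scale_by_cl distrib_right scalar_add)
  show "sc c (sc d x) = sc (c * d) x"
    unfolding x by (simp add: scale_by_cl mult.assoc[symmetric] scalar_mult)
  show "sc 1 x = x"
    unfolding x by (simp add: scale_by_cl scalar_1)
  show "sc c x \<otimes>\<^bsub>A\<^esub> y = sc c (x \<otimes>\<^bsub>A\<^esub> y)"
    unfolding x y by (simp add: scale_by_cl cl_mult[symmetric] mult.assoc)
  show "x \<otimes>\<^bsub>A\<^esub> sc c y = sc c (x \<otimes>\<^bsub>A\<^esub> y)"
    unfolding x y by (simp add: scale_by_cl cl_mult[symmetric]) (metis mult.assoc scalar_central)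
  show "sc c x \<in> carrier A"
    unfolding x by (simp add: scale_by_cl)
qed

lemma transpose_algebra:
  assumes "x \<in> carrier A" "y \<in> carrier A"
  shows "transpose_el x \<in> carrier A"
    and "transpose_el (x \<otimes>\<^bsub>A\<^esub> y) = transpose_el y \<otimes>\<^bsub>A\<^esub> transpose_el x"
    and "transpose_el (x \<oplus>\<^bsub>A\<^esub> y) = transpose_el x \<oplus>\<^bsub>A\<^esub> transpose_el y"
    and "transpose_el (sc c x) = sc c (transpose_el x)"
proof -
  obtain f g where fg: "f \<in> free_carrier N" "g \<in> free_carrier N" and x: "x = cl f" and y: "y = cl g"
    using assms by (meson cl_cases)
  note [simp] = fg free_carrier_closed free_rev_in_free_carrier
  show "transpose_el x \<in> carrier A"
    unfolding x by (simp add: transpose_cl)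
  show "transpose_el (x \<otimes>\<^bsub>A\<^esub> y) = transpose_el y \<otimes>\<^bsub>A\<^esub> transpose_el x"
    unfolding x y by (simp add: cl_mult[symmetric] transpose_cl free_rev_mult)
  show "transpose_el (x \<oplus>\<^bsub>A\<^esub> y) = transpose_el x \<oplus>\<^bsub>A\<^esub> transpose_el y"
    unfolding x y by (simp add: cl_add[symmetric] transpose_cl free_rev_add)
  show "transpose_el (sc c x) = sc c (transpose_el x)"
    unfolding x by (simp add: scale_by_cl transpose_cl free_rev_mult scalar_central)
qed

lemma transpose_egen: "i \<le> N \<Longrightarrow> transpose_el (egen N \<eta> \<omega>\<^sub>1 \<omega>\<^sub>2 \<theta> i) = egen N \<eta> \<omega>\<^sub>1 \<omega>\<^sub>2 \<theta> i"
  by (simp add: egen_def transpose_cl)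

lemma transpose_one: "transpose_el \<one>\<^bsub>A\<^esub> = \<one>\<^bsub>A\<^esub>"
  using transpose_cl[of "scalar 1"] free_rev_scalar[of 1]
  by (simp only: scalar_1 cl_1)

end

text \<open>
  A single algebra \<open>dq_alg\<close> depends on term parameters and cannot be a type. The product of all of
  them over all parameters can (\<open>N < 2\<close> being replaced by \<open>2\<close>), and each \<open>dq_alg\<close> embeds into it
  as a factor, without its unit. This makes type class reasoning available.
\<close>

datatype parameters = Parameters nat complex complex complex complex

primrec member :: "parameters \<Rightarrow> free_elem set ring"
  where "member (Parameters N \<eta> \<omega>\<^sub>1 \<omega>\<^sub>2 \<theta>) = dq_alg (max N 2) \<eta> \<omega>\<^sub>1 \<omega>\<^sub>2 \<theta>"

primrec member_scale :: "parameters \<Rightarrow> complex \<Rightarrow> free_elem set \<Rightarrow> free_elem set"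
  where "member_scale (Parameters N \<eta> \<omega>\<^sub>1 \<omega>\<^sub>2 \<theta>) = scale_by (max N 2) \<eta> \<omega>\<^sub>1 \<omega>\<^sub>2 \<theta>"

lemma member_double_quotient:
  obtains N \<eta> \<omega>\<^sub>1 \<omega>\<^sub>2 \<theta> where "double_quotient_alg N" "member \<pi> = dq_alg N \<eta> \<omega>\<^sub>1 \<omega>\<^sub>2 \<theta>"
    "member_scale \<pi> = scale_by N \<eta> \<omega>\<^sub>1 \<omega>\<^sub>2 \<theta>"
proof (cases \<pi>)
  case (Parameters N \<eta> \<omega>\<^sub>1 \<omega>\<^sub>2 \<theta>)
  then show ?thesis
    by (intro that[of "max N 2" \<eta> \<omega>\<^sub>1 \<omega>\<^sub>2 \<theta>])
      (simp_all add: double_quotient_alg_def)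
qed

lemma ring_member: "ring (member \<pi>)"
  by (rule member_double_quotient[of \<pi>]) (simp add: double_quotient_alg_def ring_dq_alg)

lemma member_scale:
  assumes "x \<in> carrier (member \<pi>)" "y \<in> carrier (member \<pi>)"
  shows "member_scale \<pi> c (x \<oplus>\<^bsub>member \<pi>\<^esub> y) = member_scale \<pi> c x \<oplus>\<^bsub>member \<pi>\<^esub> member_scale \<pi> c y"
    and "member_scale \<pi> (c + d) x = member_scale \<pi> c x \<oplus>\<^bsub>member \<pi>\<^esub> member_scale \<pi> d x"
    and "member_scale \<pi> c (member_scale \<pi> d x) = member_scale \<pi> (c * d) x"
    and "member_scale \<pi> 1 x = x"
    and "member_scale \<pi> c x \<otimes>\<^bsub>member \<pi>\<^esub> y = member_scale \<pi> c (x \<otimes>\<^bsub>member \<pi>\<^esub> y)"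
    and "x \<otimes>\<^bsub>member \<pi>\<^esub> member_scale \<pi> c y = member_scale \<pi> c (x \<otimes>\<^bsub>member \<pi>\<^esub> y)"
    and "member_scale \<pi> c x \<in> carrier (member \<pi>)"
proof -
  obtain N \<eta> \<omega>\<^sub>1 \<omega>\<^sub>2 \<theta> where "double_quotient_alg N" and eq: "member \<pi> = dq_alg N \<eta> \<omega>\<^sub>1 \<omega>\<^sub>2 \<theta>"
    "member_scale \<pi> = scale_by N \<eta> \<omega>\<^sub>1 \<omega>\<^sub>2 \<theta>"
    by (rule member_double_quotient)
  then interpret double_quotient_alg N \<eta> \<omega>\<^sub>1 \<omega>\<^sub>2 \<theta> by simp
  note facts = sc_algebra[OF assms[unfolded eq], folded eq]
  show "member_scale \<pi> c (x \<oplus>\<^bsub>member \<pi>\<^esub> y) = member_scale \<pi> c x \<oplus>\<^bsub>member \<pi>\<^esub> member_scale \<pi> c y"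
    "member_scale \<pi> (c + d) x = member_scale \<pi> c x \<oplus>\<^bsub>member \<pi>\<^esub> member_scale \<pi> d x"
    "member_scale \<pi> c (member_scale \<pi> d x) = member_scale \<pi> (c * d) x"
    "member_scale \<pi> 1 x = x"
    "member_scale \<pi> c x \<otimes>\<^bsub>member \<pi>\<^esub> y = member_scale \<pi> c (x \<otimes>\<^bsub>member \<pi>\<^esub> y)"
    "x \<otimes>\<^bsub>member \<pi>\<^esub> member_scale \<pi> c y = member_scale \<pi> c (x \<otimes>\<^bsub>member \<pi>\<^esub> y)"
    "member_scale \<pi> c x \<in> carrier (member \<pi>)"
    by (fact facts)+
qed

lemma member_transpose:
  assumes "x \<in> carrier (member \<pi>)" "y \<in> carrier (member \<pi>)"
  shows "transpose_el x \<in> carrier (member \<pi>)"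
    and "transpose_el (x \<otimes>\<^bsub>member \<pi>\<^esub> y) = transpose_el y \<otimes>\<^bsub>member \<pi>\<^esub> transpose_el x"
    and "transpose_el (x \<oplus>\<^bsub>member \<pi>\<^esub> y) = transpose_el x \<oplus>\<^bsub>member \<pi>\<^esub> transpose_el y"
    and "transpose_el (member_scale \<pi> c x) = member_scale \<pi> c (transpose_el x)"
proof -
  obtain N \<eta> \<omega>\<^sub>1 \<omega>\<^sub>2 \<theta> where "double_quotient_alg N" and eq: "member \<pi> = dq_alg N \<eta> \<omega>\<^sub>1 \<omega>\<^sub>2 \<theta>"
    "member_scale \<pi> = scale_by N \<eta> \<omega>\<^sub>1 \<omega>\<^sub>2 \<theta>"
    by (rule member_double_quotient)
  then interpret double_quotient_alg N \<eta> \<omega>\<^sub>1 \<omega>\<^sub>2 \<theta> by simp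
  note facts = transpose_algebra[OF assms[unfolded eq], folded eq]
  show "transpose_el x \<in> carrier (member \<pi>)"
    "transpose_el (x \<otimes>\<^bsub>member \<pi>\<^esub> y) = transpose_el y \<otimes>\<^bsub>member \<pi>\<^esub> transpose_el x"
    "transpose_el (x \<oplus>\<^bsub>member \<pi>\<^esub> y) = transpose_el x \<oplus>\<^bsub>member \<pi>\<^esub> transpose_el y"
    "transpose_el (member_scale \<pi> c x) = member_scale \<pi> c (transpose_el x)"
    by (fact facts)+
qed

text \<open>Rules about a single element are instantiated with y = x, since otherwise their second
  carrier premise would contain a free unknown for the simplifier.\<close>

lemmas member_scale_simps = member_scale(1,5,6) member_scale(2,3,4,7)[of x _ x for x]
lemmas member_transpose_simps = member_transpose(2,3) member_transpose(1,4)[of x _ x for x]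

lemma member_transpose_one: "transpose_el \<one>\<^bsub>member \<pi>\<^esub> = \<one>\<^bsub>member \<pi>\<^esub>"
  by (rule member_double_quotient[of \<pi>]) (simp add: double_quotient_alg.transpose_one)

typedef family = "{x :: parameters \<Rightarrow> free_elem set. \<forall>\<pi>. x \<pi> \<in> carrier (member \<pi>)}"
  morphisms comp Family
  using ring.ring_simprules(2)[OF ring_member] by (intro exI[of _ "\<lambda>\<pi>. \<zero>\<^bsub>member \<pi>\<^esub>"]) auto

setup_lifting type_definition_family

instantiation family :: "{ring, monoid_mult}"
begin

lift_definition zero_family :: family is "\<lambda>\<pi>. \<zero>\<^bsub>member \<pi>\<^esub>"
  using ring.ring_simprules[OF ring_member] by simp

lift_definition one_family :: family is "\<lambda>\<pi>. \<one>\<^bsub>member \<pi>\<^esub>"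
  using ring.ring_simprules[OF ring_member] by simp

lift_definition plus_family :: "family \<Rightarrow> family \<Rightarrow> family" is "\<lambda>x y \<pi>. x \<pi> \<oplus>\<^bsub>member \<pi>\<^esub> y \<pi>"
  using ring.ring_simprules[OF ring_member] by simp

lift_definition uminus_family :: "family \<Rightarrow> family" is "\<lambda>x \<pi>. \<ominus>\<^bsub>member \<pi>\<^esub> x \<pi>"
  using ring.ring_simprules[OF ring_member] by simp

lift_definition minus_family :: "family \<Rightarrow> family \<Rightarrow> family" is "\<lambda>x y \<pi>. x \<pi> \<ominus>\<^bsub>member \<pi>\<^esub> y \<pi>"
  using ring.ring_simprules[OF ring_member] by simp

lift_definition times_family :: "family \<Rightarrow> family \<Rightarrow> family" is "\<lambda>x y \<pi>. x \<pi> \<otimes>\<^bsub>member \<pi>\<^esub> y \<pi>"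
  using ring.ring_simprules[OF ring_member] by simp

instance
proof
  note rules = ring.ring_simprules[OF ring_member]
  fix a b c :: family
  show "a + b + c = a + (b + c)" by transfer (simp add: rules(7))
  show "a + b = b + a" by transfer (simp add: rules(10))
  show "0 + a = a" by transfer (simp add: rules(8))
  show "- a + a = 0" by transfer (simp add: rules(9))
  show "a - b = a + - b" by transfer (simp add: a_minus_def)
  show "a * b * c = a * (b * c)" by transfer (simp add: rules(11))
  show "(a + b) * c = a * c + b * c" by transfer (simp add: rules(13))
  show "a * (b + c) = a * b + a * c" by transfer (simp add: rules(23))
  show "1 * a = a" by transfer (simp add: rules(12))
  show "a * 1 = a" by transfer (simp add: monoid.r_one[OF ring.is_monoid[OF ring_member]])
qed

end

lift_definition scale_family :: "complex \<Rightarrow> family \<Rightarrow> family" is "\<lambda>c x \<pi>. member_scale \<pi> c (x \<pi>)"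
  by (simp add: member_scale_simps)

lift_definition transpose_family :: "family \<Rightarrow> family" is "\<lambda>x \<pi>. transpose_el (x \<pi>)"
  by (simp add: member_transpose_simps)

interpretation family: complex_algebra scale_family
proof
  fix x y :: family and c d
  show "scale_family c (x + y) = scale_family c x + scale_family c y"
    "scale_family (c + d) x = scale_family c x + scale_family d x"
    "scale_family c (scale_family d x) = scale_family (c * d) x"
    "scale_family 1 x = x"
    "scale_family c x * y = scale_family c (x * y)"
    "x * scale_family c y = scale_family c (x * y)"
    by (transfer; simp add: member_scale_simps)+
qed

lemma transpose_family:
  "transpose_family (x * y) = transpose_family y * transpose_family x"
  "transpose_family (x + y) = transpose_family x + transpose_family y"
  "transpose_family (scale_family c x) = scale_family c (transpose_family x)"
  by (transfer; simp add: member_transpose_simps)+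

lemma transpose_family_one: "transpose_family 1 = 1"
  by transfer (simp add: member_transpose_one)

context double_quotient_alg
begin

definition embed :: "free_elem set \<Rightarrow> family"
  where "embed x = Family (\<lambda>\<pi>. if \<pi> = Parameters N \<eta> \<omega>\<^sub>1 \<omega>\<^sub>2 \<theta> then x else \<zero>\<^bsub>member \<pi>\<^esub>)"

lemma member_eq: "member (Parameters N \<eta> \<omega>\<^sub>1 \<omega>\<^sub>2 \<theta>) = A" "member_scale (Parameters N \<eta> \<omega>\<^sub>1 \<omega>\<^sub>2 \<theta>) = sc"
  using N_ge_2 by (simp_all add: max_def)

declare member.simps [simp del] member_scale.simps [simp del]

lemma comp_embed:
  "x \<in> carrier A \<Longrightarrow> comp (embed x) = (\<lambda>\<pi>. if \<pi> = Parameters N \<eta> \<omega>\<^sub>1 \<omega>\<^sub>2 \<theta> then x else \<zero>\<^bsub>member \<pi>\<^esub>)"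
  unfolding embed_def
  by (rule Family_inverse) (auto simp: member_eq ring.ring_simprules[OF ring_member])

lemma embed_inject: "x \<in> carrier A \<Longrightarrow> y \<in> carrier A \<Longrightarrow> embed x = embed y \<longleftrightarrow> x = y"
  using comp_embed by metis

lemma member_scale_zero: "member_scale \<pi> c \<zero>\<^bsub>member \<pi>\<^esub> = \<zero>\<^bsub>member \<pi>\<^esub>"
  using arg_cong[OF family.scale_zero_right[of c], of "\<lambda>x. comp x \<pi>"]
  unfolding scale_family.rep_eq zero_family.rep_eq .

lemma transpose_zero: "transpose_el \<zero>\<^bsub>member \<pi>\<^esub> = \<zero>\<^bsub>member \<pi>\<^esub>"
proof -
  have "transpose_family 0 = 0"
    using transpose_family(2)[of 0 0] by simp
  from arg_cong[OF this, of "\<lambda>x. comp x \<pi>"] show ?thesis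
    by (simp add: transpose_family.rep_eq zero_family.rep_eq)
qed

lemma embed_hom:
  assumes "x \<in> carrier A" "y \<in> carrier A"
  shows "embed (x \<otimes>\<^bsub>A\<^esub> y) = embed x * embed y"
    and "embed (x \<oplus>\<^bsub>A\<^esub> y) = embed x + embed y"
    and "embed (x \<ominus>\<^bsub>A\<^esub> y) = embed x - embed y"
    and "embed (sc c x) = scale_family c (embed x)"
    and "embed (transpose_el x) = transpose_family (embed x)"
  using assms
  by (auto simp: comp_inject[symmetric] fun_eq_iff comp_embed times_family.rep_eq plus_family.rep_eq
      minus_family.rep_eq scale_family.rep_eq transpose_family.rep_eq member_eq sc_algebra
      transpose_algebra ring.ring_simprules[OF ring_member] member_scale_zero transpose_zero a_minus_def)

lemma embed_egen_transpose:
  "i \<le> N \<Longrightarrow> transpose_family (embed (egen N \<eta> \<omega>\<^sub>1 \<omega>\<^sub>2 \<theta> i)) = embed (egen N \<eta> \<omega>\<^sub>1 \<omega>\<^sub>2 \<theta> i)"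
  using embed_hom(5)[OF egen_closed egen_closed, of i i] by (simp add: transpose_egen)

lemma embed_0: "embed \<zero>\<^bsub>A\<^esub> = 0"
  by (auto simp: comp_inject[symmetric] fun_eq_iff comp_embed zero_family.rep_eq member_eq)

end

section \<open>Quantum numbers\<close>

lemma qpow_add: "qpow \<eta> (x + y) = qpow \<eta> x * qpow \<eta> y"
  by (simp add: qpow_def distrib_left exp_add)

lemma qpow_minus: "qpow \<eta> (- x) = 1 / qpow \<eta> x"
  by (simp add: qpow_def exp_minus divide_inverse)

lemma qpow_diff: "qpow \<eta> (x - y) = qpow \<eta> x / qpow \<eta> y"
  using qpow_add[of \<eta> x "- y"] by (simp add: qpow_minus)

lemma qpow_nonzero [simp]: "qpow \<eta> x \<noteq> 0"
  by (simp add: qpow_def)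

lemma qpow_0 [simp]: "qpow \<eta> 0 = 1"
  by (simp add: qpow_def)

lemma qnum_minus: "qnum \<eta> (- x) = - qnum \<eta> x"
  by (simp add: qnum_def minus_divide_left)

locale quantum =
  fixes \<eta> :: complex
  assumes q_sq_neq_1: "qpow \<eta> 1 ^ 2 \<noteq> 1"
begin

abbreviation q :: complex where "q \<equiv> qpow \<eta> 1"
abbreviation qn :: "complex \<Rightarrow> complex" where "qn \<equiv> qnum \<eta>"

definition D :: complex where "D = q - 1 / q"

lemma D_nonzero [simp]: "D \<noteq> 0"
  using q_sq_neq_1 by (simp add: D_def field_simps power2_eq_square)

lemma qn_eq: "qn x = (qpow \<eta> x - 1 / qpow \<eta> x) / D"
  by (simp add: qnum_def D_def qpow_minus)

lemma qn_plus_1: "qn (x + 1) = (qpow \<eta> x * q - 1 / (qpow \<eta> x * q)) / D"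
  by (simp add: qn_eq qpow_add)

lemma D_square: "D * D = q * q + 1 / (q * q) - 2"
  by (simp add: D_def algebra_simps)

lemma qn_2: "qn 2 = q + 1 / q"
proof -
  have "qpow \<eta> 2 = q * q" using qpow_add[of \<eta> 1 1] by simp
  then have "qn 2 * D = (q + 1 / q) * D"
    by (simp add: qn_eq) (simp add: D_def algebra_simps)
  then show ?thesis by simp
qed

lemma qn_mult:
  "qn x * qn y = (qpow \<eta> (x + y) + qpow \<eta> (- x - y) - qpow \<eta> (x - y) - qpow \<eta> (y - x)) / (D * D)"
  by (simp add: qn_eq qpow_add qpow_diff qpow_minus algebra_simps diff_divide_distrib add_divide_distrib)

lemma qn_succ_mult_pred: "qn (u + 1) * qn (u - 1) = qn u * qn u - 1"
proof -
  have "qpow \<eta> 2 = q * q" using qpow_add[of \<eta> 1 1] by simp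
  moreover have "(u + 1) - (u - 1) = 2" "(u - 1) - (u + 1) = - 2" by simp_all
  ultimately have "qn (u + 1) * qn (u - 1) - qn u * qn u = (2 - (q * q + 1 / (q * q))) / (D * D)"
    by (simp add: qn_mult qpow_minus diff_divide_distrib[symmetric] add_divide_distrib[symmetric] algebra_simps)
  also have "\<dots> = - 1"
    by (simp add: D_square[symmetric] minus_divide_left[symmetric] divide_eq_eq) (simp add: D_square)
  finally show ?thesis by (simp add: algebra_simps)
qed

text \<open>From [u+1] - q[u] = q^{-u}. These differences are the diagonal entries of the Hecke
  generator e - q on a block.\<close>

lemma r_minus_q: "qn u \<noteq> 0 \<Longrightarrow> r_fun \<eta> u - q = 1 / (qpow \<eta> u * qn u)"
proof -
  assume u: "qn u \<noteq> 0"
  have "qn (u + 1) - q * qn u = (q / qpow \<eta> u - 1 / (qpow \<eta> u * q)) / D"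
    unfolding qn_plus_1 qn_eq[of u] by (simp add: diff_divide_distrib algebra_simps)
  also have "q / qpow \<eta> u - 1 / (qpow \<eta> u * q) = D / qpow \<eta> u"
    by (simp add: D_def field_simps)
  finally have "qn (u + 1) - q * qn u = 1 / qpow \<eta> u"
    by simp
  then show ?thesis
    using u by (simp add: r_fun_def field_simps)
qed

text \<open>Equivalent to e_i R_i(u) = r(-u) e_i, given e_i^2 = [2] e_i.\<close>

lemma r_add_r_minus:
  assumes "qn u \<noteq> 0"
  shows "r_fun \<eta> u + r_fun \<eta> (- u) = qn 2"
proof -
  have u': "qn (- u) \<noteq> 0" using assms by (simp add: qnum_minus)
  have "r_fun \<eta> u + r_fun \<eta> (- u) - 2 * q = 1 / (qpow \<eta> u * qn u) - qpow \<eta> u / qn u"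
    using r_minus_q[OF assms] r_minus_q[OF u'] by (simp add: qnum_minus qpow_minus algebra_simps)
  also have "\<dots> = - (qpow \<eta> u - 1 / qpow \<eta> u) / qn u"
    by (simp add: diff_divide_distrib)
  also have "qpow \<eta> u - 1 / qpow \<eta> u = D * qn u"
    by (simp add: qn_eq[of u])
  also have "- (D * qn u) / qn u = - D"
    using assms by simp
  finally show ?thesis
    by (simp add: qn_2 D_def algebra_simps)
qed

text \<open>The reflection u -> -u - 1 inverts r; this is the scalar identity behind the Yang-Baxter
  step.\<close>

lemma r_mult_r:
  "qn u \<noteq> 0 \<Longrightarrow> qn (u + 1) \<noteq> 0 \<Longrightarrow> r_fun \<eta> u * r_fun \<eta> (- u - 1) = 1"
  using qnum_minus[of \<eta> "u + 1"] qnum_minus[of \<eta> u] by (simp add: r_fun_def)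

lemma r_mult_r_minus: "qn u \<noteq> 0 \<Longrightarrow> r_fun \<eta> u * r_fun \<eta> (- u) = 1 - 1 / (qn u * qn u)"
  using qnum_minus[of \<eta> u] qnum_minus[of \<eta> "u - 1"] qn_succ_mult_pred[of u]
  by (simp add: r_fun_def field_simps)

text \<open>The numerator of k(u) after the product-to-sum formula: no halved arguments remain, and
  theta occurs only in a constant that cancels in differences.\<close>

definition k_num :: "complex \<Rightarrow> complex \<Rightarrow> complex \<Rightarrow> complex"
  where "k_num \<omega>\<^sub>2 \<theta> u = - (qpow \<eta> (u - \<omega>\<^sub>2) + qpow \<eta> (\<omega>\<^sub>2 - u) - (qpow \<eta> \<theta> + qpow \<eta> (- \<theta>)))
    / (D * D * qn (\<omega>\<^sub>2 + 1))"

lemma qn_mult_halves: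
  "qn ((x + y) / 2) * qn ((x - y) / 2)
    = (qpow \<eta> x + qpow \<eta> (- x) - (qpow \<eta> y + qpow \<eta> (- y))) / (D * D)"
proof -
  have "(x + y) / 2 + (x - y) / 2 = x" "- ((x + y) / 2) - (x - y) / 2 = - x"
    "(x + y) / 2 - (x - y) / 2 = y" "(x - y) / 2 - (x + y) / 2 = - y"
    by (simp_all add: field_simps)
  then show ?thesis by (simp only: qn_mult diff_diff_eq)
qed

lemma k_fun_eq: "k_fun \<eta> \<omega>\<^sub>2 \<theta> u = k_num \<omega>\<^sub>2 \<theta> u / qn u"
  unfolding k_fun_def qn_mult_halves k_num_def by (simp add: mult_ac minus_divide_left)

text \<open>Read backwards, the product-to-sum formula turns the differences into [u][omega_2] and
  [u+1][omega_2+1], each over [omega_2+1].\<close>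

lemma k_num_diff:
  assumes "qn (\<omega>\<^sub>2 + 1) \<noteq> 0"
  shows "k_num \<omega>\<^sub>2 \<theta> u - k_num \<omega>\<^sub>2 \<theta> (- u) = qn u * (qn \<omega>\<^sub>2 / qn (\<omega>\<^sub>2 + 1))"
    and "k_num \<omega>\<^sub>2 \<theta> u - k_num \<omega>\<^sub>2 \<theta> (- u - 2) = qn (u + 1)"
proof -
  have e: "- u - \<omega>\<^sub>2 = - (u + \<omega>\<^sub>2)" "\<omega>\<^sub>2 - - u = u + \<omega>\<^sub>2" by simp_all
  have "k_num \<omega>\<^sub>2 \<theta> u - k_num \<omega>\<^sub>2 \<theta> (- u) =
      (qpow \<eta> (u + \<omega>\<^sub>2) + qpow \<eta> (- u - \<omega>\<^sub>2) - qpow \<eta> (u - \<omega>\<^sub>2) - qpow \<eta> (\<omega>\<^sub>2 - u)) / (D * D * qn (\<omega>\<^sub>2 + 1))"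
    unfolding k_num_def e by (simp add: diff_divide_distrib[symmetric])
  also have "\<dots> = qn u * qn \<omega>\<^sub>2 / qn (\<omega>\<^sub>2 + 1)"
    by (simp add: qn_mult)
  finally show "k_num \<omega>\<^sub>2 \<theta> u - k_num \<omega>\<^sub>2 \<theta> (- u) = qn u * (qn \<omega>\<^sub>2 / qn (\<omega>\<^sub>2 + 1))"
    by simp
  have e': "- u - 2 - \<omega>\<^sub>2 = - (u + 1) - (\<omega>\<^sub>2 + 1)" "\<omega>\<^sub>2 - (- u - 2) = (u + 1) + (\<omega>\<^sub>2 + 1)"
    "u - \<omega>\<^sub>2 = (u + 1) - (\<omega>\<^sub>2 + 1)" "\<omega>\<^sub>2 - u = (\<omega>\<^sub>2 + 1) - (u + 1)" by simp_all
  have "k_num \<omega>\<^sub>2 \<theta> u - k_num \<omega>\<^sub>2 \<theta> (- u - 2) =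
      (qpow \<eta> ((u + 1) + (\<omega>\<^sub>2 + 1)) + qpow \<eta> (- (u + 1) - (\<omega>\<^sub>2 + 1)) - qpow \<eta> ((u + 1) - (\<omega>\<^sub>2 + 1))
        - qpow \<eta> ((\<omega>\<^sub>2 + 1) - (u + 1))) / (D * D * qn (\<omega>\<^sub>2 + 1))"
    unfolding k_num_def e' by (simp only: diff_divide_distrib[symmetric]) (simp add: algebra_simps)
  also have "\<dots> = qn (u + 1) * qn (\<omega>\<^sub>2 + 1) / qn (\<omega>\<^sub>2 + 1)"
    unfolding qn_mult by (simp only: divide_divide_eq_left)
  finally show "k_num \<omega>\<^sub>2 \<theta> u - k_num \<omega>\<^sub>2 \<theta> (- u - 2) = qn (u + 1)"
    using assms by simp
qed

lemma k_add_k_minus: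
  assumes "qn (\<omega>\<^sub>2 + 1) \<noteq> 0" "qn u \<noteq> 0"
  shows "k_fun \<eta> \<omega>\<^sub>2 \<theta> u + k_fun \<eta> \<omega>\<^sub>2 \<theta> (- u) = qn \<omega>\<^sub>2 / qn (\<omega>\<^sub>2 + 1)"
  using k_num_diff(1)[OF assms(1), of \<theta> u] assms
  by (simp add: k_fun_eq qnum_minus diff_divide_distrib[symmetric])

text \<open>This identity is the content of the reflection equation for \<open>R\<^sub>i\<close> and \<open>K\<^sub>N\<close>;
  the parameter \<open>\<theta>\<close> drops out.\<close>

lemma reflection_identity:
  assumes "qn (\<omega>\<^sub>2 + 1) \<noteq> 0" "qn u \<noteq> 0" "qn (u + 1) \<noteq> 0" "qn (u + 2) \<noteq> 0"
  shows "1 - r_fun \<eta> (u + 1) * k_fun \<eta> \<omega>\<^sub>2 \<theta> (- u - 2) - k_fun \<eta> \<omega>\<^sub>2 \<theta> u * r_fun \<eta> (- u - 1) = 0"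
proof -
  have m: "qn (- u - 2) = - qn (u + 2)" "qn (- u - 1) = - qn (u + 1)" "qn (- u) = - qn u"
    "u + 1 + 1 = u + 2"
    using qnum_minus[of \<eta> "u + 2"] qnum_minus[of \<eta> "u + 1"] by (simp_all add: qnum_minus)
  have "r_fun \<eta> (u + 1) * k_fun \<eta> \<omega>\<^sub>2 \<theta> (- u - 2) = - k_num \<omega>\<^sub>2 \<theta> (- u - 2) / qn (u + 1)"
    using assms by (simp add: r_fun_def k_fun_eq m)
  moreover have "k_fun \<eta> \<omega>\<^sub>2 \<theta> u * r_fun \<eta> (- u - 1) = k_num \<omega>\<^sub>2 \<theta> u / qn (u + 1)"
    using assms by (simp add: r_fun_def k_fun_eq m)
  moreover have "k_num \<omega>\<^sub>2 \<theta> u / qn (u + 1) - k_num \<omega>\<^sub>2 \<theta> (- u - 2) / qn (u + 1) = 1"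
    unfolding diff_divide_distrib[symmetric] k_num_diff(2)[OF assms(1)] using assms(3) by simp
  ultimately show ?thesis by (simp add: diff_eq_eq)
qed

end

section \<open>The action of the generators on the path elements\<close>

locale path_module =
  quantum \<eta> + double_quotient scale e N "s1_par \<eta> \<omega>\<^sub>1" "b_weight N \<eta> \<omega>\<^sub>1 \<omega>\<^sub>2 \<theta>"
  for \<eta> \<omega>\<^sub>1 \<omega>\<^sub>2 \<theta> :: complex
    and scale :: "complex \<Rightarrow> 'a::{ring,monoid_mult} \<Rightarrow> 'a" (infixr "*s" 75)
    and e :: "nat \<Rightarrow> 'a" and N :: nat +
  fixes v :: "int list \<Rightarrow> 'a" and tr :: "'a \<Rightarrow> 'a"
  assumes e_sq: "1 \<le> i \<Longrightarrow> i < N \<Longrightarrow> e i * e i = qnum \<eta> 2 *s e i"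
    and e_N_sq: "e N * e N = s2_par \<eta> \<omega>\<^sub>2 *s e N"
    and generic: "qnum \<eta> (\<omega>\<^sub>1 - of_int m) \<noteq> 0"
    and qn_omega2: "qnum \<eta> (\<omega>\<^sub>2 + 1) \<noteq> 0"
    and v_fundamental: "v (fundamental_path N) = E N"
    and v_add_tile: "p \<in> paths N \<Longrightarrow> removable N p i \<Longrightarrow> v p =
      e i * v (remove_tile p i)
        - weight N \<eta> \<omega>\<^sub>2 \<theta> i (spectral \<omega>\<^sub>1 (p ! (i - 1))) *s v (remove_tile p i)"
    and tr_mult: "tr (x * y) = tr y * tr x"
    and tr_add: "tr (x + y) = tr x + tr y"
    and tr_scale: "tr (c *s x) = c *s tr x"
    and tr_1: "tr 1 = 1"
    and tr_e: "i \<le> N \<Longrightarrow> tr (e i) = e i"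
begin

abbreviation U :: "int \<Rightarrow> complex" where "U \<equiv> spectral \<omega>\<^sub>1"
abbreviation wt :: "nat \<Rightarrow> complex \<Rightarrow> complex" where "wt \<equiv> weight N \<eta> \<omega>\<^sub>2 \<theta>"

definition loop :: "nat \<Rightarrow> complex"
  where "loop i = (if i < N then qn 2 else s2_par \<eta> \<omega>\<^sub>2)"

lemma e_e: "1 \<le> i \<Longrightarrow> i \<le> N \<Longrightarrow> e i * (e i * x) = loop i *s (e i * x)"
  using e_sq[of i, THEN mult_eq_assoc] e_N_sq[THEN mult_eq_assoc] by (auto simp: loop_def)

lemma e_e_comm:
  "i \<le> N \<Longrightarrow> j \<le> N \<Longrightarrow> Suc i < j \<or> Suc j < i \<Longrightarrow> e i * (e j * x) = e j * (e i * x)"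
  using e_comm[of i j] e_comm[of j i] by (metis mult.assoc)

text \<open>Up to sign, a spectral parameter shifted by an integer is omega_1 minus an integer,
  where genericity applies.\<close>

lemma qn_U: "qn (U h + of_int m) \<noteq> 0"
proof (cases "h \<ge> 0")
  case True
  then show ?thesis
    using generic[of "h - m"] by (simp add: spectral_def algebra_simps)
next
  case False
  have "- \<omega>\<^sub>1 + of_int h + of_int m = - (\<omega>\<^sub>1 - of_int (h + m))" by simp
  then have "qn (- \<omega>\<^sub>1 + of_int h + of_int m) = - qn (\<omega>\<^sub>1 - of_int (h + m))"
    by (metis qnum_minus)
  then show ?thesis
    using generic[of "h + m"] False by (simp add: spectral_def)
qed

lemma qn_U_shifts: "qn (U h) \<noteq> 0" "qn (U h + 1) \<noteq> 0" "qn (U h + 2) \<noteq> 0" "qn (U h - 1) \<noteq> 0"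
  using qn_U[of h 0] qn_U[of h 1] qn_U[of h 2] qn_U[of h "-1"] by simp_all

lemma wt_add_wt_minus: "wt i (U h) + wt i (- U h) = loop i"
  using r_add_r_minus[OF qn_U_shifts(1)] k_add_k_minus[OF qn_omega2 qn_U_shifts(1)]
  by (simp add: weight_def loop_def s2_par_def)

text \<open>One step towards the centre adds 1 to the spectral parameter while it stays on the same
  side; crossing between 0 and -1 reflects u to -u - 1. The second case marks where tile removal
  ends and the zigzag relations take over.\<close>

lemma U_diff_outward:
  "outward (h - outward h) = outward h \<Longrightarrow> U (h - outward h) = U h + 1"
  "outward (h - outward h) \<noteq> outward h \<Longrightarrow> h \<in> {0, -1} \<and> h - outward h \<in> {0, -1} \<and> U (h - outward h) = - U h - 1"
  by (auto simp: spectral_def outward_def split: if_splits)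

lemma e_v_remove:
  "p \<in> paths N \<Longrightarrow> removable N p i \<Longrightarrow>
    e i * v (remove_tile p i) = v p + wt i (U (p ! (i - 1))) *s v (remove_tile p i)"
  by (simp add: v_add_tile)

text \<open>Since e_i X_i(u) is e_i times the weight at -u, the vectors e_i b_p for the two paths of
  a pair are proportional.\<close>

lemma e_v_add:
  assumes "p \<in> paths N" "removable N p i"
  shows "e i * v p = wt i (- U (p ! (i - 1))) *s (e i * v (remove_tile p i))"
proof -
  have i: "1 \<le> i" "i \<le> N" using assms(2) unfolding removable_def by blast+
  let ?u = "U (p ! (i - 1))"
  have "e i * v p = loop i *s (e i * v (remove_tile p i)) - wt i ?u *s (e i * v (remove_tile p i))"
    using e_e[OF i] by (simp add: v_add_tile[OF assms] right_diff_distrib)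
  also have "\<dots> = wt i (- ?u) *s (e i * v (remove_tile p i))"
    unfolding wt_add_wt_minus[of i "p ! (i - 1)", symmetric] by (simp add: scale_left_distrib)
  finally show ?thesis .
qed

section \<open>Weights on the fundamental path and the zigzag relations\<close>

lemma U_zero_one: "U 0 = \<omega>\<^sub>1" "U (-1) = - \<omega>\<^sub>1 - 1"
  by (simp_all add: spectral_def)

lemma r_base: "r_fun \<eta> \<omega>\<^sub>1 = 1 / s1_par \<eta> \<omega>\<^sub>1" "r_fun \<eta> (- \<omega>\<^sub>1 - 1) = s1_par \<eta> \<omega>\<^sub>1"
  using qnum_minus[of \<eta> \<omega>\<^sub>1] qnum_minus[of \<eta> "\<omega>\<^sub>1 + 1"] by (simp_all add: r_fun_def s1_par_def)

lemma cf_eq_wt: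
  assumes "Suc i < N"
  shows "cf (Suc i) = wt (Suc i) (U (fundamental_path N ! i))"
proof -
  have "fundamental_path N ! i = (if even i then 0 else -1)"
    using assms by (simp add: fundamental_path_nth)
  then show ?thesis
    using assms r_base by (simp add: cf_def weight_def U_zero_one)
qed

text \<open>The origin of the value of b: it makes the constant in \<open>e_N_E\<close> equal to the
  weight k of a half-tile put on the fundamental path, at u = -omega_1 - 1 for even N and u =
  omega_1 for odd N.\<close>

lemma k_base:
  "wt N (U (fundamental_path N ! (N - 1)))
    = (if even N then b_weight N \<eta> \<omega>\<^sub>1 \<omega>\<^sub>2 \<theta> else b_weight N \<eta> \<omega>\<^sub>1 \<omega>\<^sub>2 \<theta> / s1_par \<eta> \<omega>\<^sub>1)"
proof -
  have nth: "fundamental_path N ! (N - 1) = (if even N then -1 else 0)"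
    using N_ge_2 by (simp add: fundamental_path_nth)
  show ?thesis
  proof (cases "even N")
    case True
    have a: "(- \<omega>\<^sub>1 - 1 - \<omega>\<^sub>2 + \<theta>) / 2 = - ((\<omega>\<^sub>1 + \<omega>\<^sub>2 + 1 - \<theta>) / 2)"
      "(- \<omega>\<^sub>1 - 1 - \<omega>\<^sub>2 - \<theta>) / 2 = - ((\<omega>\<^sub>1 + \<omega>\<^sub>2 + 1 + \<theta>) / 2)"
      by (simp_all add: field_simps)
    have "qn (- \<omega>\<^sub>1 - 1) = - qn (\<omega>\<^sub>1 + 1)"
      using qnum_minus[of \<eta> "\<omega>\<^sub>1 + 1"] by simp
    then have "k_fun \<eta> \<omega>\<^sub>2 \<theta> (- \<omega>\<^sub>1 - 1) = b_weight N \<eta> \<omega>\<^sub>1 \<omega>\<^sub>2 \<theta>"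
      using True unfolding k_fun_def a qnum_minus b_weight_def by simp
    then show ?thesis
      using True nth by (simp add: weight_def U_zero_one)
  next
    case False
    have "k_fun \<eta> \<omega>\<^sub>2 \<theta> \<omega>\<^sub>1 = b_weight N \<eta> \<omega>\<^sub>1 \<omega>\<^sub>2 \<theta> / s1_par \<eta> \<omega>\<^sub>1"
      using False generic[of "-1"] unfolding k_fun_def b_weight_def s1_par_def by simp
    then show ?thesis
      using False nth by (simp add: weight_def U_zero_one)
  qed
qed

lemma zigzag_up:
  assumes "p \<in> paths N" "i < N" "\<And>k. k \<le> N \<Longrightarrow> i \<le> Suc k \<Longrightarrow> k \<le> i + 2 \<Longrightarrow> p ! k \<in> {0, -1}"
  shows "e i * (e (Suc i) * v p) = wt (Suc i) (U (p ! i)) *s (e i * v p)"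
  using assms(1,3)
proof (induction p rule: path_induct)
  case fundamental
  show ?case
  proof (cases "Suc i < N")
    case True
    then show ?thesis
      using e_e_Suc_E[OF True] cf_eq_wt[OF True] by (simp add: v_fundamental mult.assoc)
  next
    case False
    then have "i = N - 1" using assms(2) by simp
    then show ?thesis
      using e_N_E k_base N_ge_2 by (simp add: v_fundamental mult.assoc)
  qed
next
  case (remove p j)
  have j: "1 \<le> j" "j \<le> N" using remove.hyps(2) unfolding removable_def by blast+
  then have far: "\<not> (i \<le> Suc j \<and> j \<le> i + 2)"
    using remove.prems[of j] removable_height[OF remove.hyps(2)] by blast
  let ?p = "remove_tile p j"
  have nth: "?p ! k = p ! k" if "k \<le> N" "k \<noteq> j" for k
    using remove_tile_nth[OF remove.hyps that(1)] that(2) by simp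
  have IH: "e i * (e (Suc i) * v ?p) = wt (Suc i) (U (p ! i)) *s (e i * v ?p)"
  proof -
    have "?p ! k \<in> {0, -1}" if "k \<le> N" "i \<le> Suc k" "k \<le> i + 2" for k
      using remove.prems[OF that] nth[of k] far that by (cases "k = j") auto
    moreover have "?p ! i = p ! i"
      using nth[of i] far assms(2) by auto
    ultimately show ?thesis
      using remove.IH[OF remove_tile_in_paths area_remove_tile, OF remove.hyps remove.hyps] by metis
  qed
  have comm: "e i * (e j * x) = e j * (e i * x)" "e (Suc i) * (e j * x) = e j * (e (Suc i) * x)" for x
    using e_e_comm[of i j] e_e_comm[of "Suc i" j] far j assms(2) by auto
  show ?case
    unfolding v_add_tile[OF remove.hyps] right_diff_distrib scale_mult_right comm IH
    by (simp add: scale_right_diff_distrib mult.commute)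
qed

lemma zigzag_down:
  assumes "p \<in> paths N" "2 \<le> i" "i < N" "\<And>k. i \<le> k + 2 \<Longrightarrow> k \<le> Suc i \<Longrightarrow> p ! k \<in> {0, -1}"
  shows "e i * (e (i - 1) * v p) = wt (i - 1) (U (p ! (i - 2))) *s (e i * v p)"
  using assms(1,4)
proof (induction p rule: path_induct)
  case fundamental
  have "cf (i - 1) = wt (i - 1) (U (fundamental_path N ! (i - 2)))"
    using cf_eq_wt[of "i - 2"] assms(2,3) by (simp add: numeral_2_eq_2 Suc_diff_Suc)
  then show ?case
    using e_e_pred_E[of i] assms(2,3) by (simp add: v_fundamental mult.assoc)
next
  case (remove p j)
  have j: "1 \<le> j" "j \<le> N" using remove.hyps(2) unfolding removable_def by blast+
  then have far: "\<not> (i \<le> j + 2 \<and> j \<le> Suc i)"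
    using remove.prems[of j] removable_height[OF remove.hyps(2)] by blast
  let ?p = "remove_tile p j"
  have nth: "?p ! k = p ! k" if "k \<le> N" "k \<noteq> j" for k
    using remove_tile_nth[OF remove.hyps that(1)] that(2) by simp
  have "?p ! k \<in> {0, -1}" if "i \<le> k + 2" "k \<le> Suc i" for k
    using remove.prems[OF that] nth[of k] far that assms(3) by (cases "k = j") auto
  moreover have "?p ! (i - 2) = p ! (i - 2)"
    using nth[of "i - 2"] far assms(2,3) by auto
  ultimately have IH: "e i * (e (i - 1) * v ?p) = wt (i - 1) (U (p ! (i - 2))) *s (e i * v ?p)"
    using remove.IH[OF remove_tile_in_paths area_remove_tile, OF remove.hyps remove.hyps] by metis
  have comm: "e i * (e j * x) = e j * (e i * x)" "e (i - 1) * (e j * x) = e j * (e (i - 1) * x)" for x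
    using e_e_comm[of i j] e_e_comm[of "i - 1" j] far j assms(2,3) by auto
  show ?case
    unfolding v_add_tile[OF remove.hyps] right_diff_distrib scale_mult_right comm IH
    by (simp add: scale_right_diff_distrib mult.commute)
qed

text \<open>The Yang-Baxter equation applied to a vector killed by e_j: every surviving term is a
  multiple of e_i x, with total coefficient 1 - r0 ([2] - r1).\<close>

lemma slope_bulk_step:
  assumes i: "1 \<le> i" "i < N" and efe: "e i * e j * e i = e i"
    and x: "e j * x = 0" and r: "r0 * (qn 2 - r1) = 1"
  shows "e i * (e j * (e i * x - r1 *s x) - r0 *s (e i * x - r1 *s x)) = 0"
proof -
  have "e i * (e j * (e i * x)) = e i * x"
    using efe by (metis mult.assoc)
  moreover have "e i * (e i * x) = qn 2 *s (e i * x)"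
    using e_e[of i x] i by (simp add: loop_def)
  ultimately have "e i * (e j * (e i * x - r1 *s x) - r0 *s (e i * x - r1 *s x))
      = (1 - r0 * (qn 2 - r1)) *s (e i * x)"
    by (simp add: right_diff_distrib x scale_left_diff_distrib scale_right_diff_distrib algebra_simps)
  then show ?thesis using r by simp
qed

text \<open>The reflection equation in the same reduced form; instead of being killed, y satisfies a
  zigzag relation with some constant \<open>\<kappa>\<close>.\<close>

lemma slope_boundary_step:
  assumes y: "e (N - 1) * (e N * y) = \<kappa> *s (e (N - 1) * y)"
    and k: "1 - r * \<kappa> - k1 * (qn 2 - r) = 0"
  shows "e (N - 1) * (e N * (e (N - 1) * y - r *s y) - k1 *s (e (N - 1) * y - r *s y)) = 0"
proof -
  have "e (N - 1) * (e N * (e (N - 1) * y)) = e (N - 1) * y"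
    using e_up[of "N - 1"] N_ge_2 by (simp add: mult.assoc[symmetric])
  moreover have "e (N - 1) * (e (N - 1) * y) = qn 2 *s (e (N - 1) * y)"
    using e_e[of "N - 1" y] N_ge_2 by (simp add: loop_def)
  ultimately have "e (N - 1) * (e N * (e (N - 1) * y - r *s y) - k1 *s (e (N - 1) * y - r *s y))
      = (1 - r * \<kappa> - k1 * (qn 2 - r)) *s (e (N - 1) * y)"
    by (simp add: right_diff_distrib y[unfolded One_nat_def] scale_left_diff_distrib
        scale_right_diff_distrib algebra_simps)
  then show ?thesis using k by simp
qed

lemma outward_nonzero [simp]: "outward h \<noteq> 0"
  by (simp add: outward_def)

lemma outward_opposite:
  "\<bar>a - h\<bar> = 1 \<Longrightarrow> a \<noteq> h + outward h \<Longrightarrow> a = h - outward h"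
  "\<bar>h - a\<bar> = 1 \<Longrightarrow> a \<noteq> h + outward h \<Longrightarrow> a = h - outward h"
  by (simp_all add: outward_def abs_if split: if_splits)

lemma r_shift: "qn 2 - r_fun \<eta> (U h + 1) = r_fun \<eta> (- U h - 1)"
proof -
  have "- U h - 1 = - (U h + 1)" by simp
  then show ?thesis using r_add_r_minus[OF qn_U_shifts(2)[of h]] by (metis add_diff_cancel_left')
qed

lemma slope_bulk:
  assumes p: "p \<in> paths N" "removable N p i" and ij: "1 \<le> i" "i < N" "1 \<le> j" "j < N" "j = Suc i \<or> i = Suc j"
    and nth: "p ! (i - 1) = h - outward h" and out: "outward (h - outward h) = outward h"
    and zero: "e j * v (remove_tile p i) = 0"
  shows "e i * (e j * v p - wt j (U h) *s v p) = 0"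
proof -
  have "e i * e j * e i = e i"
    using ij e_up[of i] e_down[of i] by auto
  \<comment> \<open>With u = \<open>U h\<close>, the inner tile has parameter u + 1 and [2] - r(u+1)
    = r(-u-1), so the product is r(u) r(-u-1) = 1.\<close>
  moreover have "wt j (U h) * (qn 2 - wt i (U (h - outward h))) = 1"
    using ij r_mult_r[OF qn_U_shifts(1,2)]
    by (simp add: weight_def U_diff_outward(1)[OF out] r_shift)
  ultimately show ?thesis
    using slope_bulk_step[OF ij(1,2) _ zero] unfolding v_add_tile[OF p] nth by blast
qed

text \<open>Remove a tile j. Away from i its factor commutes with e_i. Next to i, the slope forces a
  corner at i in the smaller path: either its tile can be removed as well and the Yang-Baxter or
  reflection step applies, or the heights around are 0 and -1 and a zigzag relation applies.\<close>

lemma e_v_slope: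
  assumes "p \<in> paths N" "1 \<le> i" "i < N" "p ! (i - 1) \<noteq> p ! (i + 1)"
  shows "e i * v p = 0"
  using assms
proof (induction p arbitrary: i rule: path_induct)
  case fundamental
  then show ?case by (auto simp: fundamental_path_nth)
next
  case (remove p j)
  note p = remove.hyps(1) and rem = remove.hyps(2) and i = remove.prems(1,2)
  let ?p = "remove_tile p j" and ?h = "p ! (j - 1)"
  have j: "1 \<le> j" "j \<le> N" "j < N \<longrightarrow> ?h = p ! (j + 1)" "p ! j = ?h + outward ?h"
    using rem unfolding removable_def by blast+
  have p': "?p \<in> paths N" by (rule remove_tile_in_paths[OF p rem])
  have nth: "?p ! k = (if k = j then ?h - outward ?h else p ! k)" if "k \<le> N" for k
    by (rule remove_tile_nth[OF p rem that])
  have vp: "v p = e j * v ?p - wt j (U ?h) *s v ?p"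
    by (rule v_add_tile[OF p rem])
  have "i \<noteq> j" using j i remove.prems(3) by auto
  then consider "Suc i < j \<or> Suc j < i" | "j = Suc i" "j < N" | "j = N" "i = N - 1" | "i = Suc j"
    using i j by linarith
  then show ?case
  proof cases
    case 1
    have "?p ! (i - 1) \<noteq> ?p ! (i + 1)"
      using remove.prems(3) nth[of "i - 1"] nth[of "i + 1"] 1 i by auto
    then have "e i * v ?p = 0"
      using remove.IH[OF p' area_remove_tile[OF p rem]] i by blast
    then show ?thesis
      using e_e_comm[of i j "v ?p"] 1 i j by (simp add: vp right_diff_distrib)
  next
    case 2
    \<comment> \<open>With h = \<open>?h\<close> and o = \<open>outward ?h\<close>, the smaller path
      has heights h - o, h, h - o, h at i - 1, ..., i + 2. Removing the corner at i creates a slope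
      at j, where the induction hypothesis applies.\<close>
    then have jN: "j = Suc i" "j < N" "j - 1 = i" by simp_all
    have slope: "p ! (i - 1) = ?h - outward ?h"
      by (rule outward_opposite(2))
        (use path_step[OF p, of "i - 1"] i jN remove.prems(3) j(4) in simp_all)
    have vals: "?p ! (i - 1) = ?h - outward ?h" "?p ! i = ?h" "?p ! j = ?h - outward ?h" "?p ! Suc j = ?h"
      using slope nth[of "i - 1"] nth[of i] nth[of j] nth[of "Suc j"] i jN j(3) by auto
    have "e i * (e j * v ?p - wt j (U ?h) *s v ?p) = 0"
    proof (cases "outward (?h - outward ?h) = outward ?h")
      case True
      then have rem': "removable N ?p i"
        using vals i jN by (simp add: removable_def)
      let ?pp = "remove_tile ?p i"
      have "?pp ! (j - 1) \<noteq> ?pp ! (j + 1)"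
        using remove_tile_nth[OF p' rem', of i] remove_tile_nth[OF p' rem', of "Suc j"] vals jN True
        by (simp add: outward_def split: if_splits)
      then have "e j * v ?pp = 0"
        using remove.IH[OF remove_tile_in_paths[OF p' rem']] area_remove_tile[OF p' rem']
          area_remove_tile[OF p rem] j(1) jN by simp
      then show ?thesis
        using slope_bulk[OF p' rem' i j(1) jN(2) _ vals(1) True] jN by simp
    next
      case False
      have "p ! i = ?h" using jN by simp
      have "e i * (e (Suc i) * v ?p) = wt (Suc i) (U (?p ! i)) *s (e i * v ?p)"
      proof (rule zigzag_up[OF p' i(2)])
        fix k assume "i \<le> Suc k" "k \<le> i + 2"
        then consider "k = i - 1" | "k = i" | "k = j" | "k = Suc j" using jN by linarith
        then show "?p ! k \<in> {0, -1}"
          using vals U_diff_outward(2)[OF False] by cases auto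
      qed
      then show ?thesis
        using vals jN by (simp add: right_diff_distrib)
    qed
    then show ?thesis by (simp only: vp)
  next
    case 3
    \<comment> \<open>Here a half-tile at N, a tile at N - 1 and possibly another half-tile at N are
      removed in turn, with parameters u, u + 1, u + 2.\<close>
    have jN: "j - 1 = i" "Suc i = N" "i + 1 = N" "i \<le> N" using 3 N_ge_2 by auto
    have slope: "p ! (i - 1) = ?h - outward ?h"
      by (rule outward_opposite(2))
        (use path_step[OF p, of "i - 1"] i jN 3(1) remove.prems(3) j(4) in simp_all)
    have vals: "?p ! (i - 1) = ?h - outward ?h" "?p ! i = ?h" "?p ! N = ?h - outward ?h"
      using slope nth[of "i - 1"] nth[of i] nth[of N] i jN 3 by auto
    have "e i * (e N * v ?p - wt N (U ?h) *s v ?p) = 0"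
    proof (cases "outward (?h - outward ?h) = outward ?h")
      case True
      then have rem': "removable N ?p i"
        using vals i jN by (simp add: removable_def)
      let ?pp = "remove_tile ?p i" and ?g = "?h - outward ?h - outward ?h"
      have pp: "?pp \<in> paths N" by (rule remove_tile_in_paths[OF p' rem'])
      have vals': "?pp ! (i - 1) = ?h - outward ?h" "?pp ! i = ?g" "?pp ! N = ?h - outward ?h"
        using remove_tile_nth[OF p' rem', of "i - 1"] remove_tile_nth[OF p' rem', of i]
          remove_tile_nth[OF p' rem', of N] vals i jN True by auto
      have U1: "U (?h - outward ?h) = U ?h + 1"
        by (rule U_diff_outward(1)[OF True])
      \<comment> \<open>Both cases give the same constant k(-u-2). If a further half-tile of
        parameter u + 2 is present, e_N turns its factor into k(-u-2), and e_i kills the path below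
        it by induction. Otherwise the centre is crossed, and the reflected parameter is -(u+1) -
        1.\<close>
      have y: "e i * (e N * v ?pp) = wt N (- U ?h - 2) *s (e i * v ?pp)"
      proof (cases "outward ?g = outward ?h")
        case out: True
        have "N - 1 = i" using jN by simp
        then have g: "?pp ! (N - 1) = ?g" using vals' by simp
        have rem'': "removable N ?pp N"
          unfolding removable_def g using vals'(3) out N_ge_2 by simp
        let ?ppp = "remove_tile ?pp N"
        have ppp: "?ppp \<in> paths N" by (rule remove_tile_in_paths[OF pp rem''])
        have i1: "i - 1 \<le> N" "i - 1 \<noteq> N" using jN by simp_all
        have "?ppp ! (i - 1) = ?h - outward ?h"
          by (simp only: remove_tile_nth[OF pp rem'' i1(1)] i1(2) if_False vals'(1))
        moreover have "?ppp ! (i + 1) = ?g - outward ?g"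
          using remove_tile_nth[OF pp rem'' order_refl] by (simp only: g jN if_True simp_thms)
        ultimately have neq: "?ppp ! (i - 1) \<noteq> ?ppp ! (i + 1)"
          unfolding out by simp
        have "area ?ppp < area p"
          using area_remove_tile[OF pp rem''] area_remove_tile[OF p' rem'] area_remove_tile[OF p rem]
          by linarith
        then have zero: "e i * v ?ppp = 0"
          using remove.IH[OF ppp _ i neq] by blast
        have "U ?g = U ?h + 2"
          using U_diff_outward(1)[of "?h - outward ?h"] out True U1 by simp
        then have "- U ?g = - U ?h - 2" by simp
        then have "e N * v ?pp = wt N (- U ?h - 2) *s (e N * v ?ppp)"
          using e_v_add[OF pp rem''] unfolding g by (simp only:)
        moreover have "e i * v ?pp = e i * (e N * v ?ppp)"
          by (simp add: v_add_tile[OF pp rem''] right_diff_distrib zero)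
        ultimately show ?thesis by simp
      next
        case out: False
        have *: "?h - outward ?h \<in> {0, -1}" "?g \<in> {0, -1}" "U ?g = - U ?h - 2"
          using U_diff_outward(2)[of "?h - outward ?h"] out True U1 by simp_all
        have "e i * (e (Suc i) * v ?pp) = wt (Suc i) (U (?pp ! i)) *s (e i * v ?pp)"
        proof (rule zigzag_up[OF pp i(2)])
          fix k assume "k \<le> N" "i \<le> Suc k"
          then consider "k = i - 1" | "k = i" | "k = N" using jN by linarith
          then show "?pp ! k \<in> {0, -1}"
            using vals' * by cases auto
        qed
        then show ?thesis using vals' * jN by simp
      qed
      have "1 - r_fun \<eta> (U ?h + 1) * wt N (- U ?h - 2) - wt N (U ?h) * (qn 2 - r_fun \<eta> (U ?h + 1)) = 0"
        using reflection_identity[OF qn_omega2 qn_U_shifts(1-3)] by (simp add: weight_def r_shift)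
      then have "e i * (e N * (e i * v ?pp - r_fun \<eta> (U ?h + 1) *s v ?pp)
          - wt N (U ?h) *s (e i * v ?pp - r_fun \<eta> (U ?h + 1) *s v ?pp)) = 0"
        using slope_boundary_step[OF y[unfolded 3(2)]] 3(2) by simp
      moreover have "v ?p = e i * v ?pp - r_fun \<eta> (U ?h + 1) *s v ?pp"
        unfolding v_add_tile[OF p' rem'] vals(1) U1 using i by (simp add: weight_def)
      ultimately show ?thesis by simp
    next
      case False
      have "e i * (e (Suc i) * v ?p) = wt (Suc i) (U (?p ! i)) *s (e i * v ?p)"
      proof (rule zigzag_up[OF p' i(2)])
        fix k assume "k \<le> N" "i \<le> Suc k"
        then consider "k = i - 1" | "k = i" | "k = N" using jN by linarith
        then show "?p ! k \<in> {0, -1}"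
          using vals U_diff_outward(2)[OF False] by cases auto
      qed
      then show ?thesis
        using vals jN by (simp add: right_diff_distrib)
    qed
    then show ?thesis using 3 by (simp only: vp)
  next
    case 4
    then have jN: "i = Suc j" "j < N" "i - 1 = j" using i by simp_all
    then have hi: "p ! i = ?h" using j(3) by simp
    have slope: "p ! Suc i = ?h - outward ?h"
      by (rule outward_opposite(1))
        (use path_step[OF p, of i] i jN remove.prems(3) j(4) hi in simp_all)
    have vals: "?p ! (i - 1) = ?h - outward ?h" "?p ! i = ?h" "?p ! Suc i = ?h - outward ?h" "?p ! (j - 1) = ?h"
      using slope nth[of "j - 1"] nth[of i] nth[of j] nth[of "Suc i"] i jN j hi by auto
    have "e i * (e j * v ?p - wt j (U ?h) *s v ?p) = 0"
    proof (cases "outward (?h - outward ?h) = outward ?h")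
      case True
      then have rem': "removable N ?p i"
        using vals i jN by (simp add: removable_def)
      let ?pp = "remove_tile ?p i"
      have j1: "j - 1 \<le> N" "j - 1 \<noteq> i" "j + 1 = i" "i \<le> N" using jN i(2) by simp_all
      have "?pp ! (j - 1) = ?h"
        by (simp only: remove_tile_nth[OF p' rem' j1(1)] j1(2) if_False vals(4))
      moreover have "?pp ! (j + 1) = ?h - outward ?h - outward ?h"
        by (simp only: j1(3) remove_tile_nth[OF p' rem' j1(4)] vals(1) True simp_thms if_True)
      ultimately have "?pp ! (j - 1) \<noteq> ?pp ! (j + 1)" by simp
      then have "e j * v ?pp = 0"
        using remove.IH[OF remove_tile_in_paths[OF p' rem']] area_remove_tile[OF p' rem']
          area_remove_tile[OF p rem] j(1) jN by simp
      then show ?thesis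
        using slope_bulk[OF p' rem' i j(1) jN(2) _ vals(1) True] jN by simp
    next
      case False
      have "e i * (e (i - 1) * v ?p) = wt (i - 1) (U (?p ! (i - 2))) *s (e i * v ?p)"
      proof (rule zigzag_down[OF p' _ i(2)])
        show "2 \<le> i" using jN j(1) by simp
        fix k assume "i \<le> k + 2" "k \<le> Suc i"
        then consider "k = j - 1" | "k = i - 1" | "k = i" | "k = Suc i" using jN by linarith
        then show "?p ! k \<in> {0, -1}"
          using vals U_diff_outward(2)[OF False] by cases auto
      qed
      moreover have "i - 2 = j - 1" using jN by simp
      ultimately show ?thesis
        using vals jN by (simp add: right_diff_distrib)
    qed
    then show ?thesis by (simp only: vp)
  qed
qed

end

section \<open>Jucys--Murphy elements and orthogonality\<close>

context path_module
begin

text \<open>Only a tile at point 1 changes the first step or fails to commute with e_0. Below it the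
  path starts 0, -1, 0, so \<open>zigzag_up\<close> at i = 0 says that e_0 kills the path with the
  tile added.\<close>

lemma e_zero_v: "p \<in> paths N \<Longrightarrow> e 0 * v p = (if p ! 1 < p ! 0 then s1_par \<eta> \<omega>\<^sub>1 else 0) *s v p"
proof (induction p rule: path_induct)
  case fundamental
  then show ?case
    using e_zero_E N_ge_2 by (simp add: v_fundamental fundamental_path_nth)
next
  case (remove p j)
  note p = remove.hyps(1) and rem = remove.hyps(2)
  let ?p = "remove_tile p j"
  have j: "1 \<le> j" "j \<le> N" "j < N \<longrightarrow> p ! (j - 1) = p ! (j + 1)" "p ! j = p ! (j - 1) + outward (p ! (j - 1))"
    using rem unfolding removable_def by blast+
  have p': "?p \<in> paths N" by (rule remove_tile_in_paths[OF p rem])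
  have IH: "e 0 * v ?p = (if ?p ! 1 < ?p ! 0 then s1_par \<eta> \<omega>\<^sub>1 else 0) *s v ?p"
    by (rule remove.IH[OF p' area_remove_tile[OF p rem]])
  note nth = remove_tile_nth[OF p rem]
  show ?case
  proof (cases "j = 1")
    case False
    then have "?p ! 1 = p ! 1" "?p ! 0 = p ! 0"
      using nth[of 1] nth[of 0] j by auto
    then show ?thesis
      using IH e_e_comm[of 0 j "v ?p"] False j
      by (simp add: v_add_tile[OF p rem] right_diff_distrib scale_right_diff_distrib mult.commute)
  next
    case True
    have h: "p ! 0 = 0" "p ! 2 = 0" "p ! 1 = 1"
      using path_nth_0[OF p] j N_ge_2 by (simp_all add: True outward_def numeral_2_eq_2)
    have vals: "?p ! 0 = 0" "?p ! 1 = -1" "?p ! 2 = 0"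
      using nth[of 0] nth[of 1] nth[of 2] h N_ge_2 by (simp_all add: True outward_def)
    have "e 0 * (e (Suc 0) * v ?p) = wt (Suc 0) (U (?p ! 0)) *s (e 0 * v ?p)"
    proof (rule zigzag_up[OF p'])
      show "0 < N" using N_ge_2 by simp
      fix k :: nat assume "k \<le> 0 + 2"
      then consider "k = 0" | "k = 1" | "k = 2" by linarith
      then show "?p ! k \<in> {0, -1}" using vals by cases auto
    qed
    then show ?thesis
      using h vals by (simp add: v_add_tile[OF p rem] True right_diff_distrib)
  qed
qed

text \<open>\<open>JM n\<close> is the Jucys--Murphy element \<open>J\<^bsub>n+1\<^esub>\<close>; it detects the step from \<open>h\<^sub>n\<close> to
  \<open>h\<^bsub>n+1\<^esub>\<close>.\<close>

primrec JM :: "nat \<Rightarrow> 'a"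
  where
    "JM 0 = qpow \<eta> (- \<omega>\<^sub>1) *s 1 + ((qpow \<eta> \<omega>\<^sub>1 - qpow \<eta> (- \<omega>\<^sub>1)) / s1_par \<eta> \<omega>\<^sub>1) *s e 0"
  | "JM (Suc n) = (e (Suc n) - q *s 1) * JM n * (e (Suc n) - q *s 1)"

definition jm_eigenvalue :: "nat \<Rightarrow> int list \<Rightarrow> complex"
  where "jm_eigenvalue n p = q ^ n *
    (if p ! Suc n < p ! n then qpow \<eta> (\<omega>\<^sub>1 - of_int (p ! n)) else qpow \<eta> (- (\<omega>\<^sub>1 - of_int (p ! n))))"

lemma JM_Suc_mult:
  "JM (Suc n) * x = e (Suc n) * (JM n * (e (Suc n) * x - q *s x)) - q *s (JM n * (e (Suc n) * x - q *s x))"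
  by (simp add: algebra_simps)

text \<open>On the span of x and y the factors e - q turn the diagonal action of J_n into its mirror
  image: J_{n+1} exchanges the two eigenvalues. This rests on r(u) - q = q^{-u}/[u], r(-u) - q =
  -q^u/[u] and r(u) r(-u) = 1 - 1/[u]^2.\<close>

lemma block_step:
  fixes u c :: complex
  assumes u: "qn u \<noteq> 0"
    and ex: "e (Suc n) * x = y + r_fun \<eta> u *s x"
    and ey: "e (Suc n) * y = r_fun \<eta> (- u) *s (y + r_fun \<eta> u *s x)"
    and Jx: "JM n * x = (c * qpow \<eta> u) *s x" and Jy: "JM n * y = (c / qpow \<eta> u) *s y"
  shows "JM (Suc n) * x = (c / qpow \<eta> u) *s x" and "JM (Suc n) * y = (c * qpow \<eta> u) *s y"
proof -
  define Q where "Q = qpow \<eta> u"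
  define k where "k = qn u"
  define r where "r = r_fun \<eta> u"
  define r' where "r' = r_fun \<eta> (- u)"
  have [simp]: "Q \<noteq> 0" "k \<noteq> 0" using u by (simp_all add: Q_def k_def)
  have "qn (- u) \<noteq> 0" using u by (simp add: qnum_minus)
  then have rq: "r - q = 1 / (Q * k)" "r' - q = - Q / k"
    using r_minus_q[OF u] r_minus_q[of "- u"]
    by (simp_all add: Q_def k_def r_def r'_def qnum_minus qpow_minus)
  have rr: "r * r' = 1 - 1 / (k * k)"
    using r_mult_r_minus[OF u] by (simp add: r_def r'_def k_def)
  have Tx: "e (Suc n) * x - q *s x = y + (r - q) *s x"
    unfolding ex r_def by (simp add: scale_left_diff_distrib)
  have Ty: "e (Suc n) * y - q *s y = (r' - q) *s y + (r * r') *s x"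
    unfolding ey r_def r'_def by (simp add: scale_left_diff_distrib scale_right_distrib mult.commute)
  \<comment> \<open>The matrix of e - q in terms of y and x, for arbitrary coefficients.\<close>
  have T: "e (Suc n) * (a *s y + b *s x) - q *s (a *s y + b *s x)
      = (a * (r' - q) + b) *s y + (a * (r * r') + b * (r - q)) *s x" for a b
  proof -
    have "e (Suc n) * (a *s y + b *s x) - q *s (a *s y + b *s x)
        = a *s (e (Suc n) * y - q *s y) + b *s (e (Suc n) * x - q *s x)"
      by (simp add: distrib_left scale_right_distrib scale_right_diff_distrib mult.commute)
    then show ?thesis
      unfolding Tx Ty by (simp add: scale_right_distrib scale_left_distrib)
  qed
  have "JM n * (e (Suc n) * x - q *s x) = (c / Q) *s y + ((r - q) * (c * Q)) *s x"
    unfolding Tx by (simp add: distrib_left Jx Jy Q_def[symmetric])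
  then have "JM (Suc n) * x = (c / Q * (r' - q) + (r - q) * (c * Q)) *s y
      + (c / Q * (r * r') + (r - q) * (c * Q) * (r - q)) *s x"
    unfolding JM_Suc_mult by (simp only: T)
  moreover have "c / Q * (r' - q) + (r - q) * (c * Q) = 0"
    "c / Q * (r * r') + (r - q) * (c * Q) * (r - q) = c / Q"
    unfolding rq rr by (simp_all add: field_simps)
  ultimately show "JM (Suc n) * x = (c / qpow \<eta> u) *s x"
    by (simp add: Q_def)
  have "JM n * (e (Suc n) * y - q *s y) = ((r' - q) * (c / Q)) *s y + (r * r' * (c * Q)) *s x"
    unfolding Ty by (simp add: distrib_left Jx Jy Q_def[symmetric])
  then have "JM (Suc n) * y = ((r' - q) * (c / Q) * (r' - q) + r * r' * (c * Q)) *s y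
      + ((r' - q) * (c / Q) * (r * r') + r * r' * (c * Q) * (r - q)) *s x"
    unfolding JM_Suc_mult by (simp only: T)
  moreover have "(r' - q) * (c / Q) * (r * r') + r * r' * (c * Q) * (r - q) = 0"
    "(r' - q) * (c / Q) * (r' - q) + r * r' * (c * Q) = c * Q"
    unfolding rq rr by (simp_all add: field_simps)
  ultimately show "JM (Suc n) * y = (c * qpow \<eta> u) *s y"
    by (simp add: Q_def)
qed

text \<open>Two steps in the same direction raise the exponent by one, and the prefactor gains
  another q. On the other side, e - q acts as -q twice when e kills the vector.\<close>

lemma jm_eigenvalue_slope:
  assumes "p \<in> paths N" "Suc n < N" "p ! n \<noteq> p ! Suc (Suc n)"
  shows "jm_eigenvalue (Suc n) p = q * q * jm_eigenvalue n p"
proof -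
  have "\<bar>p ! Suc n - p ! n\<bar> = 1" "\<bar>p ! Suc (Suc n) - p ! Suc n\<bar> = 1"
    using path_step[OF assms(1), of n] path_step[OF assms(1), of "Suc n"] assms(2) by simp_all
  then consider "p ! Suc n = p ! n - 1" "p ! Suc (Suc n) = p ! n - 2"
    | "p ! Suc n = p ! n + 1" "p ! Suc (Suc n) = p ! n + 2"
    using assms(3) by linarith
  then show ?thesis
  proof cases
    case 1
    have "\<omega>\<^sub>1 - of_int (p ! n - 1) = \<omega>\<^sub>1 - of_int (p ! n) + 1" by simp
    then have "qpow \<eta> (\<omega>\<^sub>1 - of_int (p ! n - 1)) = qpow \<eta> (\<omega>\<^sub>1 - of_int (p ! n)) * q"
      by (simp only: qpow_add)
    with 1 show ?thesis by (simp add: jm_eigenvalue_def)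
  next
    case 2
    have "- (\<omega>\<^sub>1 - of_int (p ! n + 1)) = - (\<omega>\<^sub>1 - of_int (p ! n)) + 1" by simp
    then have "qpow \<eta> (- (\<omega>\<^sub>1 - of_int (p ! n + 1))) = qpow \<eta> (- (\<omega>\<^sub>1 - of_int (p ! n))) * q"
      by (simp only: qpow_add)
    with 2 show ?thesis by (simp add: jm_eigenvalue_def)
  qed
qed

text \<open>These are the data of \<open>block_step\<close> with c = q^n and u =
  \<open>U (p ! n)\<close>: x is the path without the tile, y the path with it.\<close>

lemma jm_eigenvalue_tile:
  assumes p: "p \<in> paths N" and rem: "removable N p (Suc n)" and n: "Suc n < N"
  shows "jm_eigenvalue n (remove_tile p (Suc n)) = q ^ n * qpow \<eta> (U (p ! n))"
    and "jm_eigenvalue n p = q ^ n / qpow \<eta> (U (p ! n))"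
    and "jm_eigenvalue (Suc n) (remove_tile p (Suc n)) = q ^ n / qpow \<eta> (U (p ! n))"
    and "jm_eigenvalue (Suc n) p = q ^ n * qpow \<eta> (U (p ! n))"
proof -
  let ?p = "remove_tile p (Suc n)" and ?h = "p ! n"
  have h: "p ! Suc n = ?h + outward ?h" "p ! Suc (Suc n) = ?h"
    using rem n by (simp_all add: removable_def)
  have h': "?p ! n = ?h" "?p ! Suc n = ?h - outward ?h" "?p ! Suc (Suc n) = ?h"
    using remove_tile_nth[OF p rem, of n] remove_tile_nth[OF p rem, of "Suc n"]
      remove_tile_nth[OF p rem, of "Suc (Suc n)"] n h by simp_all
  have shift: "q * qpow \<eta> (of_int ?h - 1 - \<omega>\<^sub>1) = qpow \<eta> (of_int ?h - \<omega>\<^sub>1)"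
    "q * qpow \<eta> (\<omega>\<^sub>1 - (of_int ?h + 1)) = qpow \<eta> (\<omega>\<^sub>1 - of_int ?h)"
    by (simp_all add: qpow_diff qpow_add)
  have q': "q * q ^ n * y = q ^ n * (q * y)" for y by simp
  note defs = jm_eigenvalue_def h h' outward_def spectral_def
  show "jm_eigenvalue n ?p = q ^ n * qpow \<eta> (U ?h)"
    by (simp add: defs)
  have *: "q ^ n / qpow \<eta> x = q ^ n * qpow \<eta> (- x)" for x
    by (simp add: qpow_minus)
  show "jm_eigenvalue n p = q ^ n / qpow \<eta> (U ?h)"
    unfolding * by (simp add: defs)
  show "jm_eigenvalue (Suc n) ?p = q ^ n / qpow \<eta> (U ?h)"
    unfolding * by (simp add: defs q' shift)
  show "jm_eigenvalue (Suc n) p = q ^ n * qpow \<eta> (U ?h)"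
    by (simp add: defs q' shift)
qed

lemma JM_v: "n < N \<Longrightarrow> p \<in> paths N \<Longrightarrow> JM n * v p = jm_eigenvalue n p *s v p"
proof (induction n arbitrary: p)
  case 0
  have "p ! 0 = 0" by (rule path_nth_0[OF 0(2)])
  then show ?case
    using e_zero_v[OF 0(2)] s_nonzero
    by (simp add: jm_eigenvalue_def distrib_right scale_left_distrib[symmetric])
next
  case (Suc n)
  have n: "n < N" "1 \<le> Suc n" using Suc.prems by simp_all
  note IH = Suc.IH[OF n(1)]
  show ?case
  proof (cases "p ! n = p ! Suc (Suc n)")
    case False
    then have "e (Suc n) * v p = 0"
      using e_v_slope[OF Suc.prems(2) n(2) Suc.prems(1)] by simp
    then have "JM (Suc n) * v p = (q * q * jm_eigenvalue n p) *s v p"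
      unfolding JM_Suc_mult by (simp add: IH[OF Suc.prems(2)])
    then show ?thesis
      using jm_eigenvalue_slope[OF Suc.prems(2,1) False] by simp
  next
    case True
    \<comment> \<open>The block is treated as a whole, since \<open>p\<close> may be either member
      of its pair.\<close>
    have both: "JM (Suc n) * v p' = jm_eigenvalue (Suc n) p' *s v p' \<and>
        JM (Suc n) * v (remove_tile p' (Suc n)) =
          jm_eigenvalue (Suc n) (remove_tile p' (Suc n)) *s v (remove_tile p' (Suc n))"
      if p': "p' \<in> paths N" and rem: "removable N p' (Suc n)" for p'
    proof -
      let ?x = "v (remove_tile p' (Suc n))" and ?u = "U (p' ! n)"
      have ex: "e (Suc n) * ?x = v p' + r_fun \<eta> ?u *s ?x"
        using e_v_remove[OF p' rem] Suc.prems(1) by (simp add: weight_def)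
      have ey: "e (Suc n) * v p' = r_fun \<eta> (- ?u) *s (v p' + r_fun \<eta> ?u *s ?x)"
        using e_v_add[OF p' rem] Suc.prems(1) unfolding ex by (simp add: weight_def)
      note ev = jm_eigenvalue_tile[OF p' rem Suc.prems(1)]
      have "JM n * ?x = (q ^ n * qpow \<eta> ?u) *s ?x"
        using IH[OF remove_tile_in_paths[OF p' rem]] by (simp add: ev)
      moreover have "JM n * v p' = (q ^ n / qpow \<eta> ?u) *s v p'"
        using IH[OF p'] by (simp add: ev)
      ultimately show ?thesis
        using block_step[OF qn_U_shifts(1) ex ey] unfolding ev by blast
    qed
    show ?thesis
    proof (rule extremum_cases[OF Suc.prems(2) n(2)])
      show "Suc n \<le> N" using Suc.prems(1) by simp
      show "p ! (Suc n - 1) = p ! (Suc n + 1)" using True by simp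
    next
      assume "removable N p (Suc n)"
      then show ?thesis using both[OF Suc.prems(2)] by blast
    next
      fix p' assume "p' \<in> paths N" "removable N p' (Suc n)" "remove_tile p' (Suc n) = p"
      then show ?thesis using both by blast
    qed
  qed
qed

lemma tr_minus: "tr (x - y) = tr x - tr y"
  using tr_add[of "x - y" y] by (simp add: algebra_simps)

lemma tr_JM: "n < N \<Longrightarrow> tr (JM n) = JM n"
  by (induction n) (simp_all add: tr_add tr_minus tr_scale tr_1 tr_e tr_mult mult.assoc)

lemma tr_E: "n \<le> N \<Longrightarrow> tr (E n) = E n"
  by (induction n) (simp_all add: E.simps tr_scale tr_mult tr_e tr_1 mult.assoc)

text \<open>Equality would force q^x = q^{-x}, that is [x] = 0.\<close>

lemma jm_eigenvalue_neq:
  assumes "p \<in> paths N" "p' \<in> paths N" "n < N" "p ! n = p' ! n" "p ! Suc n \<noteq> p' ! Suc n"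
  shows "jm_eigenvalue n p \<noteq> jm_eigenvalue n p'"
proof -
  let ?x = "\<omega>\<^sub>1 - of_int (p ! n)"
  have "qpow \<eta> ?x \<noteq> qpow \<eta> (- ?x)"
    using generic[of "p ! n"] by (auto simp: qnum_def)
  moreover have "p ! Suc n < p ! n \<longleftrightarrow> \<not> p' ! Suc n < p' ! n"
    using path_step[OF assms(1,3)] path_step[OF assms(2,3)] assms(4,5) by linarith
  ultimately show ?thesis
    using assms(4) by (auto simp: jm_eigenvalue_def)
qed

theorem v_orthogonal:
  assumes p: "p \<in> paths N" "p' \<in> paths N" "p \<noteq> p'"
  shows "tr (v p) * v p' = 0"
proof -
  have "\<exists>m\<le>N. p ! m \<noteq> p' ! m"
    using p path_length by (metis less_Suc_eq_le nth_equalityI)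
  then obtain m where m: "m \<le> N \<and> p ! m \<noteq> p' ! m" "\<And>k. k < m \<Longrightarrow> \<not> (k \<le> N \<and> p ! k \<noteq> p' ! k)"
    using exists_least_iff[of "\<lambda>m. m \<le> N \<and> p ! m \<noteq> p' ! m"] by blast
  then obtain n where n: "m = Suc n"
    using path_nth_0[OF p(1)] path_nth_0[OF p(2)] by (cases m) auto
  then have "n < N" "p ! n = p' ! n" "p ! Suc n \<noteq> p' ! Suc n"
    using m(1) m(2)[of n] by auto
  then have neq: "jm_eigenvalue n p \<noteq> jm_eigenvalue n p'"
    using jm_eigenvalue_neq p by blast
  have "tr (v p) * JM n = jm_eigenvalue n p *s tr (v p)"
    using arg_cong[OF JM_v[OF \<open>n < N\<close> p(1)], of tr] by (simp add: tr_mult tr_scale tr_JM \<open>n < N\<close>)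
  then have "jm_eigenvalue n p *s (tr (v p) * v p') = tr (v p) * (JM n * v p')"
    by (metis mult.assoc scale_mult_left)
  also have "\<dots> = jm_eigenvalue n p' *s (tr (v p) * v p')"
    by (simp add: JM_v[OF \<open>n < N\<close> p(2)])
  finally show ?thesis
    using neq by (simp add: scale_cancel_right)
qed

end

section \<open>The spin chain representation\<close>

text \<open>Configurations live on all natural numbers, which avoids bounds on positions; the
  generators act on the sites 1, ..., N.\<close>

type_synonym spin_space = "(nat \<Rightarrow> bool) \<Rightarrow> complex"

definition smul :: "complex \<Rightarrow> spin_space \<Rightarrow> spin_space"
  where "smul c f = (\<lambda>\<sigma>. c * f \<sigma>)"

definition site :: "nat \<Rightarrow> (bool \<Rightarrow> bool \<Rightarrow> complex) \<Rightarrow> spin_space \<Rightarrow> spin_space"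
  where "site k M f = (\<lambda>\<sigma>. M (\<sigma> k) True * f (\<sigma>(k := True)) + M (\<sigma> k) False * f (\<sigma>(k := False)))"

text \<open>Every second spin is flipped compared with the usual XXZ convention, so that a cup joins
  equal instead of opposite spins.\<close>

definition cup_weight :: "complex \<Rightarrow> nat \<Rightarrow> bool \<Rightarrow> complex"
  where "cup_weight q i x = (if x = even i then q else 1 / q)"

text \<open>A rank one operator on the sites i and i + 1: the covector sums over both equal-spin
  states, the vector carries the weights q and 1/q. A closed loop therefore has value q +
  1/q.\<close>

definition cup :: "complex \<Rightarrow> nat \<Rightarrow> spin_space \<Rightarrow> spin_space"
  where "cup q i f = (\<lambda>\<sigma>. if \<sigma> i = \<sigma> (Suc i)
    then cup_weight q i (\<sigma> i) * (f (\<sigma>(i := True, Suc i := True)) + f (\<sigma>(i := False, Suc i := False)))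
    else 0)"

definition spaced :: "nat \<Rightarrow> nat \<Rightarrow> nat list"
  where "spaced k n = map (\<lambda>j. k + 2 * j) [0..<n]"

abbreviation cups :: "complex \<Rightarrow> nat list \<Rightarrow> spin_space \<Rightarrow> spin_space"
  where "cups q l \<equiv> foldr (cup q) l"

abbreviation bsum :: "(bool \<Rightarrow> complex) \<Rightarrow> complex"
  where "bsum g \<equiv> g True + g False"

text \<open>Conjugation of M by the n-th power of the diagonal matrix of cup weights.\<close>

definition twist :: "complex \<Rightarrow> nat \<Rightarrow> nat \<Rightarrow> (bool \<Rightarrow> bool \<Rightarrow> complex) \<Rightarrow> bool \<Rightarrow> bool \<Rightarrow> complex"
  where "twist q k n M = (\<lambda>x y. M x y * (cup_weight q k y / cup_weight q k x) ^ n)"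

lemma cup_weight_simps: "q \<noteq> 0 \<Longrightarrow> cup_weight q (Suc i) x = 1 / cup_weight q i x"
  "cup_weight q (Suc (Suc i)) x = cup_weight q i x"
  by (auto simp: cup_weight_def)

lemma cup_weight_nonzero: "q \<noteq> 0 \<Longrightarrow> cup_weight q i x \<noteq> 0"
  by (simp add: cup_weight_def)

lemma smul_linear: "cup q i (smul c f) = smul c (cup q i f)" "site k M (smul c f) = smul c (site k M f)"
  by (auto simp: cup_def site_def smul_def fun_eq_iff algebra_simps)

lemma spin_additive:
  "cup q i (\<lambda>\<sigma>. f \<sigma> + g \<sigma>) = (\<lambda>\<sigma>. cup q i f \<sigma> + cup q i g \<sigma>)"
  "site k M (\<lambda>\<sigma>. f \<sigma> + g \<sigma>) = (\<lambda>\<sigma>. site k M f \<sigma> + site k M g \<sigma>)"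
  by (auto simp: cup_def site_def fun_eq_iff algebra_simps)

lemma cup_cup: "q \<noteq> 0 \<Longrightarrow> cup q i (cup q i f) = smul (q + 1 / q) (cup q i f)"
  by (auto simp: cup_def smul_def cup_weight_def fun_eq_iff algebra_simps add_divide_distrib)

text \<open>A straightened strand has factor 1, because adjacent cups give reciprocal weights to the
  same spin.\<close>

lemma cup_Suc_cup:
  assumes "q \<noteq> 0"
  shows "cup q i (cup q (Suc i) (cup q i f)) = cup q i f"
proof
  fix \<sigma> :: "nat \<Rightarrow> bool"
  \<comment> \<open>Writing a value that is already present changes nothing; this identifies the
    updated configurations on the two sides.\<close>
  have "\<sigma>(i := y, Suc i := y, Suc (Suc i) := z) = \<sigma>(i := y, Suc i := y)" if "\<sigma> (Suc (Suc i)) = z" for y z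
    using that by (auto simp: fun_eq_iff)
  then show "cup q i (cup q (Suc i) (cup q i f)) \<sigma> = cup q i f \<sigma>"
    using assms by (auto simp: cup_def cup_weight_def algebra_simps add_divide_distrib fun_upd_twist)
qed

lemma cup_cup_Suc:
  assumes "q \<noteq> 0"
  shows "cup q (Suc i) (cup q i (cup q (Suc i) f)) = cup q (Suc i) f"
proof
  fix \<sigma> :: "nat \<Rightarrow> bool"
  have "\<sigma>(i := z, Suc i := y, Suc (Suc i) := y) = \<sigma>(Suc i := y, Suc (Suc i) := y)" if "\<sigma> i = z" for y z
    using that by (auto simp: fun_eq_iff)
  then show "cup q (Suc i) (cup q i (cup q (Suc i) f)) \<sigma> = cup q (Suc i) f \<sigma>"
    using assms by (auto simp: cup_def cup_weight_def algebra_simps add_divide_distrib fun_upd_twist)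
qed

text \<open>A loop carrying M gives the trace of M weighted by the cup; either leg will do because a
  cup joins equal spins.\<close>

lemma cup_site_cup:
  "cup q i (site i M (cup q i f)) = smul (bsum (\<lambda>x. M x x * cup_weight q i x)) (cup q i f)"
  "cup q i (site (Suc i) M (cup q i f)) = smul (bsum (\<lambda>x. M x x * cup_weight q i x)) (cup q i f)"
  by (auto simp: cup_def site_def smul_def fun_eq_iff algebra_simps fun_upd_twist)

lemma site_site:
  "site k (\<lambda>x y. m x * n y) (site k (\<lambda>x y. m x * n y) f)
    = smul (bsum (\<lambda>x. m x * n x)) (site k (\<lambda>x y. m x * n y) f)"
  by (auto simp: site_def smul_def fun_eq_iff algebra_simps)

lemma cup_cup_commute: "Suc i < j \<Longrightarrow> cup q i (cup q j f) = cup q j (cup q i f)"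
  by (auto simp: cup_def fun_eq_iff algebra_simps fun_upd_twist)

lemma cup_site_commute:
  "k \<noteq> i \<Longrightarrow> k \<noteq> Suc i \<Longrightarrow> cup q i (site k M f) = site k M (cup q i f)"
  by (auto simp: cup_def site_def fun_eq_iff algebra_simps fun_upd_twist)

lemma site_site_commute: "k \<noteq> l \<Longrightarrow> site k M (site l P f) = site l P (site k M f)"
  by (auto simp: site_def fun_eq_iff algebra_simps fun_upd_twist)

text \<open>A matrix on site \<open>k\<close> slides along the zigzag of three cups to site \<open>k + 2\<close>.\<close>

lemma zipper_step:
  assumes "q \<noteq> 0"
  shows "cup q k (site k M (cup q (Suc k) (cup q k f))) = cup q k (site (k + 2) (twist q k 1 M) f)"
  using assms cup_weight_nonzero[OF assms]
  by (auto simp: cup_def site_def twist_def cup_weight_simps fun_eq_iff algebra_simps fun_upd_twist)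

text \<open>The outer boundary matrix has a constant covector, so the cup passes the inner one on to
  site k + 1 with its weight.\<close>

lemma site_cup_site:
  "site k (\<lambda>x y. m x) (cup q k (site k (\<lambda>x y. m x) f))
    = site k (\<lambda>x y. m x) (site (Suc k) (\<lambda>x y. cup_weight q k x * m y) f)"
  by (auto simp: cup_def site_def fun_eq_iff algebra_simps fun_upd_twist)

lemma cup_site_site_cup:
  "cup q k (site k M (site (Suc k) P (cup q k f)))
    = smul (bsum (\<lambda>x. bsum (\<lambda>y. M x y * P x y * cup_weight q k y))) (cup q k f)"
  by (auto simp: cup_def site_def smul_def fun_eq_iff algebra_simps fun_upd_twist)

lemma site_site_site:
  "site k (\<lambda>x y. m x * n y) (site k M (site k (\<lambda>x y. m x * n y) f))
    = smul (bsum (\<lambda>x. bsum (\<lambda>y. n x * M x y * m y))) (site k (\<lambda>x y. m x * n y) f)"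
  by (auto simp: site_def smul_def fun_eq_iff algebra_simps)

section \<open>Chains of cups\<close>

lemma spaced_simps: "spaced k 0 = []" "spaced k (Suc n) = k # spaced (k + 2) n"
  by (simp_all add: spaced_def upt_conv_Cons map_Suc_upt[symmetric] comp_def del: upt_Suc)

lemma spaced_snoc: "spaced k (Suc n) = spaced k n @ [k + 2 * n]"
  by (simp add: spaced_def)

lemma cups_cup_commute:
  "k + 2 * n \<le> j \<Longrightarrow> cups q (spaced k n) (cup q j f) = cup q j (cups q (spaced k n) f)"
  by (induction n arbitrary: k) (auto simp: spaced_simps intro!: cup_cup_commute)

lemma cups_cup_commute': "Suc j < k \<Longrightarrow> cups q (spaced k n) (cup q j f) = cup q j (cups q (spaced k n) f)"
  by (induction n arbitrary: k) (simp_all add: spaced_simps cup_cup_commute)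

lemma cups_site_commute:
  "j < k \<or> k + 2 * n \<le> j \<Longrightarrow> cups q (spaced k n) (site j M f) = site j M (cups q (spaced k n) f)"
  by (induction n arbitrary: k) (auto simp: spaced_simps cup_site_commute)

lemma smul_cups: "cups q l (smul c f) = smul c (cups q l f)"
  by (induction l) (simp_all add: smul_linear)

lemma twist_twist: "twist q (k + 2) n (twist q k 1 M) = twist q k (Suc n) M"
  by (simp add: twist_def cup_weight_simps mult_ac)

lemma zipper:
  assumes q: "q \<noteq> 0"
  shows "cups q (spaced k n) (site k M (cups q (spaced (Suc k) n) (cups q (spaced k n) f)))
    = cups q (spaced k n) (site (k + 2 * n) (twist q k n M) f)"
proof (induction n arbitrary: k M)
  case 0
  then show ?case by (simp add: spaced_simps twist_def)
next
  case (Suc n)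
  let ?A = "cups q (spaced (k + 2) n)" and ?B = "cups q (spaced (Suc (k + 2)) n)"
  have AB: "?A (cup q k g) = cup q k (?A g)" "?B (cup q k g) = cup q k (?B g)"
    "?A (site k M g) = site k M (?A g)" for g
    by (simp_all add: cups_cup_commute' cups_site_commute)
  have "cup q k (?A (site k M (cup q (Suc k) (?B (cup q k (?A f))))))
      = ?A (cup q k (site k M (cup q (Suc k) (cup q k (?B (?A f))))))"
    by (simp only: AB)
  also have "\<dots> = cup q k (?A (site (k + 2) (twist q k 1 M) (?B (?A f))))"
    by (simp only: zipper_step[OF q] AB)
  also have "\<dots> = cup q k (?A (site (k + 2 + 2 * n) (twist q k (Suc n) M) f))"
    using Suc.IH[of "k + 2" "twist q k 1 M"] by (simp only: twist_twist)
  finally show ?case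
    by (simp add: spaced_simps)
qed

text \<open>One more cup closes the chain: M slides to its far end and forms, with P on the other
  leg, a loop that contributes only a scalar.\<close>

lemma zipper_closed:
  assumes q: "q \<noteq> 0"
  shows "cups q (spaced k (Suc n)) (site k M (cups q (spaced (Suc k) n)
      (site (k + 2 * n + 1) P (cups q (spaced k (Suc n)) f))))
    = smul (bsum (\<lambda>x. bsum (\<lambda>y. twist q k n M x y * P x y * cup_weight q k y)))
        (cups q (spaced k (Suc n)) f)"
proof -
  let ?C = "cups q (spaced k n)" and ?j = "k + 2 * n"
  have w: "cup_weight q ?j y = cup_weight q k y" for y
    by (simp add: cup_weight_def)
  have C: "?C (cup q ?j g) = cup q ?j (?C g)" "?C (site (Suc ?j) P g) = site (Suc ?j) P (?C g)" for g
    by (simp_all add: cups_cup_commute cups_site_commute)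
  have zip: "?C (site k M (cups q (spaced (Suc k) n) (?C g))) = ?C (site ?j (twist q k n M) g)" for g
    by (rule zipper[OF q])
  have "cups q (spaced k (Suc n)) (site k M (cups q (spaced (Suc k) n)
      (site (Suc ?j) P (cups q (spaced k (Suc n)) f))))
    = cup q ?j (?C (site k M (cups q (spaced (Suc k) n) (?C (site (Suc ?j) P (cup q ?j f))))))"
    by (simp add: spaced_snoc C)
  also have "\<dots> = ?C (cup q ?j (site ?j (twist q k n M) (site (Suc ?j) P (cup q ?j f))))"
    unfolding zip C(1) by (rule refl)
  also have "\<dots> = smul (bsum (\<lambda>x. bsum (\<lambda>y. twist q k n M x y * P x y * cup_weight q k y)))
      (?C (cup q ?j f))"
    unfolding cup_site_site_cup w smul_cups by (rule refl)
  finally show ?thesis by (simp add: spaced_snoc)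
qed

text \<open>The boundary matrices have rank one, so \<open>I\<^sub>1\<close> and \<open>I\<^sub>2\<close> act with rank one on the first \<open>N\<close>
  sites; the double quotient relations then hold for some \<open>b\<close>, which the parameter \<open>t\<close> adjusts.\<close>

locale spin_chain =
  fixes N :: nat and q :: complex and m \<mu> \<nu> :: "bool \<Rightarrow> complex" and s1 s2 b :: complex
  assumes N_ge_2: "N \<ge> 2" and q_nonzero: "q \<noteq> 0"
    and left_trace: "bsum m = s1" and left_cup: "bsum (\<lambda>x. m x * cup_weight q 1 x) = 1"
    and right_trace: "bsum (\<lambda>x. \<mu> x * \<nu> x) = s2"
    and right_cup: "bsum (\<lambda>x. \<mu> x * \<nu> x * cup_weight q (N - 1) x) = 1"
    and b_even: "N = 2 * n + 2 \<Longrightarrow>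
      bsum (\<lambda>x. m x * \<mu> x / cup_weight q 1 x ^ n) * bsum (\<lambda>y. \<nu> y * cup_weight q 1 y ^ Suc n) = b"
    and b_odd: "N = 2 * n + 3 \<Longrightarrow>
      bsum (\<lambda>x. m x * \<nu> x / cup_weight q 1 x ^ Suc n) * bsum (\<lambda>y. \<mu> y * cup_weight q 1 y ^ Suc n) = b"
    and m_nonzero: "m True \<noteq> 0"
begin

abbreviation left :: "bool \<Rightarrow> bool \<Rightarrow> complex" where "left \<equiv> \<lambda>x y. m x"
abbreviation right :: "bool \<Rightarrow> bool \<Rightarrow> complex" where "right \<equiv> \<lambda>x y. \<mu> x * \<nu> y"

definition gen :: "nat \<Rightarrow> spin_space \<Rightarrow> spin_space"
  where "gen i = (if i = 0 then site 1 left else if i < N then cup q i else site N right)"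

abbreviation act :: "nat list \<Rightarrow> spin_space \<Rightarrow> spin_space" where "act l \<equiv> foldr gen l"

lemma gen_simps:
  "gen 0 = site 1 left" "1 \<le> i \<Longrightarrow> i < N \<Longrightarrow> gen i = cup q i" "gen N = site N right"
  using N_ge_2 by (auto simp: gen_def fun_eq_iff)

lemma left_left: "site k left (site k left f) = smul s1 (site k left f)"
  using site_site[of k m "\<lambda>_. 1" f] left_trace by simp

lemma gen_relations:
  "1 \<le> i \<Longrightarrow> i < N \<Longrightarrow> gen i (gen i f) = smul (q + 1 / q) (gen i f)"
  "gen 0 (gen 0 f) = smul s1 (gen 0 f)"
  "gen N (gen N f) = smul s2 (gen N f)"
  "1 \<le> i \<Longrightarrow> i < N \<Longrightarrow> gen i (gen (Suc i) (gen i f)) = gen i f"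
  "1 \<le> i \<Longrightarrow> i < N \<Longrightarrow> gen i (gen (i - 1) (gen i f)) = gen i f"
  "i \<le> N \<Longrightarrow> j \<le> N \<Longrightarrow> Suc i < j \<Longrightarrow> gen i (gen j f) = gen j (gen i f)"
proof -
  show "1 \<le> i \<Longrightarrow> i < N \<Longrightarrow> gen i (gen i f) = smul (q + 1 / q) (gen i f)"
    by (simp add: gen_def cup_cup q_nonzero)
  show "gen 0 (gen 0 f) = smul s1 (gen 0 f)"
    by (simp add: gen_def left_left)
  show "gen N (gen N f) = smul s2 (gen N f)"
    using N_ge_2 right_trace by (simp add: gen_def site_site)
  have one: "smul 1 g = g" for g by (simp add: smul_def)
  show "gen i (gen (Suc i) (gen i f)) = gen i f" if i: "1 \<le> i" "i < N"
  proof (cases "Suc i < N")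
    case True
    then show ?thesis using i by (simp add: gen_def cup_Suc_cup q_nonzero)
  next
    case False
    then have "N = Suc i" using i by simp
    moreover have "gen i = cup q i" by (rule gen_simps(2)[OF i])
    moreover have "gen (Suc i) = site (Suc i) right" using gen_simps(3) \<open>N = Suc i\<close> by metis
    moreover have "N - 1 = i" using \<open>N = Suc i\<close> by simp
    ultimately show ?thesis using right_cup by (simp only: cup_site_cup one)
  qed
  show "gen i (gen (i - 1) (gen i f)) = gen i f" if i: "1 \<le> i" "i < N"
  proof (cases i)
    case (Suc j)
    show ?thesis
    proof (cases "j = 0")
      case True
      then show ?thesis using Suc i left_cup by (simp add: gen_def cup_site_cup one)
    next
      case False
      then show ?thesis using Suc i by (simp add: gen_def cup_cup_Suc q_nonzero)
    qed
  qed (use i in simp)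
  show "gen i (gen j f) = gen j (gen i f)" if "i \<le> N" "j \<le> N" "Suc i < j"
    using that
    by (auto simp: gen_def cup_site_commute site_site_commute intro!: cup_cup_commute)
qed

lemma act_spaced: "1 \<le> k \<Longrightarrow> k + 2 * n \<le> N + 1 \<Longrightarrow> act (spaced k n) f = cups q (spaced k n) f"
  by (induction n arbitrary: k) (simp_all add: spaced_simps gen_def)

lemma parity_words:
  "filter odd [0..<2 * n + 1] = spaced 1 n" "filter even [0..<2 * n + 1] = spaced 0 (Suc n)"
  by (induction n) (simp_all add: spaced_simps spaced_snoc[of _ "Suc _"] spaced_snoc[of 1] spaced_def)

text \<open>In I_1 I_2 I_1 the left matrix slides to the far end and meets the right matrix in a
  closed loop. In I_2 I_1 I_2 the two left matrices produce \<open>?M\<close> on site 2, which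
  slides to site N and is caught between two rank one right matrices.\<close>

lemma even_case:
  assumes N: "N = 2 * n + 2"
  shows "act (spaced 1 (Suc n)) (act (spaced 0 (n + 2)) (act (spaced 1 (Suc n)) f)) = smul b (act (spaced 1 (Suc n)) f)"
    and "act (spaced 0 (n + 2)) (act (spaced 1 (Suc n)) (act (spaced 0 (n + 2)) f)) = smul b (act (spaced 0 (n + 2)) f)"
proof -
  have act1: "act (spaced 1 (Suc n)) g = cups q (spaced 1 (Suc n)) g" for g
    using N by (intro act_spaced) simp_all
  have act0: "act (spaced 0 (n + 2)) g = site 1 left (cups q (spaced 2 n) (site N right g))" for g
  proof -
    have "spaced 0 (n + 2) = 0 # spaced 2 n @ [N]"
      using N spaced_snoc[of 0 "Suc n"] spaced_simps(2)[of 0 n] by (simp add: numeral_2_eq_2)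
    moreover have "act (spaced 2 n) h = cups q (spaced 2 n) h" for h
      using N by (intro act_spaced) simp_all
    ultimately show ?thesis
      by (simp only: foldr.simps foldr_append comp_apply id_apply gen_simps)
  qed
  show "act (spaced 1 (Suc n)) (act (spaced 0 (n + 2)) (act (spaced 1 (Suc n)) f)) = smul b (act (spaced 1 (Suc n)) f)"
  proof -
    have "1 + 2 * n + 1 = N" "Suc 1 = 2" using N by simp_all
    then have "cups q (spaced 1 (Suc n)) (site 1 left (cups q (spaced 2 n) (site N right (cups q (spaced 1 (Suc n)) f))))
      = smul (bsum (\<lambda>x. bsum (\<lambda>y. twist q 1 n left x y * right x y * cup_weight q 1 y))) (cups q (spaced 1 (Suc n)) f)"
      using zipper_closed[OF q_nonzero, of 1 n left right f] by (simp only:)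
    also have "bsum (\<lambda>x. bsum (\<lambda>y. twist q 1 n left x y * right x y * cup_weight q 1 y)) = b"
      unfolding b_even[OF N, symmetric] twist_def
      using cup_weight_nonzero[OF q_nonzero, of 1] by (simp add: field_simps)
    finally show ?thesis
      unfolding act1 act0 .
  qed
  let ?L2 = "cups q (spaced 2 n)" and ?L3 = "cups q (spaced 3 n)"
  have comm: "site 1 left (?L2 g) = ?L2 (site 1 left g)" "site 1 left (?L3 g) = ?L3 (site 1 left g)"
    "site 1 left (site N right g) = site N right (site 1 left g)"
    "?L2 (site N right g) = site N right (?L2 g)" for g
    using N by (simp_all add: cups_site_commute site_site_commute)
  let ?M = "\<lambda>x y. cup_weight q 1 x * m y"
  have cups1: "cups q (spaced 1 (Suc n)) g = cup q 1 (?L3 g)" for g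
    by (simp add: spaced_simps numeral_3_eq_3)
  have start: "site 1 left (cup q 1 (site 1 left g)) = site 1 left (site 2 ?M g)" for g
    using site_cup_site[of 1 m q g] by (simp add: numeral_2_eq_2)
  have zip: "?L2 (site 2 ?M (?L3 (?L2 g))) = ?L2 (site N (twist q 2 n ?M) g)" for g
    using zipper[OF q_nonzero, of 2 n ?M g] N by (simp add: numeral_3_eq_3 numeral_2_eq_2)
  have "site 1 left (?L2 (site N right (cups q (spaced 1 (Suc n)) (site 1 left (?L2 (site N right f))))))
      = ?L2 (site N right (site 1 left (cup q 1 (site 1 left (?L3 (?L2 (site N right f)))))))"
    unfolding cups1 by (simp only: comm)
  also have "\<dots> = ?L2 (site N right (site 1 left (site 2 ?M (?L3 (?L2 (site N right f))))))"
    unfolding start by (rule refl)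
  also have "\<dots> = site 1 left (site N right (?L2 (site 2 ?M (?L3 (?L2 (site N right f))))))"
    by (simp only: comm)
  also have "\<dots> = site 1 left (site N right (?L2 (site N (twist q 2 n ?M) (site N right f))))"
    unfolding zip by (rule refl)
  also have "\<dots> = site 1 left (?L2 (site N right (site N (twist q 2 n ?M) (site N right f))))"
    by (simp only: comm)
  also have "\<dots> = smul (bsum (\<lambda>x. bsum (\<lambda>y. \<nu> x * twist q 2 n ?M x y * \<mu> y))) (site 1 left (?L2 (site N right f)))"
    unfolding site_site_site smul_cups smul_linear by (rule refl)
  also have "bsum (\<lambda>x. bsum (\<lambda>y. \<nu> x * twist q 2 n ?M x y * \<mu> y)) = b"
    unfolding b_even[OF N, symmetric] twist_def numeral_2_eq_2 cup_weight_simps(1)[OF q_nonzero] One_nat_def[symmetric]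
    using cup_weight_nonzero[OF q_nonzero, of 1] by (simp add: field_simps)
  finally show "act (spaced 0 (n + 2)) (act (spaced 1 (Suc n)) (act (spaced 0 (n + 2)) f)) = smul b (act (spaced 0 (n + 2)) f)"
    unfolding act1 act0 .
qed

text \<open>For odd N the right boundary matrix belongs to I_1, so the two mechanisms change places:
  I_1 I_2 I_1 ends in a sandwich of right matrices, I_2 I_1 I_2 in a closed loop.\<close>

lemma odd_case:
  assumes N: "N = 2 * n + 3"
  shows "act (spaced 1 (n + 2)) (act (spaced 0 (n + 2)) (act (spaced 1 (n + 2)) f)) = smul b (act (spaced 1 (n + 2)) f)"
    and "act (spaced 0 (n + 2)) (act (spaced 1 (n + 2)) (act (spaced 0 (n + 2)) f)) = smul b (act (spaced 0 (n + 2)) f)"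
proof -
  let ?L1 = "cups q (spaced 1 (Suc n))" and ?L2 = "cups q (spaced 2 (Suc n))" and ?L3 = "cups q (spaced 3 n)"
  have act1: "act (spaced 1 (n + 2)) g = ?L1 (site N right g)" for g
  proof -
    have "spaced 1 (n + 2) = spaced 1 (Suc n) @ [N]"
      using N spaced_snoc[of 1 "Suc n"] by simp
    moreover have "act (spaced 1 (Suc n)) h = ?L1 h" for h
      using N by (intro act_spaced) simp_all
    ultimately show ?thesis
      by (simp only: foldr.simps foldr_append comp_apply id_apply gen_simps)
  qed
  have act0: "act (spaced 0 (n + 2)) g = site 1 left (?L2 g)" for g
  proof -
    have "spaced 0 (n + 2) = 0 # spaced 2 (Suc n)"
      using spaced_simps(2)[of 0 "Suc n"] by (simp add: numeral_2_eq_2)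
    moreover have "act (spaced 2 (Suc n)) h = ?L2 h" for h
      using N by (intro act_spaced) simp_all
    ultimately show ?thesis
      by (simp only: foldr.simps comp_apply gen_simps)
  qed
  have comm: "?L1 (site N right g) = site N right (?L1 g)" for g
    using N by (simp add: cups_site_commute)
  have zip: "?L1 (site 1 left (?L2 (?L1 g))) = ?L1 (site N (twist q 1 (Suc n) left) g)" for g
    using zipper[OF q_nonzero, of 1 "Suc n" left g] N by (simp add: numeral_3_eq_3 numeral_2_eq_2)
  have "?L1 (site N right (site 1 left (?L2 (?L1 (site N right f)))))
      = site N right (?L1 (site 1 left (?L2 (?L1 (site N right f)))))"
    by (rule comm)
  also have "\<dots> = site N right (?L1 (site N (twist q 1 (Suc n) left) (site N right f)))"
    unfolding zip by (rule refl)
  also have "\<dots> = ?L1 (site N right (site N (twist q 1 (Suc n) left) (site N right f)))"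
    by (rule comm[symmetric])
  also have "\<dots> = smul (bsum (\<lambda>x. bsum (\<lambda>y. \<nu> x * twist q 1 (Suc n) left x y * \<mu> y))) (?L1 (site N right f))"
    unfolding site_site_site smul_cups by (rule refl)
  also have "bsum (\<lambda>x. bsum (\<lambda>y. \<nu> x * twist q 1 (Suc n) left x y * \<mu> y)) = b"
    unfolding b_odd[OF N, symmetric] twist_def
    using cup_weight_nonzero[OF q_nonzero, of 1] by (simp add: field_simps)
  finally show "act (spaced 1 (n + 2)) (act (spaced 0 (n + 2)) (act (spaced 1 (n + 2)) f)) = smul b (act (spaced 1 (n + 2)) f)"
    unfolding act1 act0 .
  let ?M = "\<lambda>x y. cup_weight q 1 x * m y"
  have cups1: "?L1 g = cup q 1 (?L3 g)" for g
    by (simp add: spaced_simps numeral_3_eq_3)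
  have start: "site 1 left (cup q 1 (site 1 left g)) = site 1 left (site 2 ?M g)" for g
    using site_cup_site[of 1 m q g] by (simp add: numeral_2_eq_2)
  have comm': "site 1 left (?L2 g) = ?L2 (site 1 left g)" "site 1 left (?L3 g) = ?L3 (site 1 left g)"
    "site 1 left (site N right g) = site N right (site 1 left g)" for g
    using N by (simp_all add: cups_site_commute site_site_commute)
  have closed: "?L2 (site 2 ?M (?L3 (site N right (?L2 f))))
      = smul (bsum (\<lambda>x. bsum (\<lambda>y. twist q 2 n ?M x y * right x y * cup_weight q 2 y))) (?L2 f)"
    using zipper_closed[OF q_nonzero, of 2 n ?M right f] N by (simp add: numeral_3_eq_3 numeral_2_eq_2)
  have "site 1 left (?L2 (?L1 (site N right (site 1 left (?L2 f)))))
      = ?L2 (site 1 left (cup q 1 (site 1 left (?L3 (site N right (?L2 f))))))"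
    unfolding cups1 by (simp only: comm')
  also have "\<dots> = site 1 left (?L2 (site 2 ?M (?L3 (site N right (?L2 f)))))"
    unfolding start by (simp only: comm')
  also have "\<dots> = smul (bsum (\<lambda>x. bsum (\<lambda>y. twist q 2 n ?M x y * right x y * cup_weight q 2 y))) (site 1 left (?L2 f))"
    unfolding closed smul_linear by (rule refl)
  also have "bsum (\<lambda>x. bsum (\<lambda>y. twist q 2 n ?M x y * right x y * cup_weight q 2 y)) = b"
    unfolding b_odd[OF N, symmetric] twist_def numeral_2_eq_2 cup_weight_simps(1)[OF q_nonzero] One_nat_def[symmetric]
    using cup_weight_nonzero[OF q_nonzero, of 1] by (simp add: field_simps)
  finally show "act (spaced 0 (n + 2)) (act (spaced 1 (n + 2)) (act (spaced 0 (n + 2)) f)) = smul b (act (spaced 0 (n + 2)) f)"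
    unfolding act1 act0 .
qed

end

section \<open>Extension to the free algebra and nonvanishing\<close>

context spin_chain
begin

definition eval :: "free_elem \<Rightarrow> spin_space \<Rightarrow> spin_space"
  where "eval f v = (\<lambda>\<sigma>. \<Sum>w\<in>Poly_Mapping.keys f. Poly_Mapping.lookup f w * act (letters w) v \<sigma>)"

lemma gen_linear:
  "gen i (smul c f) = smul c (gen i f)"
  "gen i (\<lambda>\<sigma>. f \<sigma> + g \<sigma>) = (\<lambda>\<sigma>. gen i f \<sigma> + gen i g \<sigma>)"
  by (simp_all add: gen_def smul_linear spin_additive)

lemma act_linear:
  "act l (smul c f) = smul c (act l f)"
  "act l (\<lambda>\<sigma>. f \<sigma> + g \<sigma>) = (\<lambda>\<sigma>. act l f \<sigma> + act l g \<sigma>)"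
  by (induction l) (simp_all add: gen_linear)

lemma act_zero: "act l (\<lambda>_. 0) = (\<lambda>_. 0)"
  using act_linear(1)[of l 0 "\<lambda>_. 0"] by (simp add: smul_def)

lemma eval_zero: "eval 0 v = (\<lambda>_. 0)"
  by (simp add: eval_def)

lemma eval_add: "eval (f + g) v = (\<lambda>\<sigma>. eval f v \<sigma> + eval g v \<sigma>)"
  unfolding eval_def
  by (rule ext, rule setsum_keys_plus_distrib) (simp_all add: distrib_right)

lemma eval_single: "eval (Poly_Mapping.single w c) v = smul c (act (letters w) v)"
  by (simp add: eval_def smul_def)

lemma eval_scalar: "eval (scalar c) v = smul c v"
  by (simp add: scalar_def eval_single)

lemma eval_monom_word: "eval (monom_word l) v = act l v"
  by (simp add: monom_word_def eval_single smul_def)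

lemma eval_minus: "eval (f - g) v = (\<lambda>\<sigma>. eval f v \<sigma> - eval g v \<sigma>)"
  using eval_add[of "f - g" g v] by (simp add: fun_eq_iff)

lemma eval_single_mult: "eval (Poly_Mapping.single w c * g) v = smul c (act (letters w) (eval g v))"
proof (induction g rule: poly_mapping_sum_induct)
  case zero
  then show ?case by (simp add: eval_zero act_zero smul_def)
next
  case (single k d)
  then show ?case
    by (simp add: mult_single eval_single act_linear) (simp add: smul_def mult.assoc)
next
  case (add f g)
  then show ?case by (simp add: distrib_left eval_add act_linear smul_def)
qed

lemma eval_mult: "eval (f * g) v = eval f (eval g v)"
  by (induction f rule: poly_mapping_sum_induct)
    (simp_all add: eval_zero eval_single eval_single_mult eval_add distrib_right)

lemma kernel_ideal: "ideal {f \<in> free_carrier N. \<forall>v. eval f v = (\<lambda>_. 0)} (free_alg N)"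
proof (rule ideal_free_algI)
  have zero: "eval f (\<lambda>_. 0) = (\<lambda>_. 0)" for f
    by (simp add: eval_def act_zero)
  fix f g
  assume "f \<in> {f \<in> free_carrier N. \<forall>v. eval f v = (\<lambda>_. 0)}" "g \<in> free_carrier N"
  then show "f * g \<in> {f \<in> free_carrier N. \<forall>v. eval f v = (\<lambda>_. 0)}"
    "g * f \<in> {f \<in> free_carrier N. \<forall>v. eval f v = (\<lambda>_. 0)}"
    by (simp_all add: free_carrier_closed eval_mult zero)
qed (auto simp: free_carrier_closed eval_zero eval_add)

lemma parity_words_N:
  "N = 2 * n + 2 \<Longrightarrow> filter odd [0..<N + 1] = spaced 1 (Suc n)"
  "N = 2 * n + 2 \<Longrightarrow> filter even [0..<N + 1] = spaced 0 (n + 2)"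
  "N = 2 * n + 3 \<Longrightarrow> filter odd [0..<N + 1] = spaced 1 (n + 2)"
  "N = 2 * n + 3 \<Longrightarrow> filter even [0..<N + 1] = spaced 0 (n + 2)"
  using parity_words[of "Suc n"] spaced_snoc[of 1 "Suc n"]
  by (simp_all add: numeral_3_eq_3)

lemma I_relations:
  "act (filter odd [0..<N + 1]) (act (filter even [0..<N + 1]) (act (filter odd [0..<N + 1]) f))
    = smul b (act (filter odd [0..<N + 1]) f)"
  "act (filter even [0..<N + 1]) (act (filter odd [0..<N + 1]) (act (filter even [0..<N + 1]) f))
    = smul b (act (filter even [0..<N + 1]) f)"
proof -
  have "\<exists>n. N = 2 * n + 2 \<or> N = 2 * n + 3"
    using N_ge_2 by presburger
  then obtain n where "N = 2 * n + 2 \<or> N = 2 * n + 3" ..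
  then show "act (filter odd [0..<N + 1]) (act (filter even [0..<N + 1]) (act (filter odd [0..<N + 1]) f))
      = smul b (act (filter odd [0..<N + 1]) f)"
    "act (filter even [0..<N + 1]) (act (filter odd [0..<N + 1]) (act (filter even [0..<N + 1]) f))
      = smul b (act (filter even [0..<N + 1]) f)"
    using parity_words_N[of n] even_case[of n f] odd_case[of n f] by metis+
qed

definition all_up :: spin_space
  where "all_up \<sigma> = (if \<forall>j. \<sigma> j then 1 else 0)"

lemma cups_all_up_vanish:
  "j < k \<Longrightarrow> \<not> \<sigma> j \<Longrightarrow> cups q (spaced k n) all_up \<sigma> = 0"
  by (induction n arbitrary: k \<sigma>) (auto simp: spaced_simps cup_def all_up_def)

text \<open>At the all-up configuration each cup contributes its weight only: the term with spins k
  and k + 1 flipped vanishes, as the later cups do not touch site k.\<close>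

lemma cups_all_up: "cups q (spaced k n) all_up (\<lambda>_. True) \<noteq> 0"
proof (induction n arbitrary: k)
  case 0
  then show ?case by (simp add: spaced_simps all_up_def)
next
  case (Suc n)
  have up: "(\<lambda>_. True)(k := True, Suc k := True) = (\<lambda>_. True)" for k :: nat
    by (simp add: fun_eq_iff)
  have "cups q (spaced (k + 2) n) all_up ((\<lambda>_. True)(k := False, Suc k := False)) = 0"
    by (rule cups_all_up_vanish[of k]) simp_all
  moreover have "cup q k f (\<lambda>_. True) = cup_weight q k True *
      (f ((\<lambda>_. True)(k := True, Suc k := True)) + f ((\<lambda>_. True)(k := False, Suc k := False)))" for f
    by (simp add: cup_def)
  ultimately have "cups q (spaced k (Suc n)) all_up (\<lambda>_. True)
      = cup_weight q k True * cups q (spaced (k + 2) n) all_up (\<lambda>_. True)"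
    by (simp only: spaced_simps foldr.simps comp_apply up add_0_right)
  then show ?case
    using Suc.IH[of "k + 2"] cup_weight_nonzero[OF q_nonzero] by simp
qed

lemma I_nonzero:
  "\<exists>v. act (if even N then filter odd [0..<N + 1] else filter even [0..<N + 1]) v \<noteq> (\<lambda>_. 0)"
proof -
  have "\<exists>n. N = 2 * n + 2 \<or> N = 2 * n + 3"
    using N_ge_2 by presburger
  then obtain n where n: "N = 2 * n + 2 \<or> N = 2 * n + 3" ..
  then show ?thesis
  proof
    assume N: "N = 2 * n + 2"
    then have "act (filter odd [0..<N + 1]) all_up = cups q (spaced 1 (Suc n)) all_up"
      unfolding parity_words_N(1)[OF N] by (intro act_spaced) simp_all
    then have "act (filter odd [0..<N + 1]) all_up \<noteq> (\<lambda>_. 0)"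
      using cups_all_up by metis
    moreover have "even N" using N by simp
    ultimately show ?thesis by metis
  next
    assume N: "N = 2 * n + 3"
    have "spaced 0 (n + 2) = 0 # spaced 2 (Suc n)"
      using spaced_simps(2)[of 0 "Suc n"] by (simp add: numeral_2_eq_2)
    moreover have "act (spaced 2 (Suc n)) all_up = cups q (spaced 2 (Suc n)) all_up"
      using N by (intro act_spaced) simp_all
    ultimately have "act (filter even [0..<N + 1]) all_up = site 1 left (cups q (spaced 2 (Suc n)) all_up)"
      unfolding parity_words_N(4)[OF N] by (simp only: foldr.simps comp_apply gen_simps)
    moreover have "site 1 left (cups q (spaced 2 (Suc n)) all_up) (\<lambda>_. True)
        = m True * cups q (spaced 2 (Suc n)) all_up (\<lambda>_. True)"
    proof -
      have "cups q (spaced 2 (Suc n)) all_up ((\<lambda>_. True)(1 := False)) = 0"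
        by (rule cups_all_up_vanish[of 1]) simp_all
      moreover have "(\<lambda>_. True)(1 := True) = (\<lambda>_::nat. True)" by (simp add: fun_eq_iff)
      ultimately show ?thesis by (simp add: site_def)
    qed
    ultimately have "act (filter even [0..<N + 1]) all_up (\<lambda>_. True) \<noteq> 0"
      using m_nonzero cups_all_up by (metis mult_eq_0_iff)
    then have "act (filter even [0..<N + 1]) all_up \<noteq> (\<lambda>_. 0)" by metis
    moreover have "\<not> even N" using N by simp
    ultimately show ?thesis by metis
  qed
qed

end

text \<open>For odd \<open>N\<close> the weights of the two spins on the last site are interchanged, because the
  cup weights alternate along the chain.\<close>

lemma (in quantum) spin_chain_exists:
  assumes N: "N \<ge> 2" and generic: "qn (\<omega>\<^sub>1 + 1) \<noteq> 0" "qn (\<omega>\<^sub>2 + 1) \<noteq> 0"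
  shows "\<exists>m \<mu> \<nu>. spin_chain N q m \<mu> \<nu> (s1_par \<eta> \<omega>\<^sub>1) (s2_par \<eta> \<omega>\<^sub>2) (b_weight N \<eta> \<omega>\<^sub>1 \<omega>\<^sub>2 \<theta>)"
proof -
  define Q1 Q2 T where "Q1 = qpow \<eta> \<omega>\<^sub>1" and "Q2 = qpow \<eta> \<omega>\<^sub>2" and "T = qpow \<eta> \<theta>"
  define D1 D2 where "D1 = D * qn (\<omega>\<^sub>1 + 1)" and "D2 = D * qn (\<omega>\<^sub>2 + 1)"
  have nz [simp]: "Q1 \<noteq> 0" "Q2 \<noteq> 0" "T \<noteq> 0" "q \<noteq> 0" "D1 \<noteq> 0" "D2 \<noteq> 0"
    using generic by (simp_all add: Q1_def Q2_def T_def D1_def D2_def)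
  define n where "n = (N - 2) div 2"
  \<comment> \<open>The right boundary conditions fix only the products of \<open>\<mu>\<close> and
    \<open>\<nu>\<close>, leaving t free. It is chosen so that the t-dependent terms of the loop
    product become -T and -1/T for even N, T and 1/T for odd N.\<close>
  define t where "t = (if even N then - T * Q1 * Q2 / q ^ (2 * n + 1) else T * q ^ (2 * n + 2) / (Q1 * Q2))"
  have t: "t \<noteq> 0" by (simp add: t_def)
  have p2: "q ^ (2 * n + 1) = q * q ^ n * q ^ n" "q ^ (2 * n + 2) = q * q * q ^ n * q ^ n"
    by (simp_all add: power_add mult_2)
  \<comment> \<open>The solution of m True + m False = s_1 and m True / q + q m False = 1.\<close>
  define m where "m x = (if x then - 1 / (Q1 * D1) else Q1 / D1)" for x :: bool
  define \<nu> where "\<nu> x = (if x then 1 else t)" for x :: bool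
  define \<mu> where "\<mu> x = (if even N then if x then - 1 / (Q2 * D2) else Q2 / (t * D2)
      else if x then Q2 / D2 else - 1 / (Q2 * t * D2))" for x :: bool
  have D1: "D1 = q * Q1 - 1 / (q * Q1)" and D2: "D2 = q * Q2 - 1 / (q * Q2)"
    by (simp_all add: D1_def D2_def qn_plus_1 Q1_def Q2_def mult.commute)
  have s: "s1_par \<eta> \<omega>\<^sub>1 = (Q1 - 1 / Q1) / D1" "s2_par \<eta> \<omega>\<^sub>2 = (Q2 - 1 / Q2) / D2"
    using generic by (simp_all add: s1_par_def s2_par_def D1_def D2_def Q1_def Q2_def qn_eq[of \<omega>\<^sub>1] qn_eq[of \<omega>\<^sub>2])
  have w: "cup_weight q 1 True = 1 / q" "cup_weight q 1 False = q"
    by (simp_all add: cup_weight_def)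
  have b_weight: "b_weight N \<eta> \<omega>\<^sub>1 \<omega>\<^sub>2 \<theta> =
    (if even N then (q * Q1 * Q2 + 1 / (q * Q1 * Q2) - (T + 1 / T)) / (D1 * D2)
     else - (Q1 / Q2 + Q2 / Q1 - (T + 1 / T)) / (D1 * D2))"
    unfolding b_weight_def qn_mult_halves
    by (simp add: qpow_add qpow_diff qpow_minus Q1_def Q2_def T_def D1_def D2_def mult_ac
        minus_divide_left)
  have "spin_chain N q m \<mu> \<nu> (s1_par \<eta> \<omega>\<^sub>1) (s2_par \<eta> \<omega>\<^sub>2) (b_weight N \<eta> \<omega>\<^sub>1 \<omega>\<^sub>2 \<theta>)"
  proof
    show "N \<ge> 2" "q \<noteq> 0" "m True \<noteq> 0" using N by (simp_all add: m_def)
    show "bsum m = s1_par \<eta> \<omega>\<^sub>1"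
      by (simp add: m_def s diff_divide_distrib)
    show "bsum (\<lambda>x. m x * cup_weight q 1 x) = 1"
    proof -
      have "bsum (\<lambda>x. m x * cup_weight q 1 x) = (q * Q1 - 1 / (q * Q1)) / D1"
        by (simp add: m_def w[unfolded One_nat_def] diff_divide_distrib mult_ac)
      then show ?thesis by (simp only: D1[symmetric]) simp
    qed
    show "bsum (\<lambda>x. \<mu> x * \<nu> x) = s2_par \<eta> \<omega>\<^sub>2"
      using t by (simp add: \<mu>_def \<nu>_def s diff_divide_distrib)
    show "bsum (\<lambda>x. \<mu> x * \<nu> x * cup_weight q (N - 1) x) = 1"
    proof -
      have "bsum (\<lambda>x. \<mu> x * \<nu> x * cup_weight q (N - 1) x) = (q * Q2 - 1 / (q * Q2)) / D2"
        using t N by (simp add: \<mu>_def \<nu>_def cup_weight_def diff_divide_distrib mult_ac)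
      then show ?thesis by (simp only: D2[symmetric]) simp
    qed
  next
    fix k assume k: "N = 2 * k + 2"
    then have n: "k = n" "even N" by (simp_all add: n_def)
    then have t': "t = - T * Q1 * Q2 / q ^ (2 * n + 1)" by (simp add: t_def)
    show "bsum (\<lambda>x. m x * \<mu> x / cup_weight q 1 x ^ k) * bsum (\<lambda>y. \<nu> y * cup_weight q 1 y ^ Suc k)
        = b_weight N \<eta> \<omega>\<^sub>1 \<omega>\<^sub>2 \<theta>"
    proof -
      have "bsum (\<lambda>x. m x * \<mu> x / cup_weight q 1 x ^ k) * bsum (\<lambda>y. \<nu> y * cup_weight q 1 y ^ Suc k)
        = (q ^ n / (Q1 * Q2) + Q1 * Q2 / (t * q ^ n)) * (1 / q ^ Suc n + t * q ^ Suc n) / (D1 * D2)"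
        unfolding n(1) w m_def \<mu>_def \<nu>_def using n(2) t by (simp add: power_divide field_simps)
      also have "(q ^ n / (Q1 * Q2) + Q1 * Q2 / (t * q ^ n)) * (1 / q ^ Suc n + t * q ^ Suc n)
        = 1 / (q * Q1 * Q2) + q * Q1 * Q2 + t * q ^ (2 * n + 1) / (Q1 * Q2) + Q1 * Q2 / (t * q ^ (2 * n + 1))"
        unfolding p2 using t by (simp add: field_simps)
      also have "t * q ^ (2 * n + 1) / (Q1 * Q2) = - T"
        unfolding t' by simp
      also have "Q1 * Q2 / (t * q ^ (2 * n + 1)) = - 1 / T"
        unfolding t' by simp
      finally show ?thesis
        using n(2) by (simp add: b_weight algebra_simps)
    qed
  next
    fix k assume k: "N = 2 * k + 3"
    then have n: "k = n" "odd N" by (simp_all add: n_def)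
    then have t': "t = T * q ^ (2 * n + 2) / (Q1 * Q2)" by (simp add: t_def)
    show "bsum (\<lambda>x. m x * \<nu> x / cup_weight q 1 x ^ Suc k) * bsum (\<lambda>y. \<mu> y * cup_weight q 1 y ^ Suc k)
        = b_weight N \<eta> \<omega>\<^sub>1 \<omega>\<^sub>2 \<theta>"
    proof -
      have "bsum (\<lambda>x. m x * \<nu> x / cup_weight q 1 x ^ Suc k) * bsum (\<lambda>y. \<mu> y * cup_weight q 1 y ^ Suc k)
        = (- (q ^ Suc n / Q1) + t * Q1 / q ^ Suc n) * (Q2 / q ^ Suc n - q ^ Suc n / (Q2 * t)) / (D1 * D2)"
        unfolding n(1) w m_def \<mu>_def \<nu>_def using n(2) t by (simp add: power_divide field_simps)
      also have "(- (q ^ Suc n / Q1) + t * Q1 / q ^ Suc n) * (Q2 / q ^ Suc n - q ^ Suc n / (Q2 * t))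
        = - (Q2 / Q1) - Q1 / Q2 + q ^ (2 * n + 2) / (Q1 * Q2 * t) + t * Q1 * Q2 / q ^ (2 * n + 2)"
        unfolding p2 using t by (simp add: field_simps)
      also have "q ^ (2 * n + 2) / (Q1 * Q2 * t) = 1 / T"
        unfolding t' by simp
      also have "t * Q1 * Q2 / q ^ (2 * n + 2) = T"
        unfolding t' by simp
      finally show ?thesis
        using n(2) by (simp add: b_weight algebra_simps)
    qed
  qed
  then show ?thesis by blast
qed

section \<open>The Gram matrix\<close>

locale generic_quotient = double_quotient_alg N \<eta> \<omega>\<^sub>1 \<omega>\<^sub>2 \<theta> + quantum \<eta>
  for N :: nat and \<eta> \<omega>\<^sub>1 \<omega>\<^sub>2 \<theta> :: complex +
  assumes generic1: "qnum \<eta> (\<omega>\<^sub>1 - of_int m) \<noteq> 0"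
    and generic2: "qnum \<eta> (\<omega>\<^sub>2 + 1) \<noteq> 0"
begin

lemma I_word_notin_J:
  "monom_word (if even N then filter odd [0..<N + 1] else filter even [0..<N + 1]) \<notin> J"
proof -
  have "qn (\<omega>\<^sub>1 + 1) \<noteq> 0" using generic1[of "-1"] by simp
  then obtain m \<mu> \<nu> where
    "spin_chain N q m \<mu> \<nu> (s1_par \<eta> \<omega>\<^sub>1) (s2_par \<eta> \<omega>\<^sub>2) (b_weight N \<eta> \<omega>\<^sub>1 \<omega>\<^sub>2 \<theta>)"
    using spin_chain_exists[OF N_ge_2 _ generic2] by blast
  then interpret spin: spin_chain N q m \<mu> \<nu> "s1_par \<eta> \<omega>\<^sub>1" "s2_par \<eta> \<omega>\<^sub>2" "b_weight N \<eta> \<omega>\<^sub>1 \<omega>\<^sub>2 \<theta>" .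
  note eval = spin.eval_minus spin.eval_mult spin.eval_scalar spin.eval_monom_word smul_def fun_eq_iff
  have "spin.eval f v = (\<lambda>_. 0)" if f: "f \<in> tbtl_relators N \<eta> \<omega>\<^sub>1 \<omega>\<^sub>2 \<union> dq_relators N \<eta> \<omega>\<^sub>1 \<omega>\<^sub>2 \<theta>" for f v
  proof -
    consider i where "1 \<le> i" "i < N" "f = monom_word [i, i] - scalar (qn 2) * monom_word [i]"
      | i where "1 \<le> i" "i < N" "f = monom_word [i, i + 1, i] - monom_word [i]"
      | i where "1 \<le> i" "i < N" "f = monom_word [i, i - 1, i] - monom_word [i]"
      | "f = monom_word [0, 0] - scalar (s1_par \<eta> \<omega>\<^sub>1) * monom_word [0]"
      | "f = monom_word [N, N] - scalar (s2_par \<eta> \<omega>\<^sub>2) * monom_word [N]"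
      | i j where "i \<le> N" "j \<le> N" "Suc i < j \<or> Suc j < i" "f = monom_word [i, j] - monom_word [j, i]"
      | "f = I1_elem N * I2_elem N * I1_elem N - scalar (b_weight N \<eta> \<omega>\<^sub>1 \<omega>\<^sub>2 \<theta>) * I1_elem N"
      | "f = I2_elem N * I1_elem N * I2_elem N - scalar (b_weight N \<eta> \<omega>\<^sub>1 \<omega>\<^sub>2 \<theta>) * I2_elem N"
    proof -
      have *: "\<bar>int i - int j\<bar> > 1 \<Longrightarrow> Suc i < j \<or> Suc j < i" for i j by auto
      show ?thesis
        using f that * unfolding tbtl_relators_def dq_relators_def by blast
    qed
    then show ?thesis
    proof cases
      case 1
      then show ?thesis using spin.gen_relations(1) by (simp add: eval qn_2)
    next
      case 2
      then show ?thesis using spin.gen_relations(4) by (simp add: eval)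
    next
      case 3
      then show ?thesis using spin.gen_relations(5) by (simp add: eval)
    next
      case 4
      then show ?thesis using spin.gen_relations(2) by (simp add: eval)
    next
      case 5
      then show ?thesis using spin.gen_relations(3) by (simp add: eval)
    next
      case 6
      then show ?thesis using spin.gen_relations(6)[of i j v] spin.gen_relations(6)[of j i v] by (auto simp: eval)
    next
      case 7
      then show ?thesis using spin.I_relations(1)[of v]
        by (simp add: eval I1_elem_def I2_elem_def del: upt_Suc filter.simps)
    next
      case 8
      then show ?thesis using spin.I_relations(2)[of v]
        by (simp add: eval I1_elem_def I2_elem_def del: upt_Suc filter.simps)
    qed
  qed
  moreover have "f \<in> free_carrier N" if "f \<in> tbtl_relators N \<eta> \<omega>\<^sub>1 \<omega>\<^sub>2 \<union> dq_relators N \<eta> \<omega>\<^sub>1 \<omega>\<^sub>2 \<theta>" for f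
    using subsetD[OF relators_carrier[OF N_ge_2] that] by (simp add: free_alg_simps)
  ultimately have "J \<subseteq> {f \<in> free_carrier N. \<forall>v. spin.eval f v = (\<lambda>_. 0)}"
    by (intro J_minimal spin.kernel_ideal) blast
  moreover obtain v where "spin.act (if even N then filter odd [0..<N + 1] else filter even [0..<N + 1]) v \<noteq> (\<lambda>_. 0)"
    using spin.I_nonzero by blast
  ultimately show ?thesis
    unfolding spin.eval_monom_word[symmetric] by blast
qed

section \<open>Transfer of the relations to the product ring\<close>

abbreviation gen :: "nat \<Rightarrow> free_elem set" where "gen \<equiv> egen N \<eta> \<omega>\<^sub>1 \<omega>\<^sub>2 \<theta>"
abbreviation fgen :: "nat \<Rightarrow> family" where "fgen i \<equiv> embed (gen i)"
abbreviation s1 :: complex where "s1 \<equiv> s1_par \<eta> \<omega>\<^sub>1"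
abbreviation b :: complex where "b \<equiv> b_weight N \<eta> \<omega>\<^sub>1 \<omega>\<^sub>2 \<theta>"

text \<open>The word must be nonempty: the empty one would give the unit of a single factor instead
  of 1. For the same reason \<open>embed_E_idem\<close> starts at n = 1.\<close>

lemma embed_monom_word:
  "set l \<subseteq> {..N} \<Longrightarrow> l \<noteq> [] \<Longrightarrow> embed (cl (monom_word l)) = prod_list (map fgen l)"
proof (induction l)
  case (Cons i l)
  show ?case
  proof (cases "l = []")
    case True
    then show ?thesis by (simp add: egen_def)
  next
    case False
    have "monom_word (i # l) = monom_word [i] * monom_word l"
      by (simp add: monom_word_mult)
    then show ?thesis
      using Cons False by (simp add: cl_mult egen_def embed_hom(1))
  qed
qed simp

lemma embed_sc: "x \<in> carrier A \<Longrightarrow> embed (sc c x) = scale_family c (embed x)"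
  by (rule embed_hom(4))

lemma embed_relation:
  assumes "monom_word l - scalar c * monom_word k \<in> J" "set l \<subseteq> {..N}" "set k \<subseteq> {..N}" "l \<noteq> []" "k \<noteq> []"
  shows "prod_list (map fgen l) = scale_family c (prod_list (map fgen k))"
proof -
  have "cl (monom_word l) = cl (scalar c * monom_word k)"
    using assms by (simp add: cl_eq_iff free_carrier_closed)
  then have "embed (cl (monom_word l)) = embed (sc c (cl (monom_word k)))"
    using assms by (simp add: scale_by_cl)
  then show ?thesis
    using assms by (simp add: embed_sc embed_monom_word)
qed

lemma relator_members:
  "1 \<le> i \<Longrightarrow> i < N \<Longrightarrow> monom_word [i, i] - scalar (qn 2) * monom_word [i] \<in> J"
  "1 \<le> i \<Longrightarrow> i < N \<Longrightarrow> monom_word [i, i + 1, i] - scalar 1 * monom_word [i] \<in> J"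
  "1 \<le> i \<Longrightarrow> i < N \<Longrightarrow> monom_word [i, i - 1, i] - scalar 1 * monom_word [i] \<in> J"
  "monom_word [0, 0] - scalar s1 * monom_word [0] \<in> J"
  "monom_word [N, N] - scalar (s2_par \<eta> \<omega>\<^sub>2) * monom_word [N] \<in> J"
  "i \<le> N \<Longrightarrow> j \<le> N \<Longrightarrow> Suc i < j \<Longrightarrow> monom_word [i, j] - scalar 1 * monom_word [j, i] \<in> J"
  unfolding scalar_1 mult_1_left
  by (rule relator_in_J, force simp: tbtl_relators_def)+

lemma s1_nonzero: "s1 \<noteq> 0"
  using generic1[of 0] generic1[of "-1"] by (simp add: s1_par_def)

lemma family_TL: "one_boundary_TL scale_family fgen N s1"
proof
  show "N \<ge> 2" "s1 \<noteq> 0" by (fact N_ge_2 s1_nonzero)+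
  show "fgen i * fgen (Suc i) * fgen i = fgen i" if "1 \<le> i" "i < N" for i
    using embed_relation[OF relator_members(2)[OF that]] that by (simp add: mult.assoc)
  show "fgen i * fgen (i - 1) * fgen i = fgen i" if "1 \<le> i" "i < N" for i
    using embed_relation[OF relator_members(3)[OF that]] that by (simp add: mult.assoc)
  show "fgen 0 * fgen 0 = scale_family s1 (fgen 0)"
    using embed_relation[OF relator_members(4)] by simp
  show "fgen i * fgen j = fgen j * fgen i" if "i \<le> N" "j \<le> N" "Suc i < j" for i j
    using embed_relation[OF relator_members(6)[OF that]] that by simp
qed

lemma family_double_quotient: "double_quotient scale_family fgen N s1 b"
proof -
  interpret one_boundary_TL scale_family fgen N s1 by (rule family_TL)
  \<comment> \<open>The parity decides which of I_1 and I_2 is \<open>I N\<close>; its word consists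
    of the indices below N with parity opposite to N.\<close>
  define F G where "F = (if even N then I1_elem N else I2_elem N)" and "G = (if even N then I2_elem N else I1_elem N)"
  have "F * G * F - scalar b * F \<in> J"
    by (rule relator_in_J) (simp add: F_def G_def dq_relators_def)
  moreover have FG: "F \<in> free_carrier N" "G \<in> free_carrier N" by (simp_all add: F_def G_def)
  ultimately have "cl (F * G * F) = cl (scalar b * F)"
    by (simp add: cl_eq_iff free_carrier_closed)
  then have "cl F \<otimes>\<^bsub>A\<^esub> cl G \<otimes>\<^bsub>A\<^esub> cl F = sc b (cl F)"
    using FG by (simp add: scale_by_cl cl_mult[symmetric] free_carrier_closed)
  then have "embed (cl F \<otimes>\<^bsub>A\<^esub> cl G \<otimes>\<^bsub>A\<^esub> cl F) = embed (sc b (cl F))" by simp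
  then have *: "embed (cl F) * embed (cl G) * embed (cl F) = scale_family b (embed (cl F))"
    using FG by (simp add: embed_hom(1) embed_sc)
  have ne: "filter (\<lambda>j. odd (n + j)) [0..<n] \<noteq> []" if "n > 0" for n
  proof -
    have "n - 1 \<in> set (filter (\<lambda>j. odd (n + j)) [0..<n])" using that by auto
    then show ?thesis by (metis empty_iff empty_set)
  qed
  have I_eq: "I n = embed (cl (monom_word (filter (\<lambda>j. odd (n + j)) [0..<n])))" if "0 < n" "n \<le> Suc N" for n
    using that ne[OF that(1)] by (subst I_eq_prod_list) (auto intro!: embed_monom_word[symmetric])
  have "F = monom_word (filter (\<lambda>j. odd (N + j)) [0..<N])"
    "G = monom_word (filter (\<lambda>j. odd (Suc N + j)) [0..<Suc N])"
    by (auto simp: F_def G_def I1_elem_def I2_elem_def)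
  then have "I N = embed (cl F)" "I (Suc N) = embed (cl G)"
    using I_eq[of N] I_eq[of "Suc N"] N_ge_2 by simp_all
  then show ?thesis
    using * by unfold_locales simp
qed

lemma embed_E_idem:
  assumes "1 \<le> n" "n \<le> N"
  shows "embed (E_idem N \<eta> \<omega>\<^sub>1 \<omega>\<^sub>2 \<theta> n) = one_boundary_TL.E scale_family fgen s1 n"
  using assms
proof (induction n)
  case (Suc n)
  interpret one_boundary_TL scale_family fgen N s1 by (rule family_TL)
  have c: "s1 powi ((-1) ^ Suc n) = 1 / cf n"
    by (simp add: cf_def power_int_minus divide_inverse)
  have closed: "E_idem N \<eta> \<omega>\<^sub>1 \<omega>\<^sub>2 \<theta> n \<in> carrier A" "gen n \<in> carrier A"
    using Suc.prems by (simp_all add: E_idem_closed)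
  show ?case
  proof (cases "n = 0")
    case True
    then show ?thesis
      using closed c by (simp add: embed_sc E.simps)
  next
    case False
    then have "embed (E_idem N \<eta> \<omega>\<^sub>1 \<omega>\<^sub>2 \<theta> n) = E n" using Suc by simp
    then show ?thesis
      using closed c
      by (simp add: E.simps embed_hom(1) embed_sc del: power_Suc)
  qed
qed simp

lemma E_N_nonzero: "E_N \<noteq> \<zero>\<^bsub>A\<^esub>"
proof
  interpret double_quotient scale_family fgen N s1 b by (rule family_double_quotient)
  let ?l = "if even N then filter odd [0..<N + 1] else filter even [0..<N + 1]"
  assume "E_N = \<zero>\<^bsub>A\<^esub>"
  then have "E N = 0"
    using embed_E_idem[of N] embed_0 N_ge_2 by simp
  then have "I N = 0"
    by (rule E_zero_imp_I_zero)
  moreover have "filter (\<lambda>j. odd (N + j)) [0..<N] = ?l"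
    by auto
  ultimately have "prod_list (map fgen ?l) = 0"
    using I_eq_prod_list[of N] by simp
  moreover have l: "set ?l \<subseteq> {..N}" "?l \<noteq> []"
  proof -
    show "set ?l \<subseteq> {..N}" by (auto simp del: upt_Suc)
    have "(if even N then 1 else 0) \<in> set ?l" using N_ge_2 by auto
    then show "?l \<noteq> []" by (metis empty_iff empty_set)
  qed
  ultimately have "embed (cl (monom_word ?l)) = embed \<zero>\<^bsub>A\<^esub>"
    using embed_monom_word[OF l] embed_0 by simp
  then have "cl (monom_word ?l) = cl 0"
    using l by (subst (asm) embed_inject) (simp_all add: cl_0)
  then have "monom_word ?l \<in> J"
    using l(1) by (subst (asm) cl_eq_iff) (simp_all add: free_carrier_closed)
  then show False using I_word_notin_J by blast
qed

lemma X_op_mult: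
  assumes "i \<le> N" "y \<in> carrier A"
  shows "X_op N \<eta> \<omega>\<^sub>1 \<omega>\<^sub>2 \<theta> i u \<otimes>\<^bsub>A\<^esub> y = (gen i \<otimes>\<^bsub>A\<^esub> y) \<ominus>\<^bsub>A\<^esub> sc (weight N \<eta> \<omega>\<^sub>2 \<theta> i u) y"
proof -
  obtain f where f: "f \<in> free_carrier N" "y = cl f"
    using assms(2) by (rule cl_cases)
  then show ?thesis
    using assms(1)
    by (simp add: X_op_eq egen_def scale_by_cl cl_mult[symmetric] cl_minus[symmetric] free_carrier_closed
        left_diff_distrib)
qed

lemma family_path_module:
  "path_module \<eta> \<omega>\<^sub>1 \<omega>\<^sub>2 \<theta> scale_family fgen N (\<lambda>p. embed (b_elt p)) transpose_family"
proof -
  interpret double_quotient scale_family fgen N s1 b by (rule family_double_quotient)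
  show ?thesis
  proof
    show "fgen i * fgen i = scale_family (qnum \<eta> 2) (fgen i)" if "1 \<le> i" "i < N" for i
      using embed_relation[OF relator_members(1)[OF that]] that by simp
    show "fgen N * fgen N = scale_family (s2_par \<eta> \<omega>\<^sub>2) (fgen N)"
      using embed_relation[OF relator_members(5)] by simp
    show "qnum \<eta> (\<omega>\<^sub>1 - of_int m) \<noteq> 0" for m by (rule generic1)
    show "qnum \<eta> (\<omega>\<^sub>2 + 1) \<noteq> 0" by (rule generic2)
    show "embed (b_elt (fundamental_path N)) = E N"
      using embed_E_idem[of N] N_ge_2 by (simp add: b_elt_fundamental)
    show "embed (b_elt p) = fgen i * embed (b_elt (remove_tile p i))
        - scale_family (weight N \<eta> \<omega>\<^sub>2 \<theta> i (spectral \<omega>\<^sub>1 (p ! (i - 1)))) (embed (b_elt (remove_tile p i)))"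
      if p: "p \<in> paths N" and i: "removable N p i" for p i
    proof -
      have iN: "i \<le> N" using i unfolding removable_def by blast
      have closed: "b_elt (remove_tile p i) \<in> carrier A"
        by (rule b_elt_closed[OF remove_tile_in_paths[OF p i]])
      show ?thesis
        unfolding b_elt_add_tile[OF p i] X_op_mult[OF iN closed]
        using iN closed by (simp add: embed_hom(1) embed_hom(3) embed_sc)
    qed
    show "transpose_family (x * y) = transpose_family y * transpose_family x"
      "transpose_family (x + y) = transpose_family x + transpose_family y"
      "transpose_family (scale_family c x) = scale_family c (transpose_family x)"
      "transpose_family 1 = 1" for x y c
      by (simp_all add: transpose_family transpose_family_one)
    show "transpose_family (fgen i) = fgen i" if "i \<le> N" for i
      by (rule embed_egen_transpose[OF that])
  qed
qed

lemma gram_zero: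
  assumes p: "p \<in> paths N" "p' \<in> paths N" "p \<noteq> p'"
  shows "gram N \<eta> \<omega>\<^sub>1 \<omega>\<^sub>2 \<theta> p p' = 0"
proof -
  interpret path: path_module \<eta> \<omega>\<^sub>1 \<omega>\<^sub>2 \<theta> scale_family fgen N "\<lambda>p. embed (b_elt p)" transpose_family
    by (rule family_path_module)
  have E: "E_N \<in> carrier A" by (simp add: E_idem_closed)
  note closed = b_elt_closed[OF p(1)] b_elt_closed[OF p(2)]
  have "transpose_el E_N = E_N"
  proof -
    have "embed (transpose_el E_N) = embed E_N"
      using path.tr_E[of N] embed_E_idem[of N] N_ge_2 by (simp add: embed_hom(5)[OF E E])
    then show ?thesis
      using E by (simp add: embed_inject transpose_algebra(1)[OF E E])
  qed
  have orth: "transpose_el (b_elt p) \<otimes>\<^bsub>A\<^esub> b_elt p' = \<zero>\<^bsub>A\<^esub>"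
  proof -
    have "embed (transpose_el (b_elt p) \<otimes>\<^bsub>A\<^esub> b_elt p') = embed \<zero>\<^bsub>A\<^esub>"
      using path.v_orthogonal[OF p] closed
      by (simp add: embed_hom(1) embed_hom(5)[OF closed(1) closed(1)] transpose_algebra(1)[OF closed(1) closed(1)] embed_0)
    then show ?thesis
      using closed by (subst (asm) embed_inject) (simp_all add: transpose_algebra(1)[OF closed(1) closed(1)])
  qed
  have scale_0: "sc 0 E_N = \<zero>\<^bsub>A\<^esub>"
  proof -
    have "embed (sc 0 E_N) = embed \<zero>\<^bsub>A\<^esub>"
      by (simp add: embed_sc E embed_0)
    then show ?thesis using E by (subst (asm) embed_inject) simp_all
  qed
  \<comment> \<open>Grouped as (a E_N)^T (a' E_N), the product is b_p^T b_{p'} and thus vanishes for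
    all representatives.\<close>
  have vanish: "E_N \<otimes>\<^bsub>A\<^esub> transpose_el a \<otimes>\<^bsub>A\<^esub> a' \<otimes>\<^bsub>A\<^esub> E_N = \<zero>\<^bsub>A\<^esub>"
    if a: "a \<in> carrier A" "a' \<in> carrier A" "b_elt p = a \<otimes>\<^bsub>A\<^esub> E_N" "b_elt p' = a' \<otimes>\<^bsub>A\<^esub> E_N" for a a'
  proof -
    have "transpose_el (b_elt p) = E_N \<otimes>\<^bsub>A\<^esub> transpose_el a"
      using a E by (simp add: transpose_algebra(2) \<open>transpose_el E_N = E_N\<close>)
    then show ?thesis
      using orth a E by (simp add: A.m_assoc transpose_algebra(1)[OF a(1) a(1)])
  qed
  \<comment> \<open>Without representatives every c would satisfy the defining condition vacuously.
    With one pair at hand, c E_N = 0 follows, and E_N is nonzero.\<close>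
  obtain a a' where a: "a \<in> carrier A" "a' \<in> carrier A" "b_elt p = a \<otimes>\<^bsub>A\<^esub> E_N" "b_elt p' = a' \<otimes>\<^bsub>A\<^esub> E_N"
    using b_elt_in_W_mod[OF p(1)] b_elt_in_W_mod[OF p(2)] by blast
  show ?thesis
    unfolding gram_def gform_def
  proof (rule the_equality)
    show "\<forall>a\<in>carrier A. \<forall>a'\<in>carrier A. b_elt p = a \<otimes>\<^bsub>A\<^esub> E_N \<longrightarrow> b_elt p' = a' \<otimes>\<^bsub>A\<^esub> E_N \<longrightarrow>
        E_N \<otimes>\<^bsub>A\<^esub> transpose_el a \<otimes>\<^bsub>A\<^esub> a' \<otimes>\<^bsub>A\<^esub> E_N = sc 0 E_N"
      using vanish scale_0 by simp
  next
    fix c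
    assume "\<forall>a\<in>carrier A. \<forall>a'\<in>carrier A. b_elt p = a \<otimes>\<^bsub>A\<^esub> E_N \<longrightarrow> b_elt p' = a' \<otimes>\<^bsub>A\<^esub> E_N \<longrightarrow>
        E_N \<otimes>\<^bsub>A\<^esub> transpose_el a \<otimes>\<^bsub>A\<^esub> a' \<otimes>\<^bsub>A\<^esub> E_N = sc c E_N"
    then have zero: "sc c E_N = \<zero>\<^bsub>A\<^esub>"
      using a vanish by metis
    have "scale_family c (embed E_N) = 0"
      using embed_sc[OF E, of c] by (simp add: zero embed_0)
    moreover have "embed E_N \<noteq> 0"
      using E_N_nonzero embed_inject[OF E A.zero_closed] by (simp add: embed_0)
    ultimately show "c = 0" by simp
  qed
qed

end

theorem proposition5p13:
  fixes N :: nat and \<eta> \<omega>\<^sub>1 \<omega>\<^sub>2 \<theta> :: complex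
  assumes "N \<ge> 2"
    and "\<forall>n::nat. n > 0 \<longrightarrow> qpow \<eta> 1 ^ n \<noteq> 1"
    and "\<forall>m::int. qnum \<eta> (\<omega>\<^sub>1 - of_int m) \<noteq> 0"
    and "qnum \<eta> \<omega>\<^sub>2 \<noteq> 0" and "qnum \<eta> (\<omega>\<^sub>2 + 1) \<noteq> 0"
  shows "\<forall>p \<in> paths N. \<forall>p' \<in> paths N. p \<noteq> p' \<longrightarrow> gram N \<eta> \<omega>\<^sub>1 \<omega>\<^sub>2 \<theta> p p' = 0"
proof -
  interpret generic_quotient N \<eta> \<omega>\<^sub>1 \<omega>\<^sub>2 \<theta>
    using assms by unfold_locales simp_all
  show ?thesis using gram_zero by blast
qed

end
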